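(* Let $\mathcal{B}$ be a complex Banach space, let $\Omega\subseteq\mathbb{D}$ be an open neighborhood of the origin, and let $\phi:\Omega\to\mathbf{L}(\mathcal{B}^*,\mathcal{B})$ be a function which is weakly continuous at the origin. Then $\phi$ is a Carath\'eodory function if and only if it admits the representation $$\phi(z)^*=D+C^*(I-z^*V)^{-1}(I+z^*V)C,\quad z\in\Omega,$$ or, equivalently, $$\tau\phi(z)=D^*\big|_{\mathcal{B}^*}+C^*(I+zV^* )(I-zV^* )^{-1}C,\quad z\in\Omega,$$ where $V$ is an isometric operator in some Hilbert space $\mathcal{H}$, $C$ is a bounded operator from $\mathcal{B}^*$ into $\mathcal{H}$, and $D$ is a purely imaginary operator from $\mathcal{B}^*$ into $\mathcal{B}^{**}$. In particular, a Carath\'eodory function $\phi$ has an analytic extension to the whole open unit disk $\mathbb{D}$.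
   Context: $\mathbb{D}$ is the open unit disk in $\mathbb{C}$, and $z^*$ denotes the complex conjugate of $z\in\mathbb{C}$. For a complex Banach space $X$, $X^*$ denotes its conjugate dual, i.e. the space of bounded anti-linear functionals on $X$, and $\langle x_*,x\rangle_{X}:=x_*(x)$ for $x\in X$, $x_*\in X^*$. $\mathbf{L}(X,Y)$ denotes the bounded linear operators from $X$ to $Y$. The natural injection $\tau:X\to X^{**}$ is defined by $\langle\tau(x),x_*\rangle_{X^*}=\overline{\langle x_*,x\rangle_{X}}$; in the statement $\tau$ is the injection $\mathcal{B}\to\mathcal{B}^{**}$. For $A\in\mathbf{L}(X,X^* )$, $A^*\big|_X\in\mathbf{L}(X,X^* )$ is the restriction of the adjoint $A^*:X^{**}\to X^*$ to $X$ via the natural injection $X\to X^{**}$; thus $\langle A^*\big|_{X}c,b\rangle_{X}=\overline{\langle Ab,c\rangle_{X}}$ for $b,c\in X$. An operator $D\in\mathbf{L}(X,X^* )$ is purely imaginary if $D+D^*\big|_X=0$; here this is used with $X=\mathcal{B}^*$. For $\phi(z)\in\mathbf{L}(\mathcal{B}^*,\mathcal{B})$, the adjoint $\phi(z)^*\in\mathbf{L}(\mathcal{B}^*,\mathcal{B}^{**})$ satisfies $\langle\phi(z)^*c_*,b_*\rangle_{\mathcal{B}^*}=\langle c_*,\phi(z)b_*\rangle_{\mathcal{B}}$. For a Hilbert space $\mathcal{H}$ (identified with its conjugate dual) and $C\in\mathbf{L}(X,\mathcal{H})$, $C^*\in\mathbf{L}(\mathcal{H},X^* )$ is given by $\langle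 C^*h,x\rangle_X=\langle h,Cx\rangle_{\mathcal{H}}$; $V^*$ is the Hilbert space adjoint of $V$. An $\mathbf{L}(X,X^* )$-valued kernel $K(z,w)$ on $\Omega\times\Omega$ is positive if for every $n$, all $z_1,\dots,z_n\in\Omega$ and all $x_1,\dots,x_n\in X$ one has $\sum_{i,j=1}^n\langle K(z_i,z_j)x_j,x_i\rangle_{X}\ge 0$. An $\mathbf{L}(X,X^* )$-valued function $\psi$ on $\Omega$ is weakly continuous at the origin if $\langle\psi(z)x,x\rangle_X\to\langle\psi(0)x,x\rangle_X$ as $z\to 0$ for all $x\in X$; such a function is a Carath\'eodory function if the kernel $$k_\psi(z,w)=\frac{\psi(z)+\psi(w)^*\big|_{X}}{2(1-zw^* )}$$ is positive in $\Omega$. An $\mathbf{L}(\mathcal{B}^*,\mathcal{B})$-valued function $\phi$ is said to be weakly continuous at the origin, respectively a Carath\'eodory function, if the $\mathbf{L}(\mathcal{B}^*,\mathcal{B}^{**})$-valued function $\tau\phi(z)$ is (with $X=\mathcal{B}^*$). *)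

theory Defs
  imports "HOL-Analysis.Analysis"
begin

section \<open>Complex Banach and Hilbert spaces\<close>

class complex_normed_vector = real_normed_vector +
  fixes scaleC :: "complex \<Rightarrow> 'a \<Rightarrow> 'a"  (infixr \<open>*\<^sub>C\<close> 75)
  assumes scaleC_add_right: "a *\<^sub>C (x + y) = a *\<^sub>C x + a *\<^sub>C y"
    and scaleC_add_left: "(a + b) *\<^sub>C x = a *\<^sub>C x + b *\<^sub>C x"
    and scaleC_scaleC: "a *\<^sub>C (b *\<^sub>C x) = (a * b) *\<^sub>C x"
    and scaleC_of_real: "complex_of_real r *\<^sub>C x = r *\<^sub>R x"
    and norm_scaleC: "norm (a *\<^sub>C x) = cmod a * norm x"

class complex_banach = complex_normed_vector + complete_space

subclass (in complex_banach) banach ..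

text \<open>The inner product is linear in its first and anti-linear in its second argument, so that
  \<open>\<lambda>y. cinner h y\<close> is a bounded anti-linear functional.  Positive definiteness is contained in
  \<open>cinner_self\<close>.\<close>

class complex_inner = complex_normed_vector +
  fixes cinner :: "'a \<Rightarrow> 'a \<Rightarrow> complex"
  assumes cinner_commute: "cinner x y = cnj (cinner y x)"
    and cinner_add_left: "cinner (x + y) z = cinner x z + cinner y z"
    and cinner_scaleC_left: "cinner (a *\<^sub>C x) y = a * cinner x y"
    and cinner_self: "cinner x x = complex_of_real ((norm x)\<^sup>2)"

class complex_hilbert = complex_inner + complete_space

subclass (in complex_hilbert) complex_banach ..

lemma scaleC_one [simp]: "1 *\<^sub>C x = x"
  using scaleC_of_real[of 1 x] by simp

lemma scaleC_zero_left [simp]: "0 *\<^sub>C x = 0"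
  using scaleC_of_real[of 0 x] by simp

lemma scaleC_zero_right [simp]: "a *\<^sub>C 0 = 0"
  using scaleC_add_right[of a 0 0] by simp

lemma scaleC_minus_right: "a *\<^sub>C (- x) = - (a *\<^sub>C x)"
  using scaleC_add_right[of a x "- x"] by (simp add: eq_neg_iff_add_eq_0 add.commute)

lemma scaleC_diff_right: "a *\<^sub>C (x - y) = a *\<^sub>C x - a *\<^sub>C y"
  using scaleC_add_right[of a x "- y"] by (simp add: scaleC_minus_right)

lemma scaleR_scaleC: "r *\<^sub>R x = complex_of_real r *\<^sub>C x"
  by (simp add: scaleC_of_real)

lemma scaleC_scaleR: "a *\<^sub>C (r *\<^sub>R x) = r *\<^sub>R (a *\<^sub>C x)"
  by (simp add: scaleR_scaleC scaleC_scaleC mult.commute)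

lemma bounded_linear_scaleC: "bounded_linear (\<lambda>x::'a::complex_normed_vector. a *\<^sub>C x)"
  by (rule bounded_linear_intro[where K = "cmod a"])
    (simp_all add: scaleC_add_right scaleC_scaleR norm_scaleC mult.commute)

lemma cinner_add_right: "cinner x (y + z) = cinner x y + cinner x z"
  using cinner_add_left[of y z x] by (metis cinner_commute complex_cnj_add)

lemma cinner_scaleC_right: "cinner x (a *\<^sub>C y) = cnj a * cinner x y"
  using cinner_scaleC_left[of a y x] by (metis cinner_commute complex_cnj_mult)

lemma cinner_zero_left [simp]: "cinner 0 x = 0"
  using cinner_add_left[of 0 0 x] by simp

lemma cinner_zero_right [simp]: "cinner x 0 = 0"
  using cinner_add_right[of x 0 0] by simp

lemma cinner_minus_left: "cinner (- x) y = - cinner x y"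
  using cinner_add_left[of x "- x" y] by (simp add: eq_neg_iff_add_eq_0 add.commute)

lemma cinner_diff_left: "cinner (x - y) z = cinner x z - cinner y z"
  using cinner_add_left[of x "- y" z] by (simp add: cinner_minus_left)

lemma cinner_diff_right: "cinner z (x - y) = cinner z x - cinner z y"
  using cinner_diff_left[of x y z] by (metis cinner_commute complex_cnj_diff)

lemma cauchy_schwarz: "cmod (cinner x y) \<le> norm x * norm y"
proof (cases "norm y = 0")
  case True
  then have "y = 0" by simp
  then show ?thesis by simp
next
  case False
  define n where "n = complex_of_real ((norm y)\<^sup>2)"
  define c where "c = cinner x y"
  have n0: "n \<noteq> 0" using False by (simp add: n_def)
  have cn: "cnj n = n" by (simp add: n_def)
  have yx: "cinner y x = cnj c" unfolding c_def by (rule cinner_commute)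
  let ?u = "n *\<^sub>C x - c *\<^sub>C y"
  have "cinner ?u ?u = n * n * cinner x x - n * cnj c * c - c * n * cnj c + c * cnj c * cinner y y"
    by (simp add: cinner_diff_left cinner_diff_right cinner_scaleC_left cinner_scaleC_right
        yx c_def[symmetric] cn algebra_simps)
  also have "cinner y y = n" by (simp add: n_def cinner_self)
  also have "n * n * cinner x x - n * cnj c * c - c * n * cnj c + c * cnj c * n
      = n * (n * cinner x x - c * cnj c)" by (simp add: algebra_simps)
  also have "\<dots> = complex_of_real ((norm y)\<^sup>2 * ((norm y)\<^sup>2 * (norm x)\<^sup>2 - (cmod c)\<^sup>2))"
    by (simp add: n_def cinner_self complex_norm_square[symmetric])
  finally have "complex_of_real ((norm ?u)\<^sup>2)
      = complex_of_real ((norm y)\<^sup>2 * ((norm y)\<^sup>2 * (norm x)\<^sup>2 - (cmod c)\<^sup>2))"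
    by (simp only: cinner_self)
  then have "0 \<le> (norm y)\<^sup>2 * ((norm y)\<^sup>2 * (norm x)\<^sup>2 - (cmod c)\<^sup>2)"
    by (metis of_real_eq_iff zero_le_power2)
  then have "0 \<le> (norm y)\<^sup>2 * (norm x)\<^sup>2 - (cmod c)\<^sup>2"
    using False by (simp add: zero_le_mult_iff)
  then have "(cmod c)\<^sup>2 \<le> (norm x * norm y)\<^sup>2" by (simp add: power_mult_distrib mult.commute)
  then show ?thesis unfolding c_def by (rule power2_le_imp_le) simp
qed

instantiation complex :: complex_hilbert
begin
definition scaleC_complex :: "complex \<Rightarrow> complex \<Rightarrow> complex"
  where [simp]: "scaleC_complex = (*)"
definition cinner_complex :: "complex \<Rightarrow> complex \<Rightarrow> complex"
  where "cinner_complex x y = x * cnj y"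
instance
  by standard (simp_all add: algebra_simps cinner_complex_def norm_mult scaleR_conv_of_real
      complex_norm_square flip: of_real_power)
end


section \<open>Bounded operators\<close>

text \<open>\<open>'a \<Rightarrow>\<^sub>B 'b\<close> is \<open>L(X,Y)\<close>: the complex-linear members of the library type of bounded
  real-linear maps, with the same (operator) norm.\<close>

typedef (overloaded) ('a, 'b) cblinfun  (\<open>(_ \<Rightarrow>\<^sub>B /_)\<close> [22, 21] 21) =
  "{f :: 'a::complex_normed_vector \<Rightarrow>\<^sub>L 'b::complex_normed_vector.
      \<forall>c x. blinfun_apply f (c *\<^sub>C x) = c *\<^sub>C blinfun_apply f x}"
  morphisms blinfun_of_cblinfun CBlinfun
  by (rule exI[of _ 0]) simp

setup_lifting type_definition_cblinfun

instantiation cblinfun :: (complex_normed_vector, complex_normed_vector) complex_normed_vector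
begin

lift_definition norm_cblinfun :: "('a \<Rightarrow>\<^sub>B 'b) \<Rightarrow> real" is norm .
lift_definition zero_cblinfun :: "'a \<Rightarrow>\<^sub>B 'b" is 0 by simp
lift_definition plus_cblinfun :: "('a \<Rightarrow>\<^sub>B 'b) \<Rightarrow> ('a \<Rightarrow>\<^sub>B 'b) \<Rightarrow> 'a \<Rightarrow>\<^sub>B 'b" is plus
  by (simp add: blinfun.add_left scaleC_add_right)
lift_definition minus_cblinfun :: "('a \<Rightarrow>\<^sub>B 'b) \<Rightarrow> ('a \<Rightarrow>\<^sub>B 'b) \<Rightarrow> 'a \<Rightarrow>\<^sub>B 'b" is minus
  by (simp add: blinfun.diff_left scaleC_diff_right)
lift_definition uminus_cblinfun :: "('a \<Rightarrow>\<^sub>B 'b) \<Rightarrow> 'a \<Rightarrow>\<^sub>B 'b" is uminus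
  by (simp add: blinfun.minus_left scaleC_minus_right)
lift_definition scaleR_cblinfun :: "real \<Rightarrow> ('a \<Rightarrow>\<^sub>B 'b) \<Rightarrow> 'a \<Rightarrow>\<^sub>B 'b" is scaleR
  by (simp add: blinfun.scaleR_left scaleC_scaleR)
lift_definition scaleC_cblinfun :: "complex \<Rightarrow> ('a \<Rightarrow>\<^sub>B 'b) \<Rightarrow> 'a \<Rightarrow>\<^sub>B 'b"
  is "\<lambda>c f. Blinfun (\<lambda>x. c *\<^sub>C blinfun_apply f x)"
  by (simp add: bounded_linear_Blinfun_apply scaleC_scaleC mult.commute
      bounded_linear_compose[OF bounded_linear_scaleC blinfun.bounded_linear_right])

definition dist_cblinfun :: "('a \<Rightarrow>\<^sub>B 'b) \<Rightarrow> ('a \<Rightarrow>\<^sub>B 'b) \<Rightarrow> real"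
  where "dist_cblinfun a b = norm (a - b)"
definition uniformity_cblinfun :: "(('a \<Rightarrow>\<^sub>B 'b) \<times> ('a \<Rightarrow>\<^sub>B 'b)) filter"
  where "uniformity_cblinfun = (INF e\<in>{0 <..}. principal {(x, y). dist x y < e})"
definition open_cblinfun :: "('a \<Rightarrow>\<^sub>B 'b) set \<Rightarrow> bool"
  where "open_cblinfun S = (\<forall>x\<in>S. \<forall>\<^sub>F (x', y) in uniformity. x' = x \<longrightarrow> y \<in> S)"
definition sgn_cblinfun :: "('a \<Rightarrow>\<^sub>B 'b) \<Rightarrow> 'a \<Rightarrow>\<^sub>B 'b"
  where "sgn_cblinfun x = scaleR (inverse (norm x)) x"

instance
proof
  have *: "blinfun_apply (Blinfun (\<lambda>x. c *\<^sub>C blinfun_apply f x)) y = c *\<^sub>C blinfun_apply f y"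
    for c and f :: "'a \<Rightarrow>\<^sub>L 'b" and y
    by (simp add: bounded_linear_Blinfun_apply
        bounded_linear_compose[OF bounded_linear_scaleC blinfun.bounded_linear_right])
  have sc: "blinfun_apply (blinfun_of_cblinfun (c *\<^sub>C f)) y = c *\<^sub>C blinfun_apply (blinfun_of_cblinfun f) y"
    for c and f :: "'a \<Rightarrow>\<^sub>B 'b" and y
    by (simp only: scaleC_cblinfun.rep_eq *)
  have le: "norm (Blinfun (\<lambda>x. c *\<^sub>C blinfun_apply f x)) \<le> cmod c * norm f"
    for c and f :: "'a \<Rightarrow>\<^sub>L 'b"
    by (rule norm_blinfun_bound)
      (simp_all add: * norm_scaleC mult.assoc mult_left_mono norm_blinfun)
  fix f g h :: "'a \<Rightarrow>\<^sub>B 'b" and a b :: complex and r s :: real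
  show "f + g + h = f + (g + h)" "f + g = g + f" "0 + f = f" "- f + f = 0" "f - g = f + - g"
    by (transfer, simp add: algebra_simps)+
  show "r *\<^sub>R (f + g) = r *\<^sub>R f + r *\<^sub>R g" "(r + s) *\<^sub>R f = r *\<^sub>R f + s *\<^sub>R f"
    "r *\<^sub>R s *\<^sub>R f = (r * s) *\<^sub>R f" "1 *\<^sub>R f = f"
    by (transfer, simp add: algebra_simps)+
  show "(norm f = 0) = (f = 0)" "norm (r *\<^sub>R f) = \<bar>r\<bar> * norm f"
    by (transfer, simp)+
  show "norm (f + g) \<le> norm f + norm g" by (transfer, rule norm_triangle_ineq)
  show "a *\<^sub>C (f + g) = a *\<^sub>C f + a *\<^sub>C g" "(a + b) *\<^sub>C f = a *\<^sub>C f + b *\<^sub>C f"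
    "a *\<^sub>C b *\<^sub>C f = (a * b) *\<^sub>C f" "complex_of_real r *\<^sub>C f = r *\<^sub>R f"
    unfolding blinfun_of_cblinfun_inject[symmetric]
    by (rule blinfun_eqI, simp only: sc plus_cblinfun.rep_eq scaleR_cblinfun.rep_eq
        blinfun.add_left blinfun.scaleR_left, simp only: scaleC_add_right scaleC_add_left scaleC_scaleC scaleC_of_real)+
  have 1: "norm (c *\<^sub>C k) \<le> cmod c * norm k" for c and k :: "'a \<Rightarrow>\<^sub>B 'b"
    by transfer (rule le)
  show "norm (a *\<^sub>C f) = cmod a * norm f"
  proof (cases "a = 0")
    case True
    moreover have "0 \<le> norm (a *\<^sub>C f)" by transfer simp
    ultimately show ?thesis using 1[of a f] by simp
  next
    case False
    have "f = inverse a *\<^sub>C a *\<^sub>C f"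
      unfolding blinfun_of_cblinfun_inject[symmetric]
      by (rule blinfun_eqI) (use False in \<open>simp add: sc scaleC_scaleC\<close>)
    then have "norm f \<le> cmod (inverse a) * norm (a *\<^sub>C f)" using 1 by metis
    then have "cmod a * norm f \<le> norm (a *\<^sub>C f)"
      using False by (simp add: norm_inverse norm_divide field_simps)
    with 1[of a f] show ?thesis by simp
  qed
qed (rule dist_cblinfun_def uniformity_cblinfun_def open_cblinfun_def sgn_cblinfun_def)+

end

lift_definition capply :: "('a::complex_normed_vector \<Rightarrow>\<^sub>B 'b::complex_normed_vector) \<Rightarrow> 'a \<Rightarrow> 'b"
  is blinfun_apply .

declare [[coercion capply]]

lemma cblinfun_eqI: "(\<And>x. capply f x = capply g x) \<Longrightarrow> f = g"
  by transfer (rule blinfun_eqI)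

lemma capply_add: "capply f (x + y) = capply f x + capply f y"
  by transfer (rule blinfun.add_right)

lemma capply_scaleC: "capply f (c *\<^sub>C x) = c *\<^sub>C capply f x"
  by transfer simp

lemma norm_capply: "norm (capply f x) \<le> norm f * norm x"
  by transfer (rule norm_blinfun)

text \<open>\<open>mk_op f\<close> is only meaningful for \<open>bounded_clinear f\<close>; likewise \<open>mk_dual\<close> below.  For every
  operator defined with them the lemma giving its values (\<open>ccomp_apply\<close>, \<open>cadj_apply\<close>,
  \<open>natinj_apply\<close>, \<open>riesz_apply\<close>) discharges that condition.\<close>

definition bounded_clinear :: "('a::complex_normed_vector \<Rightarrow> 'b::complex_normed_vector) \<Rightarrow> bool"
  where "bounded_clinear f \<longleftrightarrow>
    (\<forall>x y. f (x + y) = f x + f y) \<and> (\<forall>c x. f (c *\<^sub>C x) = c *\<^sub>C f x) \<and>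
    (\<exists>K. \<forall>x. norm (f x) \<le> K * norm x)"

definition mk_op :: "('a::complex_normed_vector \<Rightarrow> 'b::complex_normed_vector) \<Rightarrow> 'a \<Rightarrow>\<^sub>B 'b"
  where "mk_op f = CBlinfun (Blinfun f)"

lemma capply_mk_op:
  assumes "bounded_clinear f"
  shows "capply (mk_op f) = f"
proof -
  have r: "f (r *\<^sub>R x) = r *\<^sub>R f x" for r x
    using assms by (simp add: bounded_clinear_def scaleR_scaleC)
  obtain K where K: "\<And>x. norm (f x) \<le> K * norm x"
    using assms by (auto simp: bounded_clinear_def)
  have bl: "bounded_linear f"
    by (rule bounded_linear_intro[where K = K])
      (use assms r K in \<open>auto simp: bounded_clinear_def mult.commute\<close>)
  have "Blinfun f \<in> {f. \<forall>c x. blinfun_apply f (c *\<^sub>C x) = c *\<^sub>C blinfun_apply f x}"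
    using assms by (simp add: bounded_linear_Blinfun_apply[OF bl] bounded_clinear_def)
  then show ?thesis
    by (simp add: mk_op_def capply.rep_eq CBlinfun_inverse bounded_linear_Blinfun_apply[OF bl])
qed

lemma bounded_clinear_capply: "bounded_clinear (capply f)"
  unfolding bounded_clinear_def using capply_add capply_scaleC norm_capply by blast

definition cid :: "'a::complex_normed_vector \<Rightarrow>\<^sub>B 'a"
  where "cid = mk_op (\<lambda>x. x)"

definition ccomp :: "('b::complex_normed_vector \<Rightarrow>\<^sub>B 'c::complex_normed_vector) \<Rightarrow>
    ('a::complex_normed_vector \<Rightarrow>\<^sub>B 'b) \<Rightarrow> 'a \<Rightarrow>\<^sub>B 'c"  (infixl \<open>o\<^sub>B\<close> 70)
  where "A o\<^sub>B B = mk_op (\<lambda>x. A (B x))"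

text \<open>Meaningful when \<open>A\<close> has a bounded two-sided inverse, which is then unique.\<close>

definition cinv :: "('a::complex_normed_vector \<Rightarrow>\<^sub>B 'a) \<Rightarrow> 'a \<Rightarrow>\<^sub>B 'a"
  where "cinv A = (THE B. A o\<^sub>B B = cid \<and> B o\<^sub>B A = cid)"

lemma cid_apply [simp]: "capply cid x = x"
  unfolding cid_def by (subst capply_mk_op) (auto simp: bounded_clinear_def intro: exI[of _ 1])

lemma ccomp_apply [simp]: "capply (A o\<^sub>B B) x = A (B x)"
proof -
  have "norm (A (B x)) \<le> (norm A * norm B) * norm x" for x
    by (rule order_trans[OF norm_capply]) (simp add: mult.assoc mult_left_mono norm_capply)
  then have "bounded_clinear (\<lambda>x. A (B x))"
    unfolding bounded_clinear_def by (metis capply_add capply_scaleC)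
  then show ?thesis by (simp add: ccomp_def capply_mk_op)
qed

lemma cinv_eqI:
  assumes "A o\<^sub>B B = cid" "B o\<^sub>B A = cid"
  shows "cinv A = B"
  unfolding cinv_def
proof (rule the_equality)
  fix B' assume "A o\<^sub>B B' = cid \<and> B' o\<^sub>B A = cid"
  then have "capply B' x = B x" for x
    using assms by (metis ccomp_apply cid_apply)
  then show "B' = B" by (rule cblinfun_eqI)
qed (use assms in simp)


section \<open>The conjugate dual\<close>

typedef (overloaded) 'a cdual =
  "{f :: 'a::complex_normed_vector \<Rightarrow>\<^sub>L complex.
      \<forall>c x. blinfun_apply f (c *\<^sub>C x) = cnj c * blinfun_apply f x}"
  morphisms blinfun_of_cdual CDual
  by (rule exI[of _ 0]) simp

setup_lifting type_definition_cdual

instantiation cdual :: (complex_normed_vector) complex_normed_vector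
begin

lift_definition norm_cdual :: "'a cdual \<Rightarrow> real" is norm .
lift_definition zero_cdual :: "'a cdual" is 0 by simp
lift_definition plus_cdual :: "'a cdual \<Rightarrow> 'a cdual \<Rightarrow> 'a cdual" is plus
  by (simp add: blinfun.add_left algebra_simps)
lift_definition minus_cdual :: "'a cdual \<Rightarrow> 'a cdual \<Rightarrow> 'a cdual" is minus
  by (simp add: blinfun.diff_left algebra_simps)
lift_definition uminus_cdual :: "'a cdual \<Rightarrow> 'a cdual" is uminus
  by (simp add: blinfun.minus_left)
lift_definition scaleR_cdual :: "real \<Rightarrow> 'a cdual \<Rightarrow> 'a cdual" is scaleR
  by (simp add: blinfun.scaleR_left)
lift_definition scaleC_cdual :: "complex \<Rightarrow> 'a cdual \<Rightarrow> 'a cdual"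
  is "\<lambda>c f. Blinfun (\<lambda>x. c * blinfun_apply f x)"
  by (simp add: bounded_linear_Blinfun_apply bounded_linear_mult_const
      bounded_linear_compose[OF bounded_linear_mult_right blinfun.bounded_linear_right])

definition dist_cdual :: "'a cdual \<Rightarrow> 'a cdual \<Rightarrow> real"
  where "dist_cdual a b = norm (a - b)"
definition uniformity_cdual :: "('a cdual \<times> 'a cdual) filter"
  where "uniformity_cdual = (INF e\<in>{0 <..}. principal {(x, y). dist x y < e})"
definition open_cdual :: "'a cdual set \<Rightarrow> bool"
  where "open_cdual S = (\<forall>x\<in>S. \<forall>\<^sub>F (x', y) in uniformity. x' = x \<longrightarrow> y \<in> S)"
definition sgn_cdual :: "'a cdual \<Rightarrow> 'a cdual"
  where "sgn_cdual x = scaleR (inverse (norm x)) x"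

instance
proof
  have *: "blinfun_apply (Blinfun (\<lambda>x. c * blinfun_apply f x)) y = c * blinfun_apply f y"
    for c and f :: "'a \<Rightarrow>\<^sub>L complex" and y
    by (simp add: bounded_linear_Blinfun_apply
        bounded_linear_compose[OF bounded_linear_mult_right blinfun.bounded_linear_right])
  have sc: "blinfun_apply (blinfun_of_cdual (c *\<^sub>C f)) y = c * blinfun_apply (blinfun_of_cdual f) y"
    for c and f :: "'a cdual" and y
    by (simp only: scaleC_cdual.rep_eq *)
  have le: "norm (Blinfun (\<lambda>x. c * blinfun_apply f x)) \<le> cmod c * norm f"
    for c and f :: "'a \<Rightarrow>\<^sub>L complex"
    by (rule norm_blinfun_bound)
      (simp_all add: * norm_mult mult.assoc mult_left_mono norm_blinfun)
  fix f g h :: "'a cdual" and a b :: complex and r s :: real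
  show "f + g + h = f + (g + h)" "f + g = g + f" "0 + f = f" "- f + f = 0" "f - g = f + - g"
    by (transfer, simp add: algebra_simps)+
  show "r *\<^sub>R (f + g) = r *\<^sub>R f + r *\<^sub>R g" "(r + s) *\<^sub>R f = r *\<^sub>R f + s *\<^sub>R f"
    "r *\<^sub>R s *\<^sub>R f = (r * s) *\<^sub>R f" "1 *\<^sub>R f = f"
    by (transfer, simp add: algebra_simps)+
  show "(norm f = 0) = (f = 0)" "norm (r *\<^sub>R f) = \<bar>r\<bar> * norm f"
    by (transfer, simp)+
  show "norm (f + g) \<le> norm f + norm g" by (transfer, rule norm_triangle_ineq)
  show "a *\<^sub>C (f + g) = a *\<^sub>C f + a *\<^sub>C g" "(a + b) *\<^sub>C f = a *\<^sub>C f + b *\<^sub>C f"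
    "a *\<^sub>C b *\<^sub>C f = (a * b) *\<^sub>C f" "complex_of_real r *\<^sub>C f = r *\<^sub>R f"
    unfolding blinfun_of_cdual_inject[symmetric]
    by (rule blinfun_eqI, simp only: sc plus_cdual.rep_eq scaleR_cdual.rep_eq
        blinfun.add_left blinfun.scaleR_left, simp only: distrib_left distrib_right mult.assoc scaleR_conv_of_real)+
  have 1: "norm (c *\<^sub>C k) \<le> cmod c * norm k" for c and k :: "'a cdual"
    by transfer (rule le)
  show "norm (a *\<^sub>C f) = cmod a * norm f"
  proof (cases "a = 0")
    case True
    moreover have "0 \<le> norm (a *\<^sub>C f)" by transfer simp
    ultimately show ?thesis using 1[of a f] by simp
  next
    case False
    have "f = inverse a *\<^sub>C a *\<^sub>C f"
      unfolding blinfun_of_cdual_inject[symmetric]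
      by (rule blinfun_eqI) (use False in \<open>simp add: sc\<close>)
    then have "norm f \<le> cmod (inverse a) * norm (a *\<^sub>C f)" using 1 by metis
    then have "cmod a * norm f \<le> norm (a *\<^sub>C f)"
      using False by (simp add: norm_inverse norm_divide field_simps)
    with 1[of a f] show ?thesis by simp
  qed
qed (rule dist_cdual_def uniformity_cdual_def open_cdual_def sgn_cdual_def)+

end

text \<open>The pairing of \<open>f \<in> X\<^sup>*\<close> with \<open>x \<in> X\<close>; it is linear in \<open>f\<close> and anti-linear in \<open>x\<close>.\<close>

lift_definition cpair :: "'a::complex_normed_vector cdual \<Rightarrow> 'a \<Rightarrow> complex"  (\<open>(\<llangle>_,/ _\<rrangle>)\<close>)
  is blinfun_apply .

lemma cdual_eqI: "(\<And>x. \<llangle>f, x\<rrangle> = \<llangle>g, x\<rrangle>) \<Longrightarrow> f = g"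
  by transfer (rule blinfun_eqI)

lemma cpair_add_right: "\<llangle>f, x + y\<rrangle> = \<llangle>f, x\<rrangle> + \<llangle>f, y\<rrangle>"
  by transfer (rule blinfun.add_right)

lemma cpair_scaleC_right: "\<llangle>f, c *\<^sub>C x\<rrangle> = cnj c * \<llangle>f, x\<rrangle>"
  by transfer simp

lemma cpair_add_left: "\<llangle>f + g, x\<rrangle> = \<llangle>f, x\<rrangle> + \<llangle>g, x\<rrangle>"
  by transfer (rule blinfun.add_left)

lemma cpair_scaleC_left: "\<llangle>c *\<^sub>C f, x\<rrangle> = c * \<llangle>f, x\<rrangle>"
  by transfer (simp add: bounded_linear_Blinfun_apply
      bounded_linear_compose[OF bounded_linear_mult_right blinfun.bounded_linear_right])

lemma norm_cpair: "cmod \<llangle>f, x\<rrangle> \<le> norm f * norm x"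
  by transfer (rule norm_blinfun)

lemma norm_cdual_bound: "0 \<le> K \<Longrightarrow> (\<And>x. cmod \<llangle>f, x\<rrangle> \<le> K * norm x) \<Longrightarrow> norm f \<le> K"
  by transfer (rule norm_blinfun_bound)

definition bounded_antilinear_form :: "('a::complex_normed_vector \<Rightarrow> complex) \<Rightarrow> bool"
  where "bounded_antilinear_form f \<longleftrightarrow>
    (\<forall>x y. f (x + y) = f x + f y) \<and> (\<forall>c x. f (c *\<^sub>C x) = cnj c * f x) \<and>
    (\<exists>K. \<forall>x. cmod (f x) \<le> K * norm x)"

definition mk_dual :: "('a::complex_normed_vector \<Rightarrow> complex) \<Rightarrow> 'a cdual"
  where "mk_dual f = CDual (Blinfun f)"

lemma cpair_mk_dual:
  assumes "bounded_antilinear_form f"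
  shows "\<llangle>mk_dual f, x\<rrangle> = f x"
proof -
  have r: "f (r *\<^sub>R x) = r *\<^sub>R f x" for r x
    using assms by (simp add: bounded_antilinear_form_def scaleR_scaleC)
  obtain K where K: "\<And>x. cmod (f x) \<le> K * norm x"
    using assms by (auto simp: bounded_antilinear_form_def)
  have bl: "bounded_linear f"
    by (rule bounded_linear_intro[where K = K])
      (use assms r K in \<open>auto simp: bounded_antilinear_form_def mult.commute\<close>)
  have "Blinfun f \<in> {f. \<forall>c x. blinfun_apply f (c *\<^sub>C x) = cnj c * blinfun_apply f x}"
    using assms by (simp add: bounded_linear_Blinfun_apply[OF bl] bounded_antilinear_form_def)
  then show ?thesis
    by (simp add: mk_dual_def cpair.rep_eq CDual_inverse bounded_linear_Blinfun_apply[OF bl])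
qed

lemma norm_mk_dual_le:
  assumes "bounded_antilinear_form f" "0 \<le> K" "\<And>x. cmod (f x) \<le> K * norm x"
  shows "norm (mk_dual f) \<le> K"
  using assms by (intro norm_cdual_bound) (simp_all add: cpair_mk_dual)

text \<open>The adjoint in \<open>L(Y\<^sup>*,X\<^sup>*)\<close> of \<open>A \<in> L(X,Y)\<close>, and the natural injection
  \<open>X \<rightarrow> X\<^sup>*\<^sup>*\<close>.\<close>

definition cadj :: "('a::complex_normed_vector \<Rightarrow>\<^sub>B 'b::complex_normed_vector) \<Rightarrow>
    'b cdual \<Rightarrow>\<^sub>B 'a cdual"
  where "cadj A = mk_op (\<lambda>g. mk_dual (\<lambda>x. \<llangle>g, A x\<rrangle>))"

definition natinj :: "'a::complex_normed_vector \<Rightarrow>\<^sub>B 'a cdual cdual"  (\<open>\<tau>\<close>)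
  where "\<tau> = mk_op (\<lambda>x. mk_dual (\<lambda>f. cnj \<llangle>f, x\<rrangle>))"

definition adj_restr :: "('a::complex_normed_vector \<Rightarrow>\<^sub>B 'a cdual) \<Rightarrow> 'a \<Rightarrow>\<^sub>B 'a cdual"
  where "adj_restr A = cadj A o\<^sub>B \<tau>"

lemma bounded_clinear_mk_dual:
  assumes "\<And>u. bounded_antilinear_form (F u)"
    and "\<And>u v x. F (u + v) x = F u x + F v x" and "\<And>c u x. F (c *\<^sub>C u) x = c * F u x"
    and "0 \<le> K" and "\<And>u x. cmod (F u x) \<le> K * norm u * norm x"
  shows "bounded_clinear (\<lambda>u. mk_dual (F u))"
  unfolding bounded_clinear_def
proof (intro conjI allI exI[of _ K])
  show "mk_dual (F (u + v)) = mk_dual (F u) + mk_dual (F v)" for u v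
    by (rule cdual_eqI) (simp add: cpair_mk_dual assms cpair_add_left)
  show "mk_dual (F (c *\<^sub>C u)) = c *\<^sub>C mk_dual (F u)" for c u
    by (rule cdual_eqI) (simp add: cpair_mk_dual assms cpair_scaleC_left)
  show "norm (mk_dual (F u)) \<le> K * norm u" for u
    by (rule norm_mk_dual_le) (use assms in auto)
qed

lemma cadj_apply: "\<llangle>cadj A g, x\<rrangle> = \<llangle>g, A x\<rrangle>"
proof -
  have bd: "cmod \<llangle>g, A x\<rrangle> \<le> norm A * norm g * norm x" for g x
  proof -
    have "cmod \<llangle>g, A x\<rrangle> \<le> norm g * (norm A * norm x)"
      by (rule order_trans[OF norm_cpair]) (simp add: mult_left_mono norm_capply)
    then show ?thesis by (simp add: mult_ac)
  qed
  have 1: "bounded_antilinear_form (\<lambda>x. \<llangle>g, A x\<rrangle>)" for g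
    unfolding bounded_antilinear_form_def using bd
    by (auto simp: capply_add capply_scaleC cpair_add_right cpair_scaleC_right)
  have "bounded_clinear (\<lambda>g. mk_dual (\<lambda>x. \<llangle>g, A x\<rrangle>))"
    by (rule bounded_clinear_mk_dual[where K = "norm A"])
      (simp_all add: 1 bd cpair_add_left cpair_scaleC_left)
  then show ?thesis by (simp add: cadj_def capply_mk_op cpair_mk_dual 1)
qed

lemma natinj_apply: "\<llangle>\<tau> x, f\<rrangle> = cnj \<llangle>f, x\<rrangle>"
proof -
  have 1: "bounded_antilinear_form (\<lambda>f. cnj \<llangle>f, x\<rrangle>)" for x :: 'a
    unfolding bounded_antilinear_form_def
    by (auto simp: cpair_add_left cpair_scaleC_left intro!: exI[of _ "norm x"]
        order_trans[OF norm_cpair] simp: mult.commute)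
  have "bounded_clinear (\<lambda>x::'a. mk_dual (\<lambda>f. cnj \<llangle>f, x\<rrangle>))"
    by (rule bounded_clinear_mk_dual[where K = 1])
      (simp_all add: 1 cpair_add_right cpair_scaleC_right order_trans[OF norm_cpair] mult.commute)
  then show ?thesis by (simp add: natinj_def capply_mk_op cpair_mk_dual 1)
qed

lemma adj_restr_apply: "\<llangle>adj_restr A c, b\<rrangle> = cnj \<llangle>A b, c\<rrangle>"
  by (simp add: adj_restr_def cadj_apply natinj_apply)

definition purely_imaginary :: "('a::complex_normed_vector \<Rightarrow>\<^sub>B 'a cdual) \<Rightarrow> bool"
  where "purely_imaginary D \<longleftrightarrow> D + adj_restr D = 0"


section \<open>Operators and Hilbert spaces\<close>

definition riesz :: "'h::complex_inner \<Rightarrow>\<^sub>B 'h cdual"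
  where "riesz = mk_op (\<lambda>h. mk_dual (\<lambda>y. cinner h y))"

text \<open>\<open>C\<^sup>* \<in> L(H,X\<^sup>*)\<close> for \<open>C \<in> L(X,H)\<close>, the identification of \<open>H\<close> with its conjugate dual
  being \<open>riesz\<close>.\<close>

definition adj_to_dual :: "('a::complex_normed_vector \<Rightarrow>\<^sub>B 'h::complex_hilbert) \<Rightarrow> 'h \<Rightarrow>\<^sub>B 'a cdual"
  where "adj_to_dual C = cadj C o\<^sub>B riesz"

text \<open>The Hilbert space adjoint, which exists and is unique by the Riesz representation
  theorem.\<close>

definition hadj :: "('h::complex_hilbert \<Rightarrow>\<^sub>B 'h) \<Rightarrow> 'h \<Rightarrow>\<^sub>B 'h"
  where "hadj V = (THE W :: 'h \<Rightarrow>\<^sub>B 'h. \<forall>x y. cinner (W x) y = cinner x (V y))"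

definition isometric :: "('h::complex_inner \<Rightarrow>\<^sub>B 'h) \<Rightarrow> bool"
  where "isometric V \<longleftrightarrow> (\<forall>x. norm (V x) = norm x)"

lemma riesz_apply: "\<llangle>riesz h, y\<rrangle> = cinner h y"
proof -
  have 1: "bounded_antilinear_form (cinner h)" for h :: 'a
    unfolding bounded_antilinear_form_def
    using cauchy_schwarz[of h] by (auto simp: cinner_add_right cinner_scaleC_right)
  have "bounded_clinear (\<lambda>h::'a. mk_dual (cinner h))"
    by (rule bounded_clinear_mk_dual[where K = 1])
      (simp_all add: 1 cinner_add_left cinner_scaleC_left cauchy_schwarz)
  then show ?thesis by (simp add: riesz_def capply_mk_op cpair_mk_dual 1)
qed

lemma adj_to_dual_apply: "\<llangle>adj_to_dual C h, x\<rrangle> = cinner h (C x)"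
  by (simp add: adj_to_dual_def cadj_apply riesz_apply)


section \<open>Hilbert spaces of square summable families\<close>

text \<open>HOL cannot quantify existentially over types, so ``there is a Hilbert space'' needs a type that
  is large enough to serve as witness.  Any Hilbert space \<open>H\<close> with an orthonormal basis indexed by a
  subset of \<open>'i\<close> is a closed subspace of \<open>'i ell2\<close>, and an isometry of \<open>H\<close> extends to \<open>'i ell2\<close> by the
  identity on the orthogonal complement.  For the reproducing kernel Hilbert space of a kernel with
  values in \<open>L(B\<^sup>*,B\<^sup>*\<^sup>*)\<close>, whose elements are \<open>B\<^sup>*\<^sup>*\<close>-valued functions on a subset of the complex
  plane, the index type \<open>complex \<Rightarrow> 'b cdual cdual\<close> is large enough.\<close>

typedef 'i ell2 = "{f :: 'i \<Rightarrow> complex. (\<lambda>i. (cmod (f i))\<^sup>2) summable_on UNIV}"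
  morphisms ell2_nth Ell2
  by (rule exI[of _ "\<lambda>_. 0"]) simp

setup_lifting type_definition_ell2

lemma ell2_product_summable:
  fixes f g :: "'i \<Rightarrow> complex"
  assumes "(\<lambda>i. (cmod (f i))\<^sup>2) summable_on UNIV" "(\<lambda>i. (cmod (g i))\<^sup>2) summable_on UNIV"
  shows "(\<lambda>i. f i * cnj (g i)) summable_on UNIV"
proof (rule abs_summable_summable, rule Infinite_Sum.abs_summable_on_comparison_test')
  show "(\<lambda>i. (cmod (f i))\<^sup>2 + (cmod (g i))\<^sup>2) summable_on UNIV"
    by (intro summable_on_add assms)
  show "cmod (f i * cnj (g i)) \<le> (cmod (f i))\<^sup>2 + (cmod (g i))\<^sup>2" for i
  proof -
    have "0 \<le> (cmod (f i) - cmod (g i))\<^sup>2" "0 \<le> cmod (f i) * cmod (g i)" by simp_all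
    then show ?thesis unfolding norm_mult complex_mod_cnj power2_diff by linarith
  qed
qed

lemma ell2_add_summable:
  fixes f g :: "'i \<Rightarrow> complex"
  assumes "(\<lambda>i. (cmod (f i))\<^sup>2) summable_on UNIV" "(\<lambda>i. (cmod (g i))\<^sup>2) summable_on UNIV"
  shows "(\<lambda>i. (cmod (f i + g i))\<^sup>2) summable_on UNIV"
proof -
  have "(\<lambda>i. (cmod (f i))\<^sup>2 + (cmod (g i))\<^sup>2 + 2 * Re (f i * cnj (g i))) summable_on UNIV"
    by (intro summable_on_add summable_on_cmult_right summable_on_Re ell2_product_summable assms)
  moreover have "(cmod (f i + g i))\<^sup>2 = (cmod (f i))\<^sup>2 + (cmod (g i))\<^sup>2 + 2 * Re (f i * cnj (g i))" for i
    unfolding cmod_power2 by (simp add: power2_eq_square algebra_simps)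
  ultimately show ?thesis by simp
qed

lemma ell2_scale_summable:
  fixes f :: "'i \<Rightarrow> complex"
  assumes "(\<lambda>i. (cmod (f i))\<^sup>2) summable_on UNIV"
  shows "(\<lambda>i. (cmod (c * f i))\<^sup>2) summable_on UNIV"
  using summable_on_cmult_right[OF assms, of "(cmod c)\<^sup>2"] by (simp add: norm_mult power_mult_distrib)

instantiation ell2 :: (type) real_inner
begin

lift_definition zero_ell2 :: "'a ell2" is "\<lambda>_. 0" by simp
lift_definition plus_ell2 :: "'a ell2 \<Rightarrow> 'a ell2 \<Rightarrow> 'a ell2" is "\<lambda>f g i. f i + g i"
  by (rule ell2_add_summable)
lift_definition uminus_ell2 :: "'a ell2 \<Rightarrow> 'a ell2" is "\<lambda>f i. - f i" by simp
lift_definition minus_ell2 :: "'a ell2 \<Rightarrow> 'a ell2 \<Rightarrow> 'a ell2" is "\<lambda>f g i. f i - g i"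
  subgoal for f g using ell2_add_summable[of f "\<lambda>i. - g i"] by simp
  done
lift_definition scaleR_ell2 :: "real \<Rightarrow> 'a ell2 \<Rightarrow> 'a ell2" is "\<lambda>r f i. complex_of_real r * f i"
  by (rule ell2_scale_summable)
lift_definition inner_ell2 :: "'a ell2 \<Rightarrow> 'a ell2 \<Rightarrow> real"
  is "\<lambda>f g. Re (\<Sum>\<^sub>\<infinity>i. f i * cnj (g i))" .
lift_definition norm_ell2 :: "'a ell2 \<Rightarrow> real" is "\<lambda>f. sqrt (\<Sum>\<^sub>\<infinity>i. (cmod (f i))\<^sup>2)" .

definition dist_ell2 :: "'a ell2 \<Rightarrow> 'a ell2 \<Rightarrow> real"
  where "dist_ell2 a b = norm (a - b)"
definition uniformity_ell2 :: "('a ell2 \<times> 'a ell2) filter"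
  where "uniformity_ell2 = (INF e\<in>{0 <..}. principal {(x, y). dist x y < e})"
definition open_ell2 :: "'a ell2 set \<Rightarrow> bool"
  where "open_ell2 S = (\<forall>x\<in>S. \<forall>\<^sub>F (x', y) in uniformity. x' = x \<longrightarrow> y \<in> S)"
definition sgn_ell2 :: "'a ell2 \<Rightarrow> 'a ell2"
  where "sgn_ell2 x = scaleR (inverse (norm x)) x"

lemma ell2_self:
  assumes "(\<lambda>i. (cmod (f i))\<^sup>2) summable_on UNIV"
  shows "(\<Sum>\<^sub>\<infinity>i. f i * cnj (f i)) = complex_of_real (\<Sum>\<^sub>\<infinity>i. (cmod (f i))\<^sup>2)"
proof (rule infsumI)
  have "((\<lambda>i. complex_of_real ((cmod (f i))\<^sup>2)) has_sum complex_of_real (\<Sum>\<^sub>\<infinity>i. (cmod (f i))\<^sup>2)) UNIV"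
    unfolding has_sum_of_real_iff using assms by (rule has_sum_infsum)
  then show "((\<lambda>i. f i * cnj (f i)) has_sum complex_of_real (\<Sum>\<^sub>\<infinity>i. (cmod (f i))\<^sup>2)) UNIV"
    by (simp only: complex_norm_square)
qed

instance
proof
  fix f g h :: "'a ell2" and r s :: real
  show "f + g + h = f + (g + h)" "f + g = g + f" "0 + f = f" "- f + f = 0" "f - g = f + - g"
    by (transfer, simp add: algebra_simps)+
  show "r *\<^sub>R (f + g) = r *\<^sub>R f + r *\<^sub>R g" "(r + s) *\<^sub>R f = r *\<^sub>R f + s *\<^sub>R f"
    "r *\<^sub>R s *\<^sub>R f = (r * s) *\<^sub>R f" "1 *\<^sub>R f = f"
    by (transfer, simp add: algebra_simps)+
  show "inner f g = inner g f"
  proof transfer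
    fix f g :: "'a \<Rightarrow> complex"
    have "(\<Sum>\<^sub>\<infinity>i. f i * cnj (g i)) = cnj (\<Sum>\<^sub>\<infinity>i. g i * cnj (f i))"
      by (simp add: mult.commute flip: infsum_cnj)
    then show "Re (\<Sum>\<^sub>\<infinity>i. f i * cnj (g i)) = Re (\<Sum>\<^sub>\<infinity>i. g i * cnj (f i))" by simp
  qed
  show "inner (f + g) h = inner f h + inner g h"
    by transfer (simp add: distrib_right infsum_add ell2_product_summable)
  show "inner (r *\<^sub>R f) g = r * inner f g"
    by transfer (simp add: mult.assoc infsum_cmult_right ell2_product_summable)
  show "0 \<le> inner f f"
    by transfer (simp add: ell2_self infsum_nonneg)
  show "inner f f = 0 \<longleftrightarrow> f = 0"
  proof transfer
    fix f :: "'a \<Rightarrow> complex"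
    assume s: "(\<lambda>i. (cmod (f i))\<^sup>2) summable_on UNIV"
    have "(cmod (f i))\<^sup>2 = 0" if "(\<Sum>\<^sub>\<infinity>i. (cmod (f i))\<^sup>2) = 0" for i
      by (rule nonneg_infsum_le_0D[where A = UNIV and f = "\<lambda>i. (cmod (f i))\<^sup>2"])
        (use s that in auto)
    then have "f = (\<lambda>_. 0)" if "(\<Sum>\<^sub>\<infinity>i. (cmod (f i))\<^sup>2) = 0"
      using that by (simp add: fun_eq_iff)
    then show "(Re (\<Sum>\<^sub>\<infinity>i. f i * cnj (f i)) = 0) = (f = (\<lambda>_. 0))"
      unfolding ell2_self[OF s] Re_complex_of_real by (rule iffI) simp_all
  qed
  show "norm f = sqrt (inner f f)" by transfer (simp add: ell2_self)
qed (rule dist_ell2_def uniformity_ell2_def open_ell2_def sgn_ell2_def)+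

end

lemma norm_ell2_sq: "(norm f)\<^sup>2 = (\<Sum>\<^sub>\<infinity>i. (cmod (ell2_nth f i))\<^sup>2)"
  by transfer (simp add: infsum_nonneg)

lemma ell2_finite_sum_le: "finite F \<Longrightarrow> (\<Sum>i\<in>F. (cmod (ell2_nth f i))\<^sup>2) \<le> (norm f)\<^sup>2"
  unfolding norm_ell2_sq using ell2_nth[of f] by (intro finite_sum_le_infsum) auto

lemma ell2_nth_diff: "ell2_nth (f - g) i = ell2_nth f i - ell2_nth g i"
  by transfer simp

lemma norm_ell2_nth_le: "cmod (ell2_nth f i) \<le> norm f"
  by (rule power2_le_imp_le) (use ell2_finite_sum_le[of "{i}" f] in simp_all)

instantiation ell2 :: (type) complex_hilbert
begin

lift_definition scaleC_ell2 :: "complex \<Rightarrow> 'a ell2 \<Rightarrow> 'a ell2" is "\<lambda>c f i. c * f i"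
  by (rule ell2_scale_summable)
lift_definition cinner_ell2 :: "'a ell2 \<Rightarrow> 'a ell2 \<Rightarrow> complex"
  is "\<lambda>f g. \<Sum>\<^sub>\<infinity>i. f i * cnj (g i)" .

instance
proof
  fix f g h :: "'a ell2" and a b :: complex and r :: real
  show "a *\<^sub>C (f + g) = a *\<^sub>C f + a *\<^sub>C g" "(a + b) *\<^sub>C f = a *\<^sub>C f + b *\<^sub>C f"
    "a *\<^sub>C b *\<^sub>C f = (a * b) *\<^sub>C f" "complex_of_real r *\<^sub>C f = r *\<^sub>R f"
    by (transfer, simp add: algebra_simps)+
  show "norm (a *\<^sub>C f) = cmod a * norm f"
    by transfer (simp add: norm_mult power_mult_distrib infsum_cmult_right real_sqrt_mult)
  show "cinner f g = cnj (cinner g f)"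
    by transfer (simp add: mult.commute flip: infsum_cnj)
  show "cinner (f + g) h = cinner f h + cinner g h"
    by transfer (simp add: distrib_right infsum_add ell2_product_summable)
  show "cinner (a *\<^sub>C f) g = a * cinner f g"
    by transfer (simp add: mult.assoc infsum_cmult_right ell2_product_summable)
  show "cinner f f = complex_of_real ((norm f)\<^sup>2)"
    by transfer (simp add: ell2_self infsum_nonneg)
next
  fix X :: "nat \<Rightarrow> 'a ell2"
  assume C: "Cauchy X"
  have "Cauchy (\<lambda>n. ell2_nth (X n) i)" for i
  proof (rule CauchyI)
    fix e :: real assume "0 < e"
    then obtain M where "\<forall>m\<ge>M. \<forall>n\<ge>M. norm (X m - X n) < e" using CauchyD[OF C] by blast
    then show "\<exists>M. \<forall>m\<ge>M. \<forall>n\<ge>M. norm (ell2_nth (X m) i - ell2_nth (X n) i) < e"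
      by (metis ell2_nth_diff norm_ell2_nth_le le_less_trans)
  qed
  then have "\<forall>i. \<exists>c. (\<lambda>n. ell2_nth (X n) i) \<longlonglongrightarrow> c"
    unfolding Cauchy_convergent_iff convergent_def by blast
  then obtain l where "\<forall>i. (\<lambda>n. ell2_nth (X n) i) \<longlonglongrightarrow> l i"
    by (rule choice[THEN exE])
  then have l: "\<And>i. (\<lambda>n. ell2_nth (X n) i) \<longlonglongrightarrow> l i" by blast
  have fin: "(\<Sum>i\<in>F. (cmod (ell2_nth (X m) i - l i))\<^sup>2) \<le> e\<^sup>2"
    if "\<forall>m\<ge>M. \<forall>n\<ge>M. norm (X m - X n) < e" "m \<ge> M" "finite F" for M e m F
  proof (rule LIMSEQ_le_const2)
    show "(\<lambda>n. \<Sum>i\<in>F. (cmod (ell2_nth (X m) i - ell2_nth (X n) i))\<^sup>2)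
        \<longlonglongrightarrow> (\<Sum>i\<in>F. (cmod (ell2_nth (X m) i - l i))\<^sup>2)"
      by (intro tendsto_intros l)
    have "(\<Sum>i\<in>F. (cmod (ell2_nth (X m) i - ell2_nth (X n) i))\<^sup>2) \<le> e\<^sup>2" if "n \<ge> M" for n
    proof -
      have "norm (X m - X n) \<le> e" using \<open>\<forall>m\<ge>M. _\<close> \<open>m \<ge> M\<close> that by (simp add: less_imp_le)
      then have "(norm (X m - X n))\<^sup>2 \<le> e\<^sup>2" by (intro power_mono) simp_all
      then show ?thesis
        using ell2_finite_sum_le[OF \<open>finite F\<close>, of "X m - X n"] by (simp add: ell2_nth_diff)
    qed
    then show "\<exists>N. \<forall>n\<ge>N. (\<Sum>i\<in>F. (cmod (ell2_nth (X m) i - ell2_nth (X n) i))\<^sup>2) \<le> e\<^sup>2" by blast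
  qed
  have summ: "(\<lambda>i. (cmod (ell2_nth (X m) i - l i))\<^sup>2) summable_on UNIV"
    if "\<forall>m\<ge>M. \<forall>n\<ge>M. norm (X m - X n) < e" "m \<ge> M" for M e m
    by (rule nonneg_bdd_above_summable_on) (auto intro!: bdd_aboveI2[where M = "e\<^sup>2"] fin[OF that])
  obtain M where M: "\<forall>m\<ge>M. \<forall>n\<ge>M. norm (X m - X n) < 1" using CauchyD[OF C, of 1] by auto
  have "(\<lambda>i. (cmod (l i))\<^sup>2) summable_on UNIV"
    using ell2_add_summable[of "ell2_nth (X M)" "\<lambda>i. - (ell2_nth (X M) i - l i)"]
      summ[OF M order_refl] ell2_nth[of "X M"] by (simp add: norm_minus_commute)
  then have L: "ell2_nth (Ell2 l) = l" by (simp add: Ell2_inverse)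
  have "X \<longlonglongrightarrow> Ell2 l"
  proof (rule LIMSEQ_I)
    fix e :: real assume "0 < e"
    then obtain M where M: "\<forall>m\<ge>M. \<forall>n\<ge>M. norm (X m - X n) < e / 2"
      using CauchyD[OF C, of "e / 2"] by auto
    have "norm (X m - Ell2 l) < e" if "m \<ge> M" for m
    proof -
      have "(norm (X m - Ell2 l))\<^sup>2 \<le> (e / 2)\<^sup>2"
        unfolding norm_ell2_sq ell2_nth_diff L
        by (intro infsum_le_finite_sums summ[OF M that] fin[OF M that])
      then have "norm (X m - Ell2 l) \<le> e / 2" by (rule power2_le_imp_le) (use \<open>0 < e\<close> in simp)
      then show ?thesis using \<open>0 < e\<close> by simp
    qed
    then show "\<exists>M. \<forall>m\<ge>M. norm (X m - Ell2 l) < e" by blast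
  qed
  then show "convergent X" by (rule convergentI)
qed

end


section \<open>Caratheodory functions\<close>

text \<open>An operator-valued function on \<open>\<Omega>\<close> is a total function whose values outside \<open>\<Omega>\<close> play no
  role.  Membership in \<open>\<real>\<^sub>\<ge>\<^sub>0\<close> says that the complex number in question is real and nonnegative.\<close>

definition positive_kernel ::
    "complex set \<Rightarrow> (complex \<Rightarrow> complex \<Rightarrow> 'a::complex_normed_vector \<Rightarrow>\<^sub>B 'a cdual) \<Rightarrow> bool"
  where "positive_kernel \<Omega> K \<longleftrightarrow>
    (\<forall>n (z :: nat \<Rightarrow> complex) x. (\<forall>i<n. z i \<in> \<Omega>) \<longrightarrow>
      (\<Sum>i<n. \<Sum>j<n. \<llangle>K (z i) (z j) (x j), x i\<rrangle>) \<in> \<real>\<^sub>\<ge>\<^sub>0)"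

definition weakly_continuous_at_0 ::
    "complex set \<Rightarrow> (complex \<Rightarrow> 'a::complex_normed_vector \<Rightarrow>\<^sub>B 'a cdual) \<Rightarrow> bool"
  where "weakly_continuous_at_0 \<Omega> \<psi> \<longleftrightarrow>
    (\<forall>x. ((\<lambda>z. \<llangle>\<psi> z x, x\<rrangle>) \<longlongrightarrow> \<llangle>\<psi> 0 x, x\<rrangle>) (at 0 within \<Omega>))"

definition caratheodory_kernel ::
    "(complex \<Rightarrow> 'a::complex_normed_vector \<Rightarrow>\<^sub>B 'a cdual) \<Rightarrow> complex \<Rightarrow> complex \<Rightarrow> 'a \<Rightarrow>\<^sub>B 'a cdual"
  where "caratheodory_kernel \<psi> z w = (1 / (2 * (1 - z * cnj w))) *\<^sub>C (\<psi> z + adj_restr (\<psi> w))"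

definition caratheodory ::
    "complex set \<Rightarrow> (complex \<Rightarrow> 'a::complex_normed_vector \<Rightarrow>\<^sub>B 'a cdual) \<Rightarrow> bool"
  where "caratheodory \<Omega> \<psi> \<longleftrightarrow>
    weakly_continuous_at_0 \<Omega> \<psi> \<and> positive_kernel \<Omega> (caratheodory_kernel \<psi>)"

text \<open>The same notions for functions with values in \<open>L(B\<^sup>*,B)\<close>.\<close>

definition weakly_continuous_at_0' ::
    "complex set \<Rightarrow> (complex \<Rightarrow> 'b::complex_normed_vector cdual \<Rightarrow>\<^sub>B 'b) \<Rightarrow> bool"
  where "weakly_continuous_at_0' \<Omega> \<phi> \<longleftrightarrow> weakly_continuous_at_0 \<Omega> (\<lambda>z. \<tau> o\<^sub>B \<phi> z)"

definition caratheodory' ::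
    "complex set \<Rightarrow> (complex \<Rightarrow> 'b::complex_normed_vector cdual \<Rightarrow>\<^sub>B 'b) \<Rightarrow> bool"
  where "caratheodory' \<Omega> \<phi> \<longleftrightarrow> caratheodory \<Omega> (\<lambda>z. \<tau> o\<^sub>B \<phi> z)"

text \<open>For isometric \<open>V\<close> and \<open>\<bar>z\<bar> < 1\<close> the operators under \<open>cinv\<close> are invertible, since
  \<open>cnj z *\<^sub>C V\<close> and \<open>z *\<^sub>C hadj V\<close> have norm less than 1.\<close>

definition represents ::
    "complex set \<Rightarrow> (complex \<Rightarrow> 'b::complex_normed_vector cdual \<Rightarrow>\<^sub>B 'b) \<Rightarrow>
     ('h::complex_hilbert \<Rightarrow>\<^sub>B 'h) \<Rightarrow> ('b cdual \<Rightarrow>\<^sub>B 'h) \<Rightarrow> ('b cdual \<Rightarrow>\<^sub>B 'b cdual cdual) \<Rightarrow> bool"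
  where "represents \<Omega> \<phi> V C D \<longleftrightarrow> (\<forall>z\<in>\<Omega>.
    cadj (\<phi> z) = D + adj_to_dual C o\<^sub>B cinv (cid - cnj z *\<^sub>C V) o\<^sub>B (cid + cnj z *\<^sub>C V) o\<^sub>B C)"

definition represents' ::
    "complex set \<Rightarrow> (complex \<Rightarrow> 'b::complex_normed_vector cdual \<Rightarrow>\<^sub>B 'b) \<Rightarrow>
     ('h::complex_hilbert \<Rightarrow>\<^sub>B 'h) \<Rightarrow> ('b cdual \<Rightarrow>\<^sub>B 'h) \<Rightarrow> ('b cdual \<Rightarrow>\<^sub>B 'b cdual cdual) \<Rightarrow> bool"
  where "represents' \<Omega> \<phi> V C D \<longleftrightarrow> (\<forall>z\<in>\<Omega>.
    \<tau> o\<^sub>B \<phi> z =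
      adj_restr D + adj_to_dual C o\<^sub>B (cid + z *\<^sub>C hadj V) o\<^sub>B cinv (cid - z *\<^sub>C hadj V) o\<^sub>B C)"

text \<open>Complex differentiability in the norm of the target, as for \<open>holomorphic_on\<close>.\<close>

definition analytic_into :: "(complex \<Rightarrow> 'a::complex_normed_vector) \<Rightarrow> complex set \<Rightarrow> bool"
  where "analytic_into f S \<longleftrightarrow> (\<forall>z\<in>S. \<exists>f'. (f has_derivative (\<lambda>h. h *\<^sub>C f')) (at z within S))"

end

theory Submission
  imports Defs
begin

text \<open>
  Throughout, \<open>X = B\<^sup>*\<close>, \<open>\<psi>(z) = \<tau> \<phi>(z)\<close>, and \<open>k(z,w)\<close> is the kernel
  \<open>(\<psi>(z) + \<psi>(w)\<^sup>*) / 2 (1 - z cnj w)\<close>.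

  \<^bold>\<open>From the representation to positivity.\<close>  Put \<open>a\<^sub>w x = (I - cnj w V)\<inverse> C x\<close>.  Since \<open>V\<close> is
  isometric, the terms of
  \<open>\<langle>a - cnj w V a, b + cnj z V b\<rangle> + \<langle>a + cnj w V a, b - cnj z V b\<rangle>\<close> recombine to
  \<open>2 (1 - z cnj w) \<langle>a, b\<rangle>\<close>, so \<open>k(z,w)\<close> is the Gram kernel \<open>\<langle>a\<^sub>w x, a\<^sub>z y\<rangle>\<close>, the imaginary part
  \<open>D\<close> having cancelled (\<open>represents_positive_kernel\<close>).

  \<^bold>\<open>From positivity to the representation.\<close>  Conversely let vectors \<open>v\<^sub>w x\<close> with
  \<open>\<langle>v\<^sub>w x, v\<^sub>z y\<rangle> = \<langle>k(z,w) x, y\<rangle>\<close> be given.  They ought to be the \<open>a\<^sub>w x\<close>, so \<open>C x\<close> must be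
  \<open>v\<^sub>0 x\<close>, and \<open>V\<close> must send \<open>cnj w v\<^sub>w x\<close> to \<open>v\<^sub>w x - v\<^sub>0 x\<close>.  The numerator of \<open>k\<close> is a sum of
  a function of \<open>z\<close> and a function of \<open>w\<close>, and this is precisely what makes that prescription
  preserve inner products.  Weak continuity at the origin gives \<open>v\<^sub>w x \<rightarrow> v\<^sub>0 x\<close>, hence the
  vectors \<open>cnj w v\<^sub>w x\<close> have the same closed span as all the \<open>v\<^sub>w x\<close>.  The prescription
  therefore defines an isometry of this closed span into itself, which extends by the identity on the
  orthogonal complement (\<open>isometric_extension\<close>); the resulting formula is checked in
  \<open>caratheodory_imp_represents\<close>.

  The vectors themselves come from \<open>kolmogorov_decomposition\<close>, a transfinite Cholesky factorisation
  which realises a positive kernel on any index type \<open>'i\<close> inside \<open>'i ell2\<close>.  It is applied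
  with the columns \<open>k(\<sqdot>,w) x\<close> of the kernel, which are functions
  \<open>complex \<Rightarrow> 'b cdual cdual\<close>, as indices.

  \<^bold>\<open>Analytic extension.\<close>  The right-hand side of the second representation is analytic in the whole
  disk, but its values are operators into \<open>B\<^sup>*\<^sup>*\<close>.  By the Hahn-Banach theorem \<open>\<tau>\<close> is isometric, so
  its range is a closed subspace.  Near the origin the values lie in it; the Taylor coefficients
  at the origin are limits of difference quotients and so lie in it too, and the Taylor
  series converges on the disk (\<open>resolvent_orbit_in_closed_subspace\<close>).  The extension, and likewise
  its derivative, can then be pulled back along \<open>\<tau>\<close>.

  The Riesz representation theorem is stated for linear relations (\<open>riesz_relation\<close>); in this form it
  provides the Hilbert space adjoint, the projection onto a closed span and the
  inductive step of the Kolmogorov decomposition.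
\<close>

section \<open>Continuity and linearity of the basic operations\<close>

lemma scaleC_minus_left: "(- a) *\<^sub>C x = - (a *\<^sub>C x)"
  using scaleC_add_left[of a "- a" x] by (simp add: eq_neg_iff_add_eq_0 add.commute)

lemma scaleC_diff_left: "(a - b) *\<^sub>C x = a *\<^sub>C x - b *\<^sub>C x"
  using scaleC_add_left[of a "- b" x] by (simp add: scaleC_minus_left)

lemma bounded_bilinear_scaleC: "bounded_bilinear (\<lambda>c (x::'a::complex_normed_vector). c *\<^sub>C x)"
  by (rule bounded_bilinear.intro)
    (auto simp: scaleC_add_left scaleC_add_right scaleC_scaleR norm_scaleC scaleC_scaleC
      scaleR_scaleC scaleR_conv_of_real mult.commute intro!: exI[of _ 1])

lemma bounded_bilinear_cinner: "bounded_bilinear (cinner :: 'a::complex_inner \<Rightarrow> 'a \<Rightarrow> complex)"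
  by (rule bounded_bilinear.intro)
    (auto simp: cinner_add_left cinner_add_right scaleR_scaleC cinner_scaleC_left cinner_scaleC_right
      scaleR_conv_of_real intro!: exI[of _ 1] cauchy_schwarz)

lemmas tendsto_cinner = bounded_bilinear.tendsto[OF bounded_bilinear_cinner]
lemmas tendsto_scaleC = bounded_bilinear.tendsto[OF bounded_bilinear_scaleC]

lemma bounded_linear_capply: "bounded_linear (capply f)"
  unfolding capply.rep_eq by (rule blinfun.bounded_linear_right)

lemmas tendsto_capply = bounded_linear.tendsto[OF bounded_linear_capply]

lemma capply_zero [simp]: "capply f 0 = 0"
  using capply_add[of f 0 0] by simp

lemma capply_diff: "capply f (x - y) = capply f x - capply f y"
  using capply_add[of f "x - y" y] by simp

lemma capply_plus_op: "capply (f + g) x = capply f x + capply g x"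
  by transfer (rule blinfun.add_left)

lemma capply_minus_op: "capply (f - g) x = capply f x - capply g x"
  by transfer (rule blinfun.diff_left)

lemma capply_zero_op [simp]: "capply 0 x = 0"
  by transfer simp

lemma capply_scaleC_op: "capply (c *\<^sub>C f) x = c *\<^sub>C capply f x"
proof -
  show ?thesis
    by transfer (simp add: bounded_linear_Blinfun_apply
      bounded_linear_compose[OF bounded_linear_scaleC blinfun.bounded_linear_right])
qed

lemma norm_cblinfun_bound: "0 \<le> K \<Longrightarrow> (\<And>x. norm (capply f x) \<le> K * norm x) \<Longrightarrow> norm f \<le> K"
  by transfer (rule norm_blinfun_bound)

lemma cpair_diff_left: "\<llangle>f - g, x\<rrangle> = \<llangle>f, x\<rrangle> - \<llangle>g, x\<rrangle>"
  using cpair_add_left[of "f - g" g x] by simp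

lemma cpair_zero_left [simp]: "\<llangle>0, x\<rrangle> = 0"
  by transfer simp

lemma norm_eqI_cinner:
  assumes "cinner x x = cinner y y"
  shows "norm x = norm y"
proof -
  have "(norm x)\<^sup>2 = (norm y)\<^sup>2" using assms unfolding cinner_self of_real_eq_iff .
  then show ?thesis by simp
qed

lemma norm_add_sq: "(norm (x + y))\<^sup>2 = (norm x)\<^sup>2 + 2 * Re (cinner x y) + (norm (y::'a::complex_inner))\<^sup>2"
proof -
  have "cinner (x + y) (x + y) = cinner x x + (cinner x y + cnj (cinner x y)) + cinner y y"
    using cinner_commute[of y x] by (simp add: cinner_add_left cinner_add_right)
  then have "complex_of_real ((norm (x + y))\<^sup>2) = complex_of_real ((norm x)\<^sup>2 + 2 * Re (cinner x y) + (norm y)\<^sup>2)"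
    by (simp add: cinner_self complex_add_cnj)
  then show ?thesis unfolding of_real_eq_iff .
qed

lemma norm_diff_sq: "(norm (x - y))\<^sup>2 = (norm x)\<^sup>2 - 2 * Re (cinner x y) + (norm (y::'a::complex_inner))\<^sup>2"
  using norm_add_sq[of x "- y"] cinner_diff_right[of x 0 y] by simp

lemma cinner_eq_0_all: "(\<And>y. cinner x y = 0) \<Longrightarrow> x = 0"
  using cinner_self[of x] by simp

lemma cinner_cong_left: "(\<And>y. cinner x y = cinner x' y) \<Longrightarrow> x = x'"
  using cinner_eq_0_all[of "x - x'"] by (simp add: cinner_diff_left)

text \<open>Polarization: the norm determines the real part of the inner product, and replacing \<open>x\<close> by
  \<open>\<i> x\<close> the imaginary part as well.\<close>

lemma isometric_cinner:
  fixes V :: "'h::complex_inner \<Rightarrow>\<^sub>B 'h"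
  assumes "isometric V"
  shows "cinner (V x) (V y) = cinner x y"
proof -
  have Re: "Re (cinner (V x) (V y)) = Re (cinner x y)" for x y
    using norm_add_sq[of x y] norm_add_sq[of "V x" "V y"] assms
    by (simp add: isometric_def flip: capply_add)
  show ?thesis
    using Re[of x y] Re[of "\<i> *\<^sub>C x" y]
    by (simp add: complex_eq_iff capply_scaleC cinner_scaleC_left)
qed


section \<open>Linear relations and the Riesz representation theorem\<close>

text \<open>Working with relations instead of functions removes well-definedness from the construction of
  functionals and operators on a span: it becomes a consequence of the norm bound, which forces the
  second component to vanish when the first does.\<close>

definition linear_relation :: "('a::complex_normed_vector \<times> 'b::complex_normed_vector) set \<Rightarrow> bool"
  where "linear_relation M \<longleftrightarrow> (0, 0) \<in> M
    \<and> (\<forall>x y x' y'. (x, y) \<in> M \<longrightarrow> (x', y') \<in> M \<longrightarrow> (x + x', y + y') \<in> M)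
    \<and> (\<forall>c x y. (x, y) \<in> M \<longrightarrow> (c *\<^sub>C x, c *\<^sub>C y) \<in> M)"

text \<open>The smallest linear relation containing \<open>G\<close>, generated one term at a time so that its induction
  rule replaces computations with finite sums.\<close>

inductive_set relspan ::
    "('a::complex_normed_vector \<times> 'b::complex_normed_vector) set \<Rightarrow> ('a \<times> 'b) set" for G
  where zero: "(0, 0) \<in> relspan G"
  | step: "(a, b) \<in> G \<Longrightarrow> (x, y) \<in> relspan G \<Longrightarrow> (c *\<^sub>C a + x, c *\<^sub>C b + y) \<in> relspan G"

lemma linear_relation_relspan: "linear_relation (relspan G)"
proof -
  have "(x, y) \<in> relspan G \<Longrightarrow> (x', y') \<in> relspan G \<Longrightarrow> (x + x', y + y') \<in> relspan G" for x y x' y'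
    by (induction rule: relspan.induct) (auto simp: add.assoc intro: relspan.intros)
  moreover have "(x, y) \<in> relspan G \<Longrightarrow> (c *\<^sub>C x, c *\<^sub>C y) \<in> relspan G" for c x y
    by (induction rule: relspan.induct)
      (auto simp: scaleC_add_right scaleC_scaleC intro: relspan.intros)
  ultimately show ?thesis by (auto simp: linear_relation_def intro: relspan.zero)
qed

lemma relspan_base: "(a, b) \<in> G \<Longrightarrow> (a, b) \<in> relspan G"
  using relspan.step[of a b G 0 0 1] relspan.zero[of G] by simp

lemma linear_relation_diff:
  assumes "linear_relation M" "(x, y) \<in> M" "(x', y') \<in> M"
  shows "(x - x', y - y') \<in> M"
proof -
  have "((-1) *\<^sub>C x', (-1) *\<^sub>C y') \<in> M" using assms by (auto simp: linear_relation_def)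
  then have "(x + (-1) *\<^sub>C x', y + (-1) *\<^sub>C y') \<in> M" using assms unfolding linear_relation_def by blast
  then show ?thesis by (simp add: scaleC_minus_left)
qed

text \<open>A bounded functional on a subspace is represented by the vector \<open>w\<close> that minimises
  \<open>\<parallel>x\<parallel>\<^sup>2 - 2 Re y\<close> over the relation.  The parallelogram law makes a minimising sequence Cauchy, and
  the vanishing of the first variation is the real part of \<open>y = \<langle>x, w\<rangle>\<close>; applying this to multiples
  by \<open>\<i>\<close> gives the imaginary part.  That \<open>w\<close> is a limit of points of the
  domain is what makes it an orthogonal projection in the applications.\<close>

lemma riesz_relation:
  fixes M :: "('h::complex_hilbert \<times> complex) set"
  assumes M: "linear_relation M"
    and bd: "\<And>x y. (x, y) \<in> M \<Longrightarrow> cmod y \<le> K * norm x" and K: "0 \<le> K"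
  obtains w where "w \<in> closure (fst ` M)" "\<And>x y. (x, y) \<in> M \<Longrightarrow> y = cinner x w" "norm w \<le> K"
proof -
  define J where "J p = (norm (fst p))\<^sup>2 - 2 * Re (snd p)" for p :: "'h \<times> complex"
  define m where "m = Inf (J ` M)"
  have M0: "(0, 0) \<in> M" and Madd: "\<And>x y x' y'. (x, y) \<in> M \<Longrightarrow> (x', y') \<in> M \<Longrightarrow> (x + x', y + y') \<in> M"
    and Msc: "\<And>c x y. (x, y) \<in> M \<Longrightarrow> (c *\<^sub>C x, c *\<^sub>C y) \<in> M"
    using M by (auto simp: linear_relation_def)
  have lb: "- K\<^sup>2 \<le> J p" if "p \<in> M" for p
  proof -
    have "Re (snd p) \<le> K * norm (fst p)"
      using bd[of "fst p" "snd p"] that complex_Re_le_cmod[of "snd p"] by simp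
    moreover have "0 \<le> (norm (fst p) - K)\<^sup>2" by simp
    ultimately show ?thesis unfolding J_def power2_diff by (simp add: mult.commute)
  qed
  then have bdd: "bdd_below (J ` M)" by (auto intro!: bdd_belowI2)
  have mle: "m \<le> J p" if "p \<in> M" for p
    unfolding m_def using bdd that by (simp add: cINF_lower)
  have "\<exists>p\<in>M. J p < m + 1 / real (Suc n)" for n
  proof -
    have "J ` M \<noteq> {}" "Inf (J ` M) < m + 1 / real (Suc n)" using M0 by (auto simp: m_def)
    from cInf_lessD[OF this] show ?thesis by blast
  qed
  then obtain p where pM: "\<And>n. p n \<in> M" and pJ: "\<And>n. J (p n) < m + 1 / real (Suc n)" by metis
  define x where "x n = fst (p n)" for n
  define y where "y n = snd (p n)" for n
  have xyM: "(x n, y n) \<in> M" for n using pM by (simp add: x_def y_def)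
  have J': "J (x n, y n) < m + 1 / real (Suc n)" for n using pJ by (simp add: x_def y_def)
  \<comment> \<open>The midpoint of two members is a member, so its value is at least \<open>m\<close>.\<close>
  have par: "(norm (x n - x k))\<^sup>2 \<le> 2 / real (Suc n) + 2 / real (Suc k)" for n k
  proof -
    have "((1/2) *\<^sub>C (x n + x k), (1/2) *\<^sub>C (y n + y k)) \<in> M" by (intro Msc Madd xyM)
    then have "m \<le> J ((1/2) *\<^sub>C (x n + x k), (1/2) *\<^sub>C (y n + y k))" by (rule mle)
    also have "\<dots> = (norm (x n + x k))\<^sup>2 / 4 - Re (y n) - Re (y k)"
      by (simp add: J_def norm_scaleC power_divide norm_divide field_simps)
    finally have "4 * m \<le> (norm (x n + x k))\<^sup>2 - 4 * Re (y n) - 4 * Re (y k)" by simp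
    moreover have "(norm (x n + x k))\<^sup>2 + (norm (x n - x k))\<^sup>2 = 2 * (norm (x n))\<^sup>2 + 2 * (norm (x k))\<^sup>2"
      by (simp add: norm_add_sq norm_diff_sq)
    moreover have "(norm (x n))\<^sup>2 - 2 * Re (y n) < m + 1 / real (Suc n)"
      "(norm (x k))\<^sup>2 - 2 * Re (y k) < m + 1 / real (Suc k)"
      using J'[of n] J'[of k] by (simp_all add: J_def)
    ultimately show ?thesis by simp
  qed
  have "Cauchy x"
  proof (rule metric_CauchyI)
    fix e :: real assume e: "0 < e"
    obtain N where N: "4 / e\<^sup>2 < real N" using reals_Archimedean2 by blast
    have "dist (x n) (x k) < e" if "n \<ge> N" "k \<ge> N" for n k
    proof -
      have N0: "0 < real (Suc N)" by simp
      have "2 / real (Suc n) \<le> 2 / real (Suc N)" "2 / real (Suc k) \<le> 2 / real (Suc N)"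
        using that by (simp_all add: frac_le)
      moreover have "4 / real (Suc N) < e\<^sup>2"
      proof -
        have "4 / e\<^sup>2 < real (Suc N)" using N by simp
        then show ?thesis using e N0 by (simp add: field_simps del: of_nat_Suc)
      qed
      ultimately have "(norm (x n - x k))\<^sup>2 < e\<^sup>2" using par[of n k] by simp
      then show ?thesis using e by (simp add: dist_norm power_less_imp_less_base)
    qed
    then show "\<exists>M. \<forall>m\<ge>M. \<forall>n\<ge>M. dist (x m) (x n) < e" by blast
  qed
  then obtain w where w: "x \<longlonglongrightarrow> w" using Cauchy_convergent_iff convergent_def by blast
  have cl: "w \<in> closure (fst ` M)"
    unfolding closure_sequential using w xyM by force
  have Re: "Re (cinner w a) = Re b" if ab: "(a, b) \<in> M" for a b
  proof -
    define d where "d = Re (cinner w a) - Re b"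
    \<comment> \<open>First-order condition: moving the minimising sequence by \<open>t a\<close> changes the limit
        value \<open>m\<close> by \<open>2 t d + t\<^sup>2 \<parallel>a\<parallel>\<^sup>2\<close>, which therefore is nonnegative for all real \<open>t\<close>.\<close>
    have nn: "0 \<le> 2 * t * d + t\<^sup>2 * (norm a)\<^sup>2" for t
    proof -
      have "2 * t * (Re b - Re (cinner (x n) a)) - t\<^sup>2 * (norm a)\<^sup>2 \<le> 1 / real (Suc n)" for n
      proof -
        have "(x n + of_real t *\<^sub>C a, y n + of_real t *\<^sub>C b) \<in> M" by (intro Madd Msc xyM ab)
        then have "m \<le> J (x n + of_real t *\<^sub>C a, y n + of_real t *\<^sub>C b)" by (rule mle)
        also have "\<dots> = J (x n, y n) + 2 * t * (Re (cinner (x n) a) - Re b) + t\<^sup>2 * (norm a)\<^sup>2"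
          by (simp add: J_def norm_add_sq cinner_scaleC_right norm_scaleC power_mult_distrib algebra_simps)
        finally show ?thesis using J'[of n] by (simp add: algebra_simps)
      qed
      moreover have "(\<lambda>n. 2 * t * (Re b - Re (cinner (x n) a)) - t\<^sup>2 * (norm a)\<^sup>2)
          \<longlonglongrightarrow> 2 * t * (Re b - Re (cinner w a)) - t\<^sup>2 * (norm a)\<^sup>2"
        by (intro tendsto_intros tendsto_cinner w)
      moreover have "(\<lambda>n. 1 / real (Suc n)) \<longlonglongrightarrow> 0"
        using LIMSEQ_inverse_real_of_nat by (simp add: inverse_eq_divide)
      ultimately have "2 * t * (Re b - Re (cinner w a)) - t\<^sup>2 * (norm a)\<^sup>2 \<le> 0"
        by (intro LIMSEQ_le) auto
      then show ?thesis by (simp add: d_def algebra_simps)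
    qed
    have "d = 0"
    proof (rule ccontr)
      assume "d \<noteq> 0"
      \<comment> \<open>The choice \<open>t = - d / q\<close> is defined also for \<open>a = 0\<close> and makes the quadratic
          negative.\<close>
      define q where "q = (norm a)\<^sup>2 + 1"
      have q: "q > 0" by (simp add: q_def add_nonneg_pos)
      have "0 \<le> 2 * (- d / q) * d + (- d / q)\<^sup>2 * (norm a)\<^sup>2" by (rule nn)
      also have "\<dots> \<le> 2 * (- d / q) * d + (- d / q)\<^sup>2 * q"
        by (intro add_left_mono mult_left_mono) (simp_all add: q_def)
      also have "\<dots> = - d\<^sup>2 / q" using q by (simp add: field_simps power2_eq_square)
      also have "\<dots> < 0" using q \<open>d \<noteq> 0\<close> by simp
      finally show False by simp
    qed
    then show ?thesis by (simp add: d_def)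
  qed
  have rep: "b = cinner a w" if ab: "(a, b) \<in> M" for a b
  proof -
    have "Re (cinner a w) = Re b" using Re[OF ab] cinner_commute[of w a] by simp
    moreover have "Im (cinner a w) = Im b"
      using Re[OF Msc[OF ab, of "- \<i>"]] cinner_commute[of w a] by (simp add: cinner_scaleC_right)
    ultimately show ?thesis by (simp add: complex_eq_iff)
  qed
  have "norm w \<le> K"
  proof -
    have "(\<lambda>n. cmod (cinner (x n) w)) \<longlonglongrightarrow> cmod (cinner w w)"
      by (intro tendsto_intros tendsto_cinner w)
    moreover have "(\<lambda>n. K * norm (x n)) \<longlonglongrightarrow> K * norm w" by (intro tendsto_intros w)
    moreover have "cmod (cinner (x n) w) \<le> K * norm (x n)" for n
      using bd[OF xyM[of n]] rep[OF xyM[of n]] by simp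
    ultimately have "cmod (cinner w w) \<le> K * norm w" by (intro LIMSEQ_le) auto
    moreover have "cmod (cinner w w) = norm w * norm w"
      unfolding cinner_self norm_of_real by (simp add: power2_eq_square)
    ultimately show ?thesis using K by (cases "w = 0") auto
  qed
  then show thesis using that[of w] cl rep by blast
qed

text \<open>Existence of the adjoint: \<open>V\<^sup>* x\<close> represents the bounded functional
  \<open>y \<mapsto> \<langle>V y, x\<rangle>\<close>.\<close>

lemma hadj_apply: "cinner (hadj V x) y = cinner x (V y)"
proof -
  have "\<exists>w. \<forall>y. cinner w y = cinner x (V y)" for x
  proof -
    define M where "M = range (\<lambda>y. (y, cinner (V y) x))"
    have "linear_relation M"
      unfolding linear_relation_def M_def
    proof (intro conjI allI impI)
      show "(0, 0) \<in> range (\<lambda>y. (y, cinner (V y) x))" by (rule range_eqI[of _ _ 0]) simp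
    qed (auto simp: capply_add capply_scaleC cinner_add_left cinner_scaleC_left)
    moreover have "cmod b \<le> (norm V * norm x) * norm a" if "(a, b) \<in> M" for a b
    proof -
      have "cmod (cinner (V a) x) \<le> norm (V a) * norm x" by (rule cauchy_schwarz)
      also have "\<dots> \<le> (norm V * norm a) * norm x" by (intro mult_right_mono norm_capply) simp
      finally show ?thesis using that by (auto simp: M_def mult_ac)
    qed
    ultimately obtain w where "\<And>a b. (a, b) \<in> M \<Longrightarrow> b = cinner a w"
      by (rule riesz_relation) auto
    then have "cinner (V y) x = cinner y w" for y by (simp add: M_def)
    then have "cinner w y = cinner x (V y)" for y by (metis cinner_commute)
    then show ?thesis by blast
  qed
  then obtain W where W: "\<And>x y. cinner (W x) y = cinner x (V y)" by metis
  have "bounded_clinear W"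
    unfolding bounded_clinear_def
  proof (intro conjI allI exI[of _ "norm V"])
    show "W (x + y) = W x + W y" for x y
      by (rule cinner_cong_left) (simp add: W cinner_add_left)
    show "W (c *\<^sub>C x) = c *\<^sub>C W x" for c x
      by (rule cinner_cong_left) (simp add: W cinner_scaleC_left)
    show "norm (W x) \<le> norm V * norm x" for x
    proof -
      have "norm (W x) * norm (W x) = cmod (cinner x (V (W x)))"
        unfolding W[symmetric] cinner_self norm_of_real by (simp add: power2_eq_square)
      also have "\<dots> \<le> norm x * norm (V (W x))" by (rule cauchy_schwarz)
      also have "\<dots> \<le> norm x * (norm V * norm (W x))" by (intro mult_left_mono norm_capply) simp
      finally have "norm (W x) * norm (W x) \<le> (norm V * norm x) * norm (W x)" by (simp add: mult_ac)
      then show ?thesis by (cases "W x = 0") auto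
    qed
  qed
  then have "\<forall>x y. cinner (capply (mk_op W) x) y = cinner x (V y)" by (simp add: capply_mk_op W)
  moreover have "A = B" if "\<forall>x y. cinner (capply A x) y = cinner x (V y)"
    "\<forall>x y. cinner (capply B x) y = cinner x (V y)" for A B :: "'a \<Rightarrow>\<^sub>B 'a"
    by (rule cblinfun_eqI, rule cinner_cong_left) (simp add: that)
  ultimately have "\<exists>!W :: 'a \<Rightarrow>\<^sub>B 'a. \<forall>x y. cinner (W x) y = cinner x (V y)" by blast
  from theI'[OF this] show ?thesis unfolding hadj_def by blast
qed

lemma norm_hadj_isometric:
  assumes "isometric V"
  shows "norm (hadj V x) \<le> norm x"
proof -
  have "norm (hadj V x) * norm (hadj V x) = cmod (cinner x (V (hadj V x)))"
    unfolding hadj_apply[symmetric] cinner_self norm_of_real by (simp add: power2_eq_square)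
  also have "\<dots> \<le> norm x * norm (hadj V x)"
    using cauchy_schwarz[of x "V (hadj V x)"] assms by (simp add: isometric_def)
  finally show ?thesis by (cases "hadj V x = 0") auto
qed

section \<open>The Hahn-Banach theorem and the natural injection\<close>

text \<open>The Hahn-Banach theorem in the case that is needed for norming functionals.  A maximal subspace
  \<open>G\<close> of \<open>'a \<times> real\<close> on which the second component is at most the norm of the first is
  the graph of the functional.  If \<open>x\<close> were missing from its domain, any
  \<open>\<alpha>\<close> separating the numbers \<open>a - \<parallel>u - x\<parallel>\<close> from the numbers \<open>\<parallel>u' + x\<parallel> - a'\<close> would be an
  admissible value at \<open>x\<close>; the triangle inequality provides such an \<open>\<alpha>\<close>.\<close>

lemma norming_real_functional:
  fixes x0 :: "'a::real_normed_vector"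
  obtains g :: "'a \<Rightarrow> real" where "linear g" "\<And>x. g x \<le> norm x" "g x0 = norm x0"
proof -
  define A where "A = {G :: ('a \<times> real) set. subspace G \<and> (x0, norm x0) \<in> G \<and> (\<forall>(x, y)\<in>G. y \<le> norm x)}"
  have "\<exists>G\<in>A. \<forall>X\<in>A. G \<subseteq> X \<longrightarrow> X = G"
  proof (rule subset_Zorn_nonempty)
    have "span {(x0, norm x0)} \<in> A"
    proof -
      have "y \<le> norm x" if xy: "(x, y) \<in> span {(x0, norm x0)}" for x y
      proof -
        obtain k where "x = k *\<^sub>R x0" "y = k * norm x0"
          using xy unfolding span_singleton by auto
        then show ?thesis by (simp add: mult_right_mono)
      qed
      then show ?thesis by (auto simp: A_def intro: span_base)
    qed
    then show "A \<noteq> {}" by blast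
  next
    fix C assume C: "C \<noteq> {}" "subset.chain A C"
    have sub: "subspace G" "(x0, norm x0) \<in> G" "\<forall>(x, y)\<in>G. y \<le> norm x" if "G \<in> C" for G
      using C that by (auto simp: subset.chain_def A_def)
    have dir: "\<exists>G\<in>C. p \<in> G \<and> q \<in> G" if "p \<in> \<Union>C" "q \<in> \<Union>C" for p q
      using C that unfolding subset.chain_def by blast
    have "subspace (\<Union>C)"
      unfolding subspace_def
    proof (intro conjI ballI allI)
      show "0 \<in> \<Union>C" using C sub(1) subspace_0 by blast
      show "p + q \<in> \<Union>C" if "p \<in> \<Union>C" "q \<in> \<Union>C" for p q
        using dir[OF that] sub(1) subspace_add by blast
      show "c *\<^sub>R p \<in> \<Union>C" if "p \<in> \<Union>C" for c p
        using that sub(1) subspace_scale by blast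
    qed
    then show "\<Union>C \<in> A" using C sub unfolding A_def by blast
  qed
  then obtain G where "G \<in> A" and max: "\<And>X. X \<in> A \<Longrightarrow> G \<subseteq> X \<Longrightarrow> X = G" by blast
  then have G: "subspace G" "(x0, norm x0) \<in> G" and le: "\<And>x y. (x, y) \<in> G \<Longrightarrow> y \<le> norm x"
    by (auto simp: A_def)
  have unique: "y = y'" if "(x, y) \<in> G" "(x, y') \<in> G" for x y y'
  proof -
    have "(0, y - y') \<in> G" "(0, y' - y) \<in> G"
      using subspace_diff[OF G(1) that] subspace_diff[OF G(1) that(2,1)] by simp_all
    then show ?thesis using le[of 0 "y - y'"] le[of 0 "y' - y"] by simp
  qed
  have total: "\<exists>y. (x, y) \<in> G" for x
  proof -
    define L where "L = {a - norm (u - x) |u a. (u, a) \<in> G}"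
    have sep: "a - norm (u - x) \<le> norm (u' + x) - a'" if "(u, a) \<in> G" "(u', a') \<in> G" for u a u' a'
    proof -
      have "a + a' \<le> norm (u + u')" using subspace_add[OF G(1) that] by (auto intro: le)
      also have "\<dots> \<le> norm (u - x) + norm (u' + x)" using norm_triangle_ineq[of "u - x" "u' + x"] by simp
      finally show ?thesis by simp
    qed
    have 0: "(0, 0) \<in> G" using subspace_0[OF G(1)] by (simp add: zero_prod_def)
    have ne: "L \<noteq> {}" using 0 by (auto simp: L_def)
    have bdd: "bdd_above L" using sep[OF _ 0] by (auto simp: L_def intro!: bdd_aboveI)
    define \<alpha> where "\<alpha> = Sup L"
    have lower: "a - norm (u - x) \<le> \<alpha>" if "(u, a) \<in> G" for u a
      unfolding \<alpha>_def using that bdd by (auto simp: L_def intro!: cSup_upper)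
    have upper: "\<alpha> \<le> norm (u + x) - a" if "(u, a) \<in> G" for u a
      unfolding \<alpha>_def using ne sep[OF _ that] by (intro cSup_least) (auto simp: L_def)
    \<comment> \<open>By homogeneity only \<open>t = 1\<close> and \<open>t = -1\<close> matter, which are the two bounds on
        \<open>\<alpha>\<close>.\<close>
    have ext: "a + t * \<alpha> \<le> norm (u + t *\<^sub>R x)" if ua: "(u, a) \<in> G" for u a t
    proof -
      have sc: "((1/\<bar>t\<bar>) *\<^sub>R u, (1/\<bar>t\<bar>) * a) \<in> G"
        using subspace_scale[OF G(1) ua, of "1/\<bar>t\<bar>"] by simp
      consider "t = 0" | "t > 0" | "t < 0" by linarith
      then show ?thesis
      proof cases
        case 1 then show ?thesis using le[OF ua] by simp
      next
        case 2
        have "u + t *\<^sub>R x = t *\<^sub>R ((1/\<bar>t\<bar>) *\<^sub>R u + x)" using 2 by (simp add: scaleR_add_right)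
        then have "norm (u + t *\<^sub>R x) = t * norm ((1/\<bar>t\<bar>) *\<^sub>R u + x)" using 2 by simp
        moreover have "t * \<alpha> \<le> t * (norm ((1/\<bar>t\<bar>) *\<^sub>R u + x) - (1/\<bar>t\<bar>) * a)"
          using upper[OF sc] 2 by (intro mult_left_mono) auto
        ultimately show ?thesis using 2 by (simp add: right_diff_distrib)
      next
        case 3
        have "u + t *\<^sub>R x = (- t) *\<^sub>R ((1/\<bar>t\<bar>) *\<^sub>R u - x)" using 3 by (simp add: scaleR_diff_right)
        then have "norm (u + t *\<^sub>R x) = (- t) * norm ((1/\<bar>t\<bar>) *\<^sub>R u - x)" using 3 by simp
        moreover have "(- t) * ((1/\<bar>t\<bar>) * a - norm ((1/\<bar>t\<bar>) *\<^sub>R u - x)) \<le> (- t) * \<alpha>"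
          using lower[OF sc] 3 by (intro mult_left_mono) auto
        ultimately show ?thesis using 3 by (simp add: right_diff_distrib)
      qed
    qed
    have "span (insert (x, \<alpha>) G) \<in> A"
    proof -
      have "d \<le> norm v" if vd: "(v, d) \<in> span (insert (x, \<alpha>) G)" for v d
      proof -
        obtain t where "(v, d) - t *\<^sub>R (x, \<alpha>) \<in> span G" using vd unfolding span_insert by blast
        then have "(v - t *\<^sub>R x, d - t * \<alpha>) \<in> G" using G(1) by (simp add: span_eq_iff[THEN iffD2])
        from ext[OF this, of t] show ?thesis by simp
      qed
      moreover have "(x0, norm x0) \<in> span (insert (x, \<alpha>) G)" using G(2) by (simp add: span_base)
      ultimately show ?thesis by (auto simp: A_def)
    qed
    moreover have "G \<subseteq> span (insert (x, \<alpha>) G)" by (auto intro: span_base)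
    ultimately have "span (insert (x, \<alpha>) G) = G" by (rule max)
    then have "(x, \<alpha>) \<in> G" using span_base[of "(x, \<alpha>)" "insert (x, \<alpha>) G"] by simp
    then show ?thesis ..
  qed
  then obtain g where g: "\<And>x. (x, g x) \<in> G" by metis
  have "linear g"
  proof (rule linearI)
    show "g (x + y) = g x + g y" for x y
      using subspace_add[OF G(1) g[of x] g[of y]] by (intro unique[OF g]) simp
    show "g (r *\<^sub>R x) = r *\<^sub>R g x" for r x
      using subspace_scale[OF G(1) g[of x], of r] by (intro unique[OF g]) simp
  qed
  then show thesis using that[of g] g G(2) le unique by blast
qed

text \<open>A real-linear functional \<open>g\<close> is the real part of the anti-linear functional
  \<open>x \<mapsto> g x + \<i> g (\<i> x)\<close>, which obeys the same norm bound.\<close>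

lemma norming_functional:
  fixes x0 :: "'a::complex_normed_vector"
  obtains f :: "'a cdual" where "norm f \<le> 1" "norm x0 \<le> cmod \<llangle>f, x0\<rrangle>"
proof -
  obtain g :: "'a \<Rightarrow> real" where g: "linear g" "\<And>x. g x \<le> norm x" "g x0 = norm x0"
    by (rule norming_real_functional[of x0]) blast
  define f where "f x = Complex (g x) (g (\<i> *\<^sub>C x))" for x
  have sc: "c *\<^sub>C x = Re c *\<^sub>R x + Im c *\<^sub>R (\<i> *\<^sub>C x)" for c and x :: 'a
    by (metis complex_eq scaleC_add_left scaleC_scaleC scaleR_scaleC mult.commute)
  have ii: "\<i> *\<^sub>C \<i> *\<^sub>C x = - x" for x :: 'a by (simp add: scaleC_scaleC scaleC_minus_left)
  have fsc: "f (c *\<^sub>C x) = cnj c * f x" for c x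
  proof -
    have "\<i> *\<^sub>C c *\<^sub>C x = Re c *\<^sub>R (\<i> *\<^sub>C x) - Im c *\<^sub>R x"
      unfolding sc[of c x] scaleC_add_right scaleC_scaleR ii by simp
    then show ?thesis
      unfolding f_def using sc[of c x] g(1)
      by (simp add: complex_eq_iff linear_add linear_diff linear_scale)
  qed
  have bd: "cmod (f x) \<le> norm x" for x
  proof (cases "f x = 0")
    case False
    \<comment> \<open>Rotate \<open>x\<close> so that \<open>f\<close> becomes real there, where it agrees with \<open>g\<close>.\<close>
    define c where "c = f x / of_real (cmod (f x))"
    have c: "cmod c = 1" using False by (simp add: c_def norm_divide)
    have "f (c *\<^sub>C x) = of_real (cmod (f x))"
      using False complex_norm_square[of "f x"]
      by (simp add: fsc c_def power2_eq_square field_simps)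
    then have "cmod (f x) = g (c *\<^sub>C x)" by (simp add: f_def complex_eq_iff)
    also have "\<dots> \<le> norm (c *\<^sub>C x)" by (rule g)
    finally show ?thesis by (simp add: norm_scaleC c)
  qed simp
  have form: "bounded_antilinear_form f"
    unfolding bounded_antilinear_form_def
  proof (intro conjI allI exI[of _ 1])
    show "f (x + y) = f x + f y" for x y
      unfolding f_def using g(1) by (simp add: complex_eq_iff scaleC_add_right linear_add)
  qed (use fsc bd in auto)
  have "norm (mk_dual f) \<le> 1" by (rule norm_mk_dual_le[OF form]) (use bd in auto)
  moreover have "norm x0 \<le> cmod \<llangle>mk_dual f, x0\<rrangle>"
    using complex_Re_le_cmod[of "f x0"] by (simp add: cpair_mk_dual[OF form] f_def g)
  ultimately show thesis by (rule that)
qed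

lemma norm_natinj: "norm (\<tau> x) = norm x"
proof (rule antisym)
  show "norm (\<tau> x) \<le> norm x"
    using norm_cpair[of _ x] by (intro norm_cdual_bound) (simp_all add: natinj_apply mult.commute)
  obtain f where f: "norm f \<le> 1" "norm x \<le> cmod \<llangle>f, x\<rrangle>" by (rule norming_functional)
  have "norm x \<le> cmod \<llangle>\<tau> x, f\<rrangle>" using f by (simp add: natinj_apply)
  also have "\<dots> \<le> norm (\<tau> x) * norm f" by (rule norm_cpair)
  also have "\<dots> \<le> norm (\<tau> x)" using f(1) mult_left_le[of "norm f" "norm (\<tau> x)"] by simp
  finally show "norm x \<le> norm (\<tau> x)" .
qed

lemma natinj_eq_iff [simp]: "\<tau> x = \<tau> y \<longleftrightarrow> x = y"
  by (metis capply_diff norm_natinj norm_eq_zero right_minus_eq)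

text \<open>Completeness of the space carries over to its isometric image.\<close>

lemma closed_range_natinj: "closed (range (capply (\<tau> :: 'a::complex_banach \<Rightarrow>\<^sub>B 'a cdual cdual)))"
  by (intro complete_imp_closed complete_isometric_image[where e = 1])
    (auto simp: bounded_linear_capply norm_natinj complete_UNIV)


section \<open>Inverses close to the identity\<close>

text \<open>Solving \<open>x - A x = y\<close> means finding the fixed point of the contraction \<open>x \<mapsto> y + A x\<close>.
  Linearity and boundedness of the solution operator follow from the lower bound
  \<open>(1 - q) \<parallel>x\<parallel> \<le> \<parallel>x - A x\<parallel>\<close>.\<close>

lemma inverse_one_minus_contraction:
  fixes A :: "'a::complex_banach \<Rightarrow>\<^sub>B 'a"
  assumes A: "\<And>x. norm (A x) \<le> q * norm x" and q: "0 \<le> q" "q < 1"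
  shows "(cid - A) o\<^sub>B cinv (cid - A) = cid" "cinv (cid - A) o\<^sub>B (cid - A) = cid"
    and "norm (cinv (cid - A) x) \<le> norm x / (1 - q)"
proof -
  have "\<exists>!x. y + A x = x" for y
  proof (rule banach_fix_type[OF q])
    show "\<forall>x x'. dist (y + A x) (y + A x') \<le> q * dist x x'"
      using A by (simp add: dist_norm flip: capply_diff)
  qed
  then obtain B where B: "\<And>y. y + A (B y) = B y" by metis
  have low: "norm x \<le> norm (x - A x) / (1 - q)" for x
  proof -
    have "norm x \<le> norm (x - A x) + norm (A x)" using norm_triangle_ineq[of "x - A x" "A x"] by simp
    then have "(1 - q) * norm x \<le> norm (x - A x)" using A[of x] by (simp add: left_diff_distrib)
    then show ?thesis using q by (simp add: field_simps)
  qed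
  have inj: "x = x'" if "x - A x = x' - A x'" for x x'
    using low[of "x - x'"] that by (simp add: capply_diff algebra_simps)
  have B': "B y - A (B y) = y" for y using B[of y] by (simp add: algebra_simps)
  have bd: "norm (B y) \<le> norm y / (1 - q)" for y using low[of "B y"] by (simp add: B')
  have "bounded_clinear B"
    unfolding bounded_clinear_def
  proof (intro conjI allI exI[of _ "1 / (1 - q)"])
    show "B (x + y) = B x + B y" for x y
    proof (rule inj)
      have "B x + B y - A (B x + B y) = (B x - A (B x)) + (B y - A (B y))"
        by (simp add: capply_add)
      then show "B (x + y) - A (B (x + y)) = B x + B y - A (B x + B y)" by (simp add: B')
    qed
    show "B (c *\<^sub>C x) = c *\<^sub>C B x" for c x
    proof (rule inj)
      have "c *\<^sub>C B x - A (c *\<^sub>C B x) = c *\<^sub>C (B x - A (B x))" by (simp add: capply_scaleC scaleC_diff_right)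
      then show "B (c *\<^sub>C x) - A (B (c *\<^sub>C x)) = c *\<^sub>C B x - A (c *\<^sub>C B x)" by (simp add: B')
    qed
    show "norm (B x) \<le> 1 / (1 - q) * norm x" for x using bd[of x] by simp
  qed
  then have ap: "capply (mk_op B) = B" by (rule capply_mk_op)
  have 1: "(cid - A) o\<^sub>B mk_op B = cid"
    by (rule cblinfun_eqI) (simp add: capply_minus_op ap B')
  have 2: "mk_op B o\<^sub>B (cid - A) = cid"
    by (rule cblinfun_eqI) (auto simp: capply_minus_op ap B' intro: inj)
  have 3: "cinv (cid - A) = mk_op B" by (rule cinv_eqI[OF 1 2])
  show "(cid - A) o\<^sub>B cinv (cid - A) = cid" "cinv (cid - A) o\<^sub>B (cid - A) = cid"
    "norm (cinv (cid - A) x) \<le> norm x / (1 - q)"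
    using 1 2 bd by (simp_all add: 3 ap)
qed

text \<open>The previous lemma for \<open>A = z W\<close>, in pointwise form.  It serves both for \<open>cnj z V\<close> and for
  \<open>z V\<^sup>*\<close>.\<close>

lemma resolvent_contraction:
  fixes W :: "'a::complex_banach \<Rightarrow>\<^sub>B 'a"
  assumes W: "\<And>x. norm (W x) \<le> norm x" and z: "cmod z < 1"
  shows "cinv (cid - z *\<^sub>C W) x - z *\<^sub>C W (cinv (cid - z *\<^sub>C W) x) = x"
    and "cinv (cid - z *\<^sub>C W) (x - z *\<^sub>C W x) = x"
    and "norm (cinv (cid - z *\<^sub>C W) x) \<le> norm x / (1 - cmod z)"
proof -
  have "norm (capply (z *\<^sub>C W) x) \<le> cmod z * norm x" for x
    using W by (simp add: capply_scaleC_op norm_scaleC mult_left_mono)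
  note inv = inverse_one_minus_contraction[OF this norm_ge_zero z]
  show "cinv (cid - z *\<^sub>C W) x - z *\<^sub>C W (cinv (cid - z *\<^sub>C W) x) = x"
    using inv(1)[THEN arg_cong, of "\<lambda>T. capply T x"] by (simp add: capply_minus_op capply_scaleC_op)
  show "cinv (cid - z *\<^sub>C W) (x - z *\<^sub>C W x) = x"
    using inv(2)[THEN arg_cong, of "\<lambda>T. capply T x"] by (simp add: capply_minus_op capply_scaleC_op)
  show "norm (cinv (cid - z *\<^sub>C W) x) \<le> norm x / (1 - cmod z)" by (rule inv(3))
qed

section \<open>Equivalence of the two representations\<close>

lemma isometric_contraction: "isometric V \<Longrightarrow> norm (V x) \<le> norm x"
  by (simp add: isometric_def)

lemma cpair_cadj_natinj: "\<llangle>cadj A c, b\<rrangle> = cnj \<llangle>(\<tau> o\<^sub>B A) b, c\<rrangle>"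
  by (simp add: cadj_apply natinj_apply)

text \<open>The operators \<open>(I - cnj z V)\<inverse> (I + cnj z V)\<close> and \<open>(I + z V\<^sup>*) (I - z V\<^sup>*)\<inverse>\<close> are adjoint to
  each other.  Writing \<open>g = (I - z V\<^sup>*) g'\<close> moves \<open>I - z V\<^sup>*\<close> to the other side, where it cancels
  the inverse.\<close>

lemma cayley_adjoint:
  fixes V :: "'h::complex_hilbert \<Rightarrow>\<^sub>B 'h"
  assumes V: "isometric V" and z: "cmod z < 1"
  shows "cinner (cinv (cid - cnj z *\<^sub>C V) ((cid + cnj z *\<^sub>C V) h)) g
    = cinner h ((cid + z *\<^sub>C hadj V) (cinv (cid - z *\<^sub>C hadj V) g))"
proof -
  define y where "y = cinv (cid - cnj z *\<^sub>C V) ((cid + cnj z *\<^sub>C V) h)"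
  define g' where "g' = cinv (cid - z *\<^sub>C hadj V) g"
  have y: "y - cnj z *\<^sub>C V y = h + cnj z *\<^sub>C V h"
    using resolvent_contraction(1)[of V "cnj z" "(cid + cnj z *\<^sub>C V) h"] V z
    by (simp add: isometric_contraction y_def capply_plus_op capply_scaleC_op)
  have g: "g' - z *\<^sub>C hadj V g' = g"
    using resolvent_contraction(1)[of "hadj V" z g] V z by (simp add: norm_hadj_isometric g'_def)
  have adj: "cinner x (hadj V g') = cinner (V x) g'" for x
    using hadj_apply[of V g' x] by (metis cinner_commute)
  have "cinner y g = cinner (y - cnj z *\<^sub>C V y) g'"
    unfolding g[symmetric] by (simp add: cinner_diff_left cinner_diff_right cinner_scaleC_left cinner_scaleC_right adj)
  also have "\<dots> = cinner h (g' + z *\<^sub>C hadj V g')"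
    unfolding y by (simp add: cinner_add_left cinner_add_right cinner_scaleC_left cinner_scaleC_right adj)
  finally show ?thesis by (simp add: y_def g'_def capply_plus_op capply_scaleC_op)
qed

text \<open>Each of \<open>\<phi>(z)\<^sup>*\<close> and \<open>\<tau> \<phi>(z)\<close> determines the other through
  \<open>\<langle>\<phi>(z)\<^sup>* c, b\<rangle> = cnj \<langle>\<tau> \<phi>(z) b, c\<rangle>\<close>, and the right-hand sides are related in the same
  way.\<close>

lemma represents_iff_represents':
  fixes V :: "'h::complex_hilbert \<Rightarrow>\<^sub>B 'h"
  assumes V: "isometric V" and \<Omega>: "\<Omega> \<subseteq> ball 0 1"
  shows "represents \<Omega> \<phi> V C D \<longleftrightarrow> represents' \<Omega> \<phi> V C D"
proof -
  define L where "L z = D + adj_to_dual C o\<^sub>B cinv (cid - cnj z *\<^sub>C V) o\<^sub>B (cid + cnj z *\<^sub>C V) o\<^sub>B C" for z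
  define R where "R z = adj_restr D + adj_to_dual C o\<^sub>B (cid + z *\<^sub>C hadj V)
      o\<^sub>B cinv (cid - z *\<^sub>C hadj V) o\<^sub>B C" for z
  have LR: "\<llangle>L z c, b\<rrangle> = cnj \<llangle>R z b, c\<rrangle>" if "cmod z < 1" for z b c
    using cayley_adjoint[OF V that, of "C c" "C b"] cinner_commute[of "C c"]
    by (simp add: L_def R_def capply_plus_op cpair_add_left adj_to_dual_apply adj_restr_apply)
  have "cadj (\<phi> z) = L z \<longleftrightarrow> \<tau> o\<^sub>B \<phi> z = R z" if z: "z \<in> \<Omega>" for z
  proof
    have z1: "cmod z < 1" using z \<Omega> by auto
    show "\<tau> o\<^sub>B \<phi> z = R z" if "cadj (\<phi> z) = L z"
    proof (intro cblinfun_eqI cdual_eqI)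
      fix b c
      have "cnj \<llangle>(\<tau> o\<^sub>B \<phi> z) b, c\<rrangle> = cnj \<llangle>R z b, c\<rrangle>"
        using that LR[OF z1] cpair_cadj_natinj by metis
      then show "\<llangle>(\<tau> o\<^sub>B \<phi> z) b, c\<rrangle> = \<llangle>R z b, c\<rrangle>" by simp
    qed
    show "cadj (\<phi> z) = L z" if "\<tau> o\<^sub>B \<phi> z = R z"
      by (intro cblinfun_eqI cdual_eqI) (simp only: cpair_cadj_natinj that LR[OF z1])
  qed
  then show ?thesis by (simp add: represents_def represents'_def L_def R_def)
qed

section \<open>From the representation to the kernel\<close>

lemma one_minus_mult_cnj_nonzero:
  assumes "cmod z < 1" "cmod w < 1"
  shows "1 - z * cnj w \<noteq> 0"
proof -
  have "cmod z * cmod w < 1 * 1" using assms by (intro mult_strict_mono') auto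
  then have "cmod (z * cnj w) < 1" by (simp add: norm_mult)
  then show ?thesis by auto
qed

text \<open>The kernel is the Gram kernel of the vectors \<open>a w x = (I - cnj w V)\<inverse> C x\<close>.\<close>

lemma represents_positive_kernel:
  fixes V :: "'h::complex_hilbert \<Rightarrow>\<^sub>B 'h"
  assumes V: "isometric V" and D: "purely_imaginary D" and rep: "represents \<Omega> \<phi> V C D"
    and \<Omega>: "\<Omega> \<subseteq> ball 0 1"
  shows "positive_kernel \<Omega> (caratheodory_kernel (\<lambda>z. \<tau> o\<^sub>B \<phi> z))"
proof -
  define a where "a w x = cinv (cid - cnj w *\<^sub>C V) (C x)" for w x
  have a: "C x = a w x - cnj w *\<^sub>C V (a w x)"
    and cayley: "cinv (cid - cnj w *\<^sub>C V) ((cid + cnj w *\<^sub>C V) (C x)) = a w x + cnj w *\<^sub>C V (a w x)"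
    if "w \<in> \<Omega>" for w x
  proof -
    have w: "cmod (cnj w) < 1" using that \<Omega> by auto
    note res = resolvent_contraction[OF isometric_contraction[OF V] w]
    show C: "C x = a w x - cnj w *\<^sub>C V (a w x)" using res(1)[of "C x"] by (simp add: a_def)
    \<comment> \<open>\<open>V\<close> commutes with its resolvent: apply \<open>I - cnj w V\<close> to the claimed value.\<close>
    have "(cid + cnj w *\<^sub>C V) (C x)
        = (a w x + cnj w *\<^sub>C V (a w x)) - cnj w *\<^sub>C V (a w x + cnj w *\<^sub>C V (a w x))"
      by (simp add: C capply_plus_op capply_scaleC_op capply_diff capply_add capply_scaleC
          scaleC_add_right scaleC_diff_right)
    then show "cinv (cid - cnj w *\<^sub>C V) ((cid + cnj w *\<^sub>C V) (C x)) = a w x + cnj w *\<^sub>C V (a w x)"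
      by (simp only: res(2))
  qed
  have adj: "\<llangle>cadj (\<phi> w) x, y\<rrangle> = \<llangle>D x, y\<rrangle> + cinner (a w x + cnj w *\<^sub>C V (a w x)) (C y)" if "w \<in> \<Omega>" for w x y
    using rep that cayley[OF that]
    by (simp add: represents_def capply_plus_op cpair_add_left adj_to_dual_apply)
  have Dim: "\<llangle>D x, y\<rrangle> + cnj \<llangle>D y, x\<rrangle> = 0" for x y
    using D[unfolded purely_imaginary_def, THEN arg_cong, of "\<lambda>T. \<llangle>T x, y\<rrangle>"]
    by (simp add: capply_plus_op cpair_add_left adj_restr_apply)
  have k: "\<llangle>caratheodory_kernel (\<lambda>z. \<tau> o\<^sub>B \<phi> z) z w x, y\<rrangle> = cinner (a w x) (a z y)"
    if "z \<in> \<Omega>" "w \<in> \<Omega>" for z w x y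
  proof -
    have ne: "1 - z * cnj w \<noteq> 0" using that \<Omega> by (intro one_minus_mult_cnj_nonzero) auto
    have "\<llangle>(\<tau> o\<^sub>B \<phi> z) x, y\<rrangle> = cnj \<llangle>cadj (\<phi> z) y, x\<rrangle>" by (simp add: cpair_cadj_natinj)
    moreover have "\<llangle>adj_restr (\<tau> o\<^sub>B \<phi> w) x, y\<rrangle> = \<llangle>cadj (\<phi> w) x, y\<rrangle>"
      by (simp add: cpair_cadj_natinj adj_restr_apply)
    ultimately have "\<llangle>(\<tau> o\<^sub>B \<phi> z) x, y\<rrangle> + \<llangle>adj_restr (\<tau> o\<^sub>B \<phi> w) x, y\<rrangle>
        = (\<llangle>D x, y\<rrangle> + cnj \<llangle>D y, x\<rrangle>) + cinner (C x) (a z y + cnj z *\<^sub>C V (a z y))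
          + cinner (a w x + cnj w *\<^sub>C V (a w x)) (C y)"
      using that cinner_commute[of "C x"] by (simp add: adj del: ccomp_apply)
    also have "\<dots> = cinner (a w x - cnj w *\<^sub>C V (a w x)) (a z y + cnj z *\<^sub>C V (a z y))
          + cinner (a w x + cnj w *\<^sub>C V (a w x)) (a z y - cnj z *\<^sub>C V (a z y))"
      by (simp only: Dim a[OF that(1), of y] a[OF that(2), of x] add_0_left)
    also have "\<dots> = 2 * (1 - z * cnj w) * cinner (a w x) (a z y)"
      by (simp add: cinner_add_left cinner_add_right cinner_diff_left cinner_diff_right
          cinner_scaleC_left cinner_scaleC_right isometric_cinner[OF V] algebra_simps)
    finally show ?thesis
      using ne by (simp add: caratheodory_kernel_def capply_scaleC_op capply_plus_op
          cpair_scaleC_left cpair_add_left)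
  qed
  show ?thesis
    unfolding positive_kernel_def
  proof (intro allI impI)
    fix n :: nat and z x assume z: "\<forall>i<n. z i \<in> \<Omega>"
    define s where "s = (\<Sum>j<n. a (z j) (x j))"
    have "(\<Sum>i<n. \<Sum>j<n. \<llangle>caratheodory_kernel (\<lambda>z. \<tau> o\<^sub>B \<phi> z) (z i) (z j) (x j), x i\<rrangle>)
        = (\<Sum>i<n. \<Sum>j<n. cinner (a (z j) (x j)) (a (z i) (x i)))"
      using z by (simp add: k)
    also have "\<dots> = cinner s s"
      by (simp add: s_def bounded_bilinear.sum_left[OF bounded_bilinear_cinner]
          bounded_bilinear.sum_right[OF bounded_bilinear_cinner])
    also have "\<dots> = complex_of_real ((norm s)\<^sup>2)" by (rule cinner_self)
    finally show "(\<Sum>i<n. \<Sum>j<n. \<llangle>caratheodory_kernel (\<lambda>z. \<tau> o\<^sub>B \<phi> z) (z i) (z j) (x j), x i\<rrangle>) \<in> \<real>\<^sub>\<ge>\<^sub>0"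
      by (simp only: nonneg_Reals_of_real_iff zero_le_power2)
  qed
qed

section \<open>Kolmogorov decomposition of positive kernels\<close>

lift_definition ell2_unit :: "'i \<Rightarrow> 'i ell2" is "\<lambda>s i. if i = s then 1 else 0"
proof -
  fix s :: 'i
  have "(\<lambda>i. (cmod (if i = s then 1 else 0))\<^sup>2) summable_on {s}" by simp
  then show "(\<lambda>i. (cmod (if i = s then 1 else 0))\<^sup>2) summable_on UNIV"
    by (rule summable_on_cong_neutral[THEN iffD1, rotated -1]) auto
qed

lemma ell2_nth_unit: "ell2_nth (ell2_unit s) i = (if i = s then 1 else 0)"
  by transfer simp

lemma cinner_ell2_unit: "cinner a (ell2_unit s) = ell2_nth a s"
proof transfer
  fix a :: "'i \<Rightarrow> complex" and s
  show "(\<Sum>\<^sub>\<infinity>i. a i * cnj (if i = s then 1 else 0)) = a s"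
    using infsum_cong_neutral[of "{s}" UNIV "\<lambda>i. a i * cnj (if i = s then 1 else 0)"
        "\<lambda>i. a i * cnj (if i = s then 1 else 0)"] by simp
qed

lemma ell2_nth_add: "ell2_nth (f + g) i = ell2_nth f i + ell2_nth g i"
  by transfer simp

lemma ell2_nth_scaleC: "ell2_nth (c *\<^sub>C f) i = c * ell2_nth f i"
  by transfer simp

lemma ell2_nth_zero [simp]: "ell2_nth 0 i = 0"
  by transfer simp

lemma closed_ell2_supported: "closed {a. \<forall>i. i \<notin> T \<longrightarrow> ell2_nth a i = 0}"
proof -
  have "continuous_on UNIV (\<lambda>a. ell2_nth a i)" for i :: 'i
    unfolding cinner_ell2_unit[symmetric]
    by (intro bounded_bilinear.continuous_on[OF bounded_bilinear_cinner] continuous_intros)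
  then show ?thesis
    by (intro closed_Collect_all closed_Collect_imp closed_Collect_eq open_Collect_const continuous_on_const)
qed

text \<open>The discriminant inequality for a Hermitian quadratic polynomial, restricted to \<open>d\<close> in the direction of
  \<open>- y\<close>.  The choice \<open>t = 1 / B\<close> is optimal for \<open>B \<noteq> 0\<close>; for \<open>B = 0\<close> the polynomial is affine in \<open>t\<close>
  and can only be bounded below when \<open>y = 0\<close>.\<close>

lemma nonneg_quadratic_bound:
  fixes y :: complex
  assumes nn: "\<And>d. 0 \<le> A + 2 * Re (cnj d * y) + (cmod d)\<^sup>2 * B" and B: "0 \<le> B"
  shows "(cmod y)\<^sup>2 \<le> A * B"
proof -
  have t: "0 \<le> A - 2 * t * (cmod y)\<^sup>2 + t\<^sup>2 * (cmod y)\<^sup>2 * B" for t :: real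
  proof -
    have "Re (cnj (- of_real t * y) * y) = - t * (cmod y)\<^sup>2"
      unfolding cmod_power2 by (simp add: power2_eq_square algebra_simps)
    then show ?thesis
      using nn[of "- of_real t * y"] by (simp add: norm_mult power_mult_distrib)
  qed
  show ?thesis
  proof (cases "B = 0")
    case True
    have "cmod y = 0"
    proof (rule ccontr)
      assume "cmod y \<noteq> 0"
      then show False using t[of "(A + 1) / (2 * (cmod y)\<^sup>2)"] True by (simp add: field_simps)
    qed
    then show ?thesis using True by simp
  next
    case False
    then show ?thesis using t[of "1 / B"] B by (simp add: field_simps power2_eq_square)
  qed
qed

text \<open>Transfinite Cholesky factorisation.  The partial solutions are relations between indices and
  vectors with the right Gram matrix, such that the coordinates of the vectors lie in the set of
  indices treated so far; such relations are closed under unions of chains.  To treat a further index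
  \<open>s\<close>, positivity of \<open>\<kappa>\<close> says that \<open>\<Sum> c\<^sub>p v\<^sub>p \<mapsto> \<Sum> c\<^sub>p \<kappa>(s,i\<^sub>p)\<close> is a functional of norm at most
  \<open>K = sqrt \<kappa>(s,s)\<close> on the span of the vectors found so far.  Its representing vector \<open>w\<close> has the
  required inner products with them, and the coordinate \<open>s\<close>, on which all of them vanish, is free to
  raise the norm from \<open>\<parallel>w\<parallel>\<close> to \<open>K\<close>.\<close>

lemma kolmogorov_decomposition:
  fixes \<kappa> :: "'i \<Rightarrow> 'i \<Rightarrow> complex"
  assumes herm: "\<And>i j. \<kappa> i j = cnj (\<kappa> j i)"
    and pos: "\<And>(n::nat) c i. 0 \<le> Re (\<Sum>p<n. \<Sum>q<n. c q * cnj (c p) * \<kappa> (i p) (i q))"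
  obtains v :: "'i \<Rightarrow> 'i ell2" where "\<And>i j. cinner (v j) (v i) = \<kappa> i j"
proof -
  have diag: "\<kappa> s s = of_real (Re (\<kappa> s s))" for s
    using herm[of s s] by (simp add: complex_eq_iff)
  have diag_nn: "0 \<le> Re (\<kappa> s s)" for s
    using pos[where n = 1 and c = "\<lambda>_. 1" and i = "\<lambda>_. s"] by simp
  define A where "A = {G :: ('i \<times> 'i ell2) set. (\<forall>(i, a)\<in>G. \<forall>(j, b)\<in>G. cinner b a = \<kappa> i j)
      \<and> (\<forall>(i, a)\<in>G. \<forall>k. k \<notin> Domain G \<longrightarrow> ell2_nth a k = 0)}"
  have Agram: "cinner b a = \<kappa> i j" if "G \<in> A" "(i, a) \<in> G" "(j, b) \<in> G" for G i a j b
    using that unfolding A_def by blast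
  have Asupp: "ell2_nth a k = 0" if "G \<in> A" "(i, a) \<in> G" "k \<notin> Domain G" for G i a k
    using that unfolding A_def by blast
  have "\<exists>G\<in>A. \<forall>X\<in>A. G \<subseteq> X \<longrightarrow> X = G"
  proof (rule subset_Zorn_nonempty)
    have "{} \<in> A" by (simp add: A_def)
    then show "A \<noteq> {}" by blast
  next
    fix C assume C: "C \<noteq> {}" "subset.chain A C"
    have CA: "G \<in> A" if "G \<in> C" for G using that C(2) by (auto simp: subset.chain_def)
    have dir: "\<exists>G\<in>C. p \<in> G \<and> q \<in> G" if "p \<in> \<Union>C" "q \<in> \<Union>C" for p q
      using C(2) that unfolding subset.chain_def by blast
    have "cinner b a = \<kappa> i j" if "(i, a) \<in> \<Union>C" "(j, b) \<in> \<Union>C" for i a j b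
      using dir[OF that] CA Agram by blast
    moreover have "ell2_nth a k = 0" if "(i, a) \<in> \<Union>C" "k \<notin> Domain (\<Union>C)" for i a k
      using that CA Asupp by blast
    ultimately show "\<Union>C \<in> A" unfolding A_def by blast
  qed
  then obtain G where G: "G \<in> A" and max: "\<And>X. X \<in> A \<Longrightarrow> G \<subseteq> X \<Longrightarrow> X = G" by blast
  note gram = Agram[OF G] and supp = Asupp[OF G]
  have total: "s \<in> Domain G" for s
  proof (rule ccontr)
    assume s: "s \<notin> Domain G"
    define E where "E = {(a, \<kappa> s i) |i a. (i, a) \<in> G}"
    define K where "K = sqrt (Re (\<kappa> s s))"
    \<comment> \<open>Members of the span as indexed sums, the form in which positivity is given.\<close>
    have comb: "\<exists>(n::nat) c i w. (\<forall>p<n. (i p, w p) \<in> G) \<and> x = (\<Sum>p<n. c p *\<^sub>C w p) \<and> y = (\<Sum>p<n. c p * \<kappa> s (i p))"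
      if "(x, y) \<in> relspan E" for x y
      using that
    proof (induction rule: relspan.induct)
      case zero
      show ?case by (rule exI[of _ 0]) simp
    next
      case (step a b x y d)
      then obtain n :: nat and c i w where *: "\<forall>p<n. (i p, w p) \<in> G" "x = (\<Sum>p<n. c p *\<^sub>C w p)"
        "y = (\<Sum>p<n. c p * \<kappa> s (i p))" by blast
      obtain j where j: "(j, a) \<in> G" "b = \<kappa> s j" using step.hyps(1) by (auto simp: E_def)
      have "\<forall>p<Suc n. ((i(n := j)) p, (w(n := a)) p) \<in> G" using *(1) j(1) by (simp add: less_Suc_eq)
      moreover have "d *\<^sub>C a + x = (\<Sum>p<Suc n. (c(n := d)) p *\<^sub>C (w(n := a)) p)"
        by (simp add: *(2) add.commute)
      moreover have "d *\<^sub>C b + y = (\<Sum>p<Suc n. (c(n := d)) p * \<kappa> s ((i(n := j)) p))"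
        by (simp add: *(3) j(2) add.commute)
      ultimately show ?case by blast
    qed
    have bound: "cmod y \<le> K * norm x" if xy: "(x, y) \<in> relspan E" for x y
    proof -
      obtain n :: nat and c i w where *: "\<forall>p<n. (i p, w p) \<in> G" "x = (\<Sum>p<n. c p *\<^sub>C w p)"
        "y = (\<Sum>p<n. c p * \<kappa> s (i p))" using comb[OF xy] by blast
      have "0 \<le> (norm x)\<^sup>2 + 2 * Re (cnj d * y) + (cmod d)\<^sup>2 * Re (\<kappa> s s)" for d
      proof -
        have sq: "cinner x x = (\<Sum>p<n. \<Sum>q<n. c q * cnj (c p) * \<kappa> (i p) (i q))"
        proof -
          have "cinner x x = (\<Sum>p<n. \<Sum>q<n. cinner (c q *\<^sub>C w q) (c p *\<^sub>C w p))"
            by (simp add: *(2) bounded_bilinear.sum_left[OF bounded_bilinear_cinner]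
                bounded_bilinear.sum_right[OF bounded_bilinear_cinner])
          also have "\<dots> = (\<Sum>p<n. \<Sum>q<n. c q * cnj (c p) * \<kappa> (i p) (i q))"
            using *(1) by (intro sum.cong refl)
              (simp add: cinner_scaleC_left cinner_scaleC_right gram mult_ac)
          finally show ?thesis .
        qed
        have col: "(\<Sum>p<n. d * cnj (c p) * \<kappa> (i p) s) = d * cnj y"
          by (simp add: *(3) sum_distrib_left herm[of _ s] mult_ac)
        have row: "(\<Sum>q<n. c q * cnj d * \<kappa> s (i q)) = cnj d * y"
          by (simp add: *(3) sum_distrib_left mult_ac)
        \<comment> \<open>Positivity for the formal combination \<open>\<Sum> c\<^sub>p v\<^sub>p + d v\<^sub>s\<close>, with \<open>s\<close>
            placed at the new position \<open>n\<close>.\<close>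
        have "(\<Sum>p<Suc n. \<Sum>q<Suc n. (c(n := d)) q * cnj ((c(n := d)) p) * \<kappa> ((i(n := s)) p) ((i(n := s)) q))
            = cinner x x + d * cnj y + (cnj d * y + d * cnj d * \<kappa> s s)"
          by (simp add: sum.distrib sq col row)
        also have "Re \<dots> = (norm x)\<^sup>2 + 2 * Re (cnj d * y) + (cmod d)\<^sup>2 * Re (\<kappa> s s)"
        proof -
          have "Re (d * cnj d * \<kappa> s s) = (cmod d)\<^sup>2 * Re (\<kappa> s s)"
            unfolding cmod_power2 by (subst diag) (simp add: power2_eq_square algebra_simps)
          then show ?thesis by (simp add: cinner_self)
        qed
        finally show ?thesis using pos[where n = "Suc n" and c = "c(n := d)" and i = "i(n := s)"] by simp
      qed
      then have "(cmod y)\<^sup>2 \<le> (norm x)\<^sup>2 * Re (\<kappa> s s)" by (rule nonneg_quadratic_bound) (rule diag_nn)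
      then have "(cmod y)\<^sup>2 \<le> (K * norm x)\<^sup>2" using diag_nn[of s] by (simp add: K_def power_mult_distrib mult.commute)
      then show ?thesis by (rule power2_le_imp_le) (simp add: K_def diag_nn)
    qed
    have "0 \<le> K" by (simp add: K_def diag_nn)
    then obtain w where wcl: "w \<in> closure (fst ` relspan E)"
      and w: "\<And>x y. (x, y) \<in> relspan E \<Longrightarrow> y = cinner x w" and wK: "norm w \<le> K"
      using riesz_relation[OF linear_relation_relspan bound] by blast
    have "ell2_nth x k = 0" if "(x, y) \<in> relspan E" "k \<notin> Domain G" for x y k
      using that by (induction rule: relspan.induct)
        (auto simp: ell2_nth_add ell2_nth_scaleC E_def supp)
    then have "fst ` relspan E \<subseteq> {a. \<forall>k. k \<notin> Domain G \<longrightarrow> ell2_nth a k = 0}" by auto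
    then have "closure (fst ` relspan E) \<subseteq> {a. \<forall>k. k \<notin> Domain G \<longrightarrow> ell2_nth a k = 0}"
      by (rule closure_minimal) (rule closed_ell2_supported)
    then have wsupp: "ell2_nth w k = 0" if "k \<notin> Domain G" for k using wcl that by blast
    define u where "u = w + of_real (sqrt (Re (\<kappa> s s) - (norm w)\<^sup>2)) *\<^sub>C ell2_unit s"
    have old: "cinner a u = \<kappa> s i" if "(i, a) \<in> G" for i a
    proof -
      have "\<kappa> s i = cinner a w" by (rule w[OF relspan_base]) (use that in \<open>auto simp: E_def\<close>)
      then show ?thesis
        using supp[OF that s] by (simp add: u_def cinner_add_right cinner_scaleC_right cinner_ell2_unit)
    qed
    have new: "cinner u u = \<kappa> s s"
    proof -
      have "(norm w)\<^sup>2 \<le> Re (\<kappa> s s)"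
        using power_mono[OF wK norm_ge_zero, of 2] diag_nn[of s] by (simp add: K_def)
      moreover have "norm (ell2_unit s) = 1"
        using cinner_self[of "ell2_unit s"] norm_ge_zero[of "ell2_unit s"]
        by (simp add: cinner_ell2_unit ell2_nth_unit power2_eq_1_iff flip: of_real_power)
      ultimately have "(norm u)\<^sup>2 = Re (\<kappa> s s)"
        by (simp add: u_def norm_add_sq cinner_scaleC_right cinner_ell2_unit wsupp[OF s] norm_scaleC)
      then show ?thesis by (simp only: cinner_self diag[symmetric])
    qed
    have rev: "cinner u a = \<kappa> i s" if "(i, a) \<in> G" for i a
      using old[OF that] herm[of i s] cinner_commute[of u a] by simp
    have "insert (s, u) G \<in> A"
    proof -
      have "ell2_nth u k = 0" if "k \<noteq> s" "k \<notin> Domain G" for k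
        using that by (simp add: u_def ell2_nth_add ell2_nth_scaleC ell2_nth_unit wsupp)
      then show ?thesis
        unfolding A_def using gram old rev new supp by auto
    qed
    then have "insert (s, u) G = G" by (rule max) blast
    then show False using s by blast
  qed
  then have "\<exists>v. \<forall>i. (i, v i) \<in> G" by (intro choice) (auto simp: Domain_iff)
  then obtain v where "\<And>i. (i, v i) \<in> G" by blast
  then show thesis by (intro that[of v] gram)
qed

section \<open>Isometric relations\<close>

lemma relspan_cinner_eq:
  fixes G :: "('a::complex_inner \<times> 'b::complex_inner) set"
  assumes G: "\<And>a b a' b'. (a, b) \<in> G \<Longrightarrow> (a', b') \<in> G \<Longrightarrow> cinner a a' = cinner b b'"
    and "(x, y) \<in> relspan G" "(x', y') \<in> relspan G"
  shows "cinner x x' = cinner y y'"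
  using assms(2)
proof (induction rule: relspan.induct)
  case (step a b x y c)
  have "cinner a x' = cinner b y'"
    using assms(3)
    by (induction rule: relspan.induct)
      (simp_all add: cinner_add_right cinner_scaleC_right G[OF step.hyps(1)])
  with step.IH show ?case by (simp add: cinner_add_left cinner_scaleC_left)
qed simp

text \<open>The closure of an isometric linear relation is again isometric and linear, hence
  single-valued, and by completeness its domain is closed.\<close>

lemma dense_isometric_relation:
  fixes R :: "('h::complex_hilbert \<times> 'h) set"
  assumes R: "linear_relation R" and iso: "\<And>p q. (p, q) \<in> R \<Longrightarrow> norm p = norm q"
    and dense: "\<And>h. h \<in> closure (fst ` R)"
  obtains V :: "'h \<Rightarrow>\<^sub>B 'h" where "isometric V" "\<And>p q. (p, q) \<in> R \<Longrightarrow> V p = q"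
proof -
  define S where "S = closure R"
  have S: "(h, g) \<in> S \<longleftrightarrow> (\<exists>p q. (\<forall>n. (p n, q n) \<in> R) \<and> p \<longlonglongrightarrow> h \<and> q \<longlonglongrightarrow> g)" for h g
  proof
    assume "(h, g) \<in> S"
    then obtain r where r: "\<And>n. r n \<in> R" "r \<longlonglongrightarrow> (h, g)" unfolding S_def closure_sequential by blast
    have "(\<lambda>n. fst (r n)) \<longlonglongrightarrow> h" "(\<lambda>n. snd (r n)) \<longlonglongrightarrow> g"
      using tendsto_fst[OF r(2)] tendsto_snd[OF r(2)] by simp_all
    with r(1) show "\<exists>p q. (\<forall>n. (p n, q n) \<in> R) \<and> p \<longlonglongrightarrow> h \<and> q \<longlonglongrightarrow> g"
      by (intro exI[of _ "\<lambda>n. fst (r n)"] exI[of _ "\<lambda>n. snd (r n)"]) auto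
  next
    assume "\<exists>p q. (\<forall>n. (p n, q n) \<in> R) \<and> p \<longlonglongrightarrow> h \<and> q \<longlonglongrightarrow> g"
    then obtain p q where "\<And>n. (p n, q n) \<in> R" "p \<longlonglongrightarrow> h" "q \<longlonglongrightarrow> g" by blast
    then show "(h, g) \<in> S"
      unfolding S_def closure_sequential by (intro exI[of _ "\<lambda>n. (p n, q n)"]) (auto intro: tendsto_Pair)
  qed
  have S_iso: "norm h = norm g" if "(h, g) \<in> S" for h g
  proof -
    obtain p q where pq: "\<And>n. (p n, q n) \<in> R" "p \<longlonglongrightarrow> h" "q \<longlonglongrightarrow> g" using \<open>(h, g) \<in> S\<close> S by blast
    have "(\<lambda>n. norm (q n)) \<longlonglongrightarrow> norm h" using tendsto_norm[OF pq(2)] iso[OF pq(1)] by simp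
    then show ?thesis using tendsto_norm[OF pq(3)] LIMSEQ_unique by blast
  qed
  have S_lin: "linear_relation S"
    unfolding linear_relation_def
  proof (intro conjI allI impI)
    show "(0, 0) \<in> S" using R closure_subset by (auto simp: S_def linear_relation_def)
  next
    fix x y x' y' assume "(x, y) \<in> S" "(x', y') \<in> S"
    then obtain p q p' q' where "\<And>n. (p n, q n) \<in> R" "p \<longlonglongrightarrow> x" "q \<longlonglongrightarrow> y"
      "\<And>n. (p' n, q' n) \<in> R" "p' \<longlonglongrightarrow> x'" "q' \<longlonglongrightarrow> y'" unfolding S by blast
    with R show "(x + x', y + y') \<in> S"
      unfolding S linear_relation_def
      by (intro exI[of _ "\<lambda>n. p n + p' n"] exI[of _ "\<lambda>n. q n + q' n"]) (auto intro: tendsto_add)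
  next
    fix c x y assume "(x, y) \<in> S"
    then obtain p q where "\<And>n. (p n, q n) \<in> R" "p \<longlonglongrightarrow> x" "q \<longlonglongrightarrow> y" unfolding S by blast
    with R show "(c *\<^sub>C x, c *\<^sub>C y) \<in> S"
      unfolding S linear_relation_def
      by (intro exI[of _ "\<lambda>n. c *\<^sub>C p n"] exI[of _ "\<lambda>n. c *\<^sub>C q n"])
        (auto intro: tendsto_scaleC tendsto_const)
  qed
  have unique: "g = g'" if "(h, g) \<in> S" "(h, g') \<in> S" for h g g'
    using S_iso[OF linear_relation_diff[OF S_lin that]] by simp
  have "\<exists>g. (h, g) \<in> S" for h
  proof -
    obtain p where "\<And>n. p n \<in> fst ` R" and p: "p \<longlonglongrightarrow> h" using dense[of h] unfolding closure_sequential by blast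
    then have "\<forall>n. \<exists>q. (p n, q) \<in> R" by force
    then obtain q where pq: "\<And>n. (p n, q n) \<in> R" by metis
    have "norm (q m - q n) = norm (p m - p n)" for m n
      using iso[OF linear_relation_diff[OF R pq pq]] by metis
    then have "Cauchy q" using LIMSEQ_imp_Cauchy[OF p] by (simp add: Cauchy_def dist_norm)
    then obtain g where "q \<longlonglongrightarrow> g" using Cauchy_convergent_iff convergent_def by blast
    then show ?thesis using S pq p by blast
  qed
  then obtain V where V: "\<And>h. (h, V h) \<in> S" by metis
  have "bounded_clinear V"
    unfolding bounded_clinear_def
  proof (intro conjI allI exI[of _ 1])
    show "V (x + y) = V x + V y" for x y
      by (rule unique[OF V]) (use S_lin V in \<open>auto simp: linear_relation_def\<close>)
    show "V (c *\<^sub>C x) = c *\<^sub>C V x" for c x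
      by (rule unique[OF V]) (use S_lin V in \<open>auto simp: linear_relation_def\<close>)
    show "norm (V x) \<le> 1 * norm x" for x using S_iso[OF V[of x]] by simp
  qed
  then have ap: "capply (mk_op V) = V" by (rule capply_mk_op)
  show thesis
  proof (rule that[of "mk_op V"])
    show "isometric (mk_op V)" using S_iso[OF V] by (simp add: isometric_def ap)
    show "capply (mk_op V) p = q" if "(p, q) \<in> R" for p q
      unfolding ap by (rule unique[OF V]) (use that closure_subset S_def in blast)
  qed
qed

text \<open>Assumption \<open>range\<close> says that the range lies in the closed span of the domain.  On the orthogonal
  complement of the domain the identity can therefore be adjoined without spoiling the isometry, and
  the sum of the domain and its orthogonal complement is dense.\<close>

lemma isometric_extension:
  fixes R :: "('h::complex_hilbert \<times> 'h) set"
  assumes R: "linear_relation R" and iso: "\<And>p q. (p, q) \<in> R \<Longrightarrow> norm p = norm q"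
    and range: "\<And>e p q. (\<And>p q. (p, q) \<in> R \<Longrightarrow> cinner p e = 0) \<Longrightarrow> (p, q) \<in> R \<Longrightarrow> cinner q e = 0"
  obtains V :: "'h \<Rightarrow>\<^sub>B 'h" where "isometric V" "\<And>p q. (p, q) \<in> R \<Longrightarrow> V p = q"
proof -
  define N where "N = {e. \<forall>p q. (p, q) \<in> R \<longrightarrow> cinner p e = 0}"
  define R' where "R' = {(p + e, q + e) |p q e. (p, q) \<in> R \<and> e \<in> N}"
  have N: "0 \<in> N" "\<And>d e. d \<in> N \<Longrightarrow> e \<in> N \<Longrightarrow> d + e \<in> N" "\<And>c e. e \<in> N \<Longrightarrow> c *\<^sub>C e \<in> N"
    by (auto simp: N_def cinner_add_right cinner_scaleC_right)
  have R0: "(0, 0) \<in> R" and Radd: "\<And>x y x' y'. (x, y) \<in> R \<Longrightarrow> (x', y') \<in> R \<Longrightarrow> (x + x', y + y') \<in> R"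
    and Rsc: "\<And>c x y. (x, y) \<in> R \<Longrightarrow> (c *\<^sub>C x, c *\<^sub>C y) \<in> R"
    using R by (auto simp: linear_relation_def)
  have R'I: "(p + e, q + e) \<in> R'" if "(p, q) \<in> R" "e \<in> N" for p q e
    using that by (auto simp: R'_def)
  have R'lin: "linear_relation R'"
    unfolding linear_relation_def
  proof (intro conjI allI impI)
    show "(0, 0) \<in> R'" using R'I[OF R0 N(1)] by simp
  next
    fix x y x' y' assume "(x, y) \<in> R'" "(x', y') \<in> R'"
    then obtain p q e p' q' e' where *: "(p, q) \<in> R" "e \<in> N" "(p', q') \<in> R" "e' \<in> N"
      "x = p + e" "y = q + e" "x' = p' + e'" "y' = q' + e'" by (auto simp: R'_def)
    have "((p + p') + (e + e'), (q + q') + (e + e')) \<in> R'" by (intro R'I Radd N *)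
    then show "(x + x', y + y') \<in> R'" by (simp add: * ac_simps)
  next
    fix c x y assume "(x, y) \<in> R'"
    then obtain p q e where *: "(p, q) \<in> R" "e \<in> N" "x = p + e" "y = q + e" by (auto simp: R'_def)
    have "(c *\<^sub>C p + c *\<^sub>C e, c *\<^sub>C q + c *\<^sub>C e) \<in> R'" by (intro R'I Rsc N *)
    then show "(c *\<^sub>C x, c *\<^sub>C y) \<in> R'" by (simp add: * scaleC_add_right)
  qed
  have R'iso: "norm x = norm y" if "(x, y) \<in> R'" for x y
  proof -
    obtain p q e where *: "(p, q) \<in> R" "e \<in> N" "x = p + e" "y = q + e"
      using \<open>(x, y) \<in> R'\<close> by (auto simp: R'_def)
    have "cinner p e = 0" using *(1,2) by (auto simp: N_def)
    moreover have "cinner q e = 0" using *(1,2) range[of e p q] by (auto simp: N_def)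
    ultimately have "(norm x)\<^sup>2 = (norm y)\<^sup>2" using iso[OF *(1)] by (simp add: * norm_add_sq)
    then show ?thesis by simp
  qed
  have R'dense: "h \<in> closure (fst ` R')" for h
  proof -
    \<comment> \<open>The representing vector \<open>w\<close> of \<open>p \<mapsto> \<langle>p, h\<rangle>\<close> is the
        projection of \<open>h\<close> onto the closure of the domain.\<close>
    define M where "M = {(p, cinner p h) |p q. (p, q) \<in> R}"
    have Mlin: "linear_relation M"
      unfolding linear_relation_def
    proof (intro conjI allI impI)
      show "(0, 0) \<in> M" using R0 by (force simp: M_def)
    next
      fix x y x' y' assume "(x, y) \<in> M" "(x', y') \<in> M"
      then obtain z z' where "(x, z) \<in> R" "(x', z') \<in> R" "y = cinner x h" "y' = cinner x' h"
        by (auto simp: M_def)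
      then show "(x + x', y + y') \<in> M"
        unfolding M_def using Radd by (fastforce simp: cinner_add_left)
    next
      fix c x y assume "(x, y) \<in> M"
      then obtain z where "(x, z) \<in> R" "y = cinner x h" by (auto simp: M_def)
      then show "(c *\<^sub>C x, c *\<^sub>C y) \<in> M"
        unfolding M_def using Rsc by (fastforce simp: cinner_scaleC_left)
    qed
    have MK: "cmod y \<le> norm h * norm x" if "(x, y) \<in> M" for x y
      using that cauchy_schwarz[of x h] by (auto simp: M_def mult.commute)
    obtain w where w: "w \<in> closure (fst ` M)" "\<And>x y. (x, y) \<in> M \<Longrightarrow> y = cinner x w"
      by (rule riesz_relation[OF Mlin MK norm_ge_zero]) blast+
    have "cinner p h = cinner p w" if "(p, q) \<in> R" for p q
      by (rule w(2)) (use that in \<open>auto simp: M_def\<close>)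
    then have "h - w \<in> N" by (auto simp: N_def cinner_diff_right)
    obtain p where p: "\<And>n. p n \<in> fst ` M" "p \<longlonglongrightarrow> w" using w(1) unfolding closure_sequential by blast
    have "p n + (h - w) \<in> fst ` R'" for n
    proof -
      obtain q where "(p n, q) \<in> R" using p(1)[of n] by (auto simp: M_def)
      then have "(p n + (h - w), q + (h - w)) \<in> R'" by (rule R'I) fact
      then show ?thesis by force
    qed
    moreover have "(\<lambda>n. p n + (h - w)) \<longlonglongrightarrow> w + (h - w)" by (intro tendsto_intros p)
    ultimately show ?thesis
      unfolding closure_sequential by (intro exI[of _ "\<lambda>n. p n + (h - w)"]) auto
  qed
  obtain V :: "'h \<Rightarrow>\<^sub>B 'h" where "isometric V" and V: "\<And>p q. (p, q) \<in> R' \<Longrightarrow> V p = q"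
    by (rule dense_isometric_relation[OF R'lin R'iso R'dense]) blast+
  show thesis
  proof (rule that)
    show "isometric V" by fact
    show "V p = q" if "(p, q) \<in> R" for p q using V[OF R'I[OF that N(1)]] by simp
  qed
qed


section \<open>From the kernel to the representation\<close>

text \<open>The isometry \<open>V\<close> extends \<open>cnj w v\<^sub>w x \<mapsto> v\<^sub>w x - v\<^sub>0 x\<close>, where the \<open>v\<^sub>w x\<close> form a Kolmogorov
  decomposition of the kernel.  Then \<open>(I - cnj z V) v\<^sub>z x = v\<^sub>0 x = C x\<close>, so the Cayley transform
  maps \<open>C x\<close> to \<open>2 v\<^sub>z x - v\<^sub>0 x\<close>, and the inner product of this vector with \<open>C y = v\<^sub>0 y\<close> is read off from
  the kernel.\<close>

lemma caratheodory_imp_represents: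
  fixes \<phi> :: "complex \<Rightarrow> 'b::complex_normed_vector cdual \<Rightarrow>\<^sub>B 'b"
  assumes op: "open \<Omega>" and 0: "0 \<in> \<Omega>" and \<Omega>: "\<Omega> \<subseteq> ball 0 1" and car: "caratheodory' \<Omega> \<phi>"
  obtains V :: "(complex \<Rightarrow> 'b cdual cdual) ell2 \<Rightarrow>\<^sub>B (complex \<Rightarrow> 'b cdual cdual) ell2" and C D
  where "isometric V" "purely_imaginary D" "represents \<Omega> \<phi> V C D"
proof -
  define \<psi> where "\<psi> z = \<tau> o\<^sub>B \<phi> z" for z
  define k where "k z w x y = \<llangle>caratheodory_kernel \<psi> z w x, y\<rrangle>" for z w x y
  have wc: "((\<lambda>z. \<llangle>\<psi> z x, x\<rrangle>) \<longlongrightarrow> \<llangle>\<psi> 0 x, x\<rrangle>) (at 0)" for x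
    using car 0 op unfolding caratheodory'_def caratheodory_def weakly_continuous_at_0_def \<psi>_def
    by (metis (no_types, lifting) at_within_open)
  have posk: "positive_kernel \<Omega> (caratheodory_kernel \<psi>)"
    using car by (simp add: caratheodory'_def caratheodory_def \<psi>_def[abs_def])
  have k_eq: "k z w x y = (\<llangle>\<psi> z x, y\<rrangle> + cnj \<llangle>\<psi> w y, x\<rrangle>) / (2 * (1 - z * cnj w))" for z w x y
    by (simp add: k_def caratheodory_kernel_def capply_scaleC_op capply_plus_op cpair_scaleC_left
        cpair_add_left adj_restr_apply)
  have k_herm: "k z w x y = cnj (k w z y x)" for z w x y
    by (simp add: k_eq add.commute mult.commute)
  have k_add: "k z w (x + x') y = k z w x y + k z w x' y" for z w x x' y
    by (simp add: k_def capply_add cpair_add_left)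
  have k_scale: "k z w (c *\<^sub>C x) (d *\<^sub>C y) = c * cnj d * k z w x y" for z w c x d y
    by (simp add: k_def capply_scaleC cpair_scaleC_left cpair_scaleC_right)
  \<comment> \<open>Index the kernel by its own columns; \<open>\<sigma>\<close> chooses a point \<open>(w, x)\<close> behind each column, and
      takes an arbitrary value in \<open>S\<close> at functions that are not columns.\<close>
  define col where "col = (\<lambda>(w, x) z. if z \<in> \<Omega> then caratheodory_kernel \<psi> z w x else 0)"
  define S where "S = \<Omega> \<times> (UNIV :: 'b cdual set)"
  have "\<forall>f. \<exists>s. s \<in> S \<and> (f \<in> col ` S \<longrightarrow> col s = f)" using 0 by (auto simp: S_def)
  then obtain \<sigma> where \<sigma>S: "\<And>f. \<sigma> f \<in> S" and \<sigma>col: "\<And>f. f \<in> col ` S \<Longrightarrow> col (\<sigma> f) = f" by metis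
  define \<kappa> where "\<kappa> f g = k (fst (\<sigma> f)) (fst (\<sigma> g)) (snd (\<sigma> g)) (snd (\<sigma> f))" for f g
  have \<kappa>_herm: "\<kappa> f g = cnj (\<kappa> g f)" for f g unfolding \<kappa>_def by (rule k_herm)
  have \<kappa>_pos: "0 \<le> Re (\<Sum>p<n. \<Sum>q<n. c q * cnj (c p) * \<kappa> (i p) (i q))" for n :: nat and c i
  proof -
    have "fst (\<sigma> (i p)) \<in> \<Omega>" for p using \<sigma>S[of "i p"] by (auto simp: S_def)
    then have "(\<Sum>p<n. \<Sum>q<n. k (fst (\<sigma> (i p))) (fst (\<sigma> (i q))) (c q *\<^sub>C snd (\<sigma> (i q))) (c p *\<^sub>C snd (\<sigma> (i p))))
        \<in> \<real>\<^sub>\<ge>\<^sub>0"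
      using posk[unfolded positive_kernel_def, rule_format, of n "\<lambda>p. fst (\<sigma> (i p))" "\<lambda>p. c p *\<^sub>C snd (\<sigma> (i p))"]
      by (simp add: k_def)
    then show ?thesis by (simp add: k_scale \<kappa>_def complex_nonneg_Reals_iff)
  qed
  obtain v0 :: "(complex \<Rightarrow> 'b cdual cdual) \<Rightarrow> (complex \<Rightarrow> 'b cdual cdual) ell2"
    where v0: "\<And>f g. cinner (v0 g) (v0 f) = \<kappa> f g"
    using kolmogorov_decomposition[of \<kappa>, OF \<kappa>_herm \<kappa>_pos] by blast
  define v where "v w x = v0 (col (w, x))" for w x
  \<comment> \<open>The point chosen by \<open>\<sigma>\<close> may differ from the given one, but the kernel depends on its
      second argument only through the column and, being Hermitian, likewise on its first.\<close>
  have gram: "cinner (v w x) (v z y) = k z w x y" if z: "z \<in> \<Omega>" and w: "w \<in> \<Omega>" for z w x y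
  proof -
    obtain z' y' where s: "\<sigma> (col (z, y)) = (z', y')" by force
    obtain w' x' where t: "\<sigma> (col (w, x)) = (w', x')" by force
    have z': "z' \<in> \<Omega>" using \<sigma>S[of "col (z, y)"] s by (simp add: S_def)
    have colt: "col (w', x') = col (w, x)" using \<sigma>col[of "col (w, x)"] w t by (auto simp: S_def)
    have cols: "col (z', y') = col (z, y)" using \<sigma>col[of "col (z, y)"] z s by (auto simp: S_def)
    have "k z' w' x' y' = k z' w x y'"
      using colt[THEN fun_cong, of z'] z' by (simp add: col_def k_def)
    also have "\<dots> = cnj (k w z' y' x)" by (rule k_herm)
    also have "k w z' y' x = k w z y x"
      using cols[THEN fun_cong, of w] w by (simp add: col_def k_def)
    finally have "k z' w' x' y' = k z w x y" by (simp only: k_herm[of z w x y])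
    then show ?thesis by (simp add: v_def v0 \<kappa>_def s t)
  qed
  have v_add: "v w (x + x') = v w x + v w x'" if w: "w \<in> \<Omega>" for w x x'
  proof -
    define d where "d = v w (x + x') - v w x - v w x'"
    have u: "cinner d (v w y) = 0" for y
      by (simp add: d_def cinner_diff_left gram[OF w w] k_add)
    \<comment> \<open>\<open>d\<close> is orthogonal to the vectors of which it is a combination.\<close>
    have "cinner d d = 0"
      by (subst (2) d_def) (simp add: cinner_diff_right u)
    then have "d = 0" by (simp add: cinner_self)
    then show ?thesis by (simp add: d_def algebra_simps)
  qed
  have v_scale: "v w (c *\<^sub>C x) = c *\<^sub>C v w x" if w: "w \<in> \<Omega>" for w c x
  proof -
    define d where "d = v w (c *\<^sub>C x) - c *\<^sub>C v w x"
    have u: "cinner d (v w y) = 0" for y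
      using k_scale[of w w c x 1 y] by (simp add: d_def cinner_diff_left cinner_scaleC_left gram[OF w w])
    have "cinner d d = 0"
      by (subst (2) d_def) (simp add: cinner_diff_right cinner_scaleC_right u)
    then have "d = 0" by (simp add: cinner_self)
    then show ?thesis by (simp add: d_def)
  qed
  define C where "C = mk_op (v 0)"
  have "bounded_clinear (v 0)"
    unfolding bounded_clinear_def
  proof (intro conjI allI exI)
    define K where "K = norm (caratheodory_kernel \<psi> 0 0)"
    show "norm (v 0 x) \<le> sqrt K * norm x" for x
    proof -
      have "complex_of_real ((norm (v 0 x))\<^sup>2) = k 0 0 x x"
        unfolding cinner_self[symmetric] by (rule gram[OF 0 0])
      then have "(norm (v 0 x))\<^sup>2 = cmod (k 0 0 x x)" by (metis norm_of_real abs_of_nonneg zero_le_power2)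
      also have "\<dots> \<le> norm (caratheodory_kernel \<psi> 0 0 x) * norm x" unfolding k_def by (rule norm_cpair)
      also have "\<dots> \<le> (K * norm x) * norm x"
        unfolding K_def by (intro mult_right_mono norm_capply) simp
      also have "\<dots> = (sqrt K * norm x)\<^sup>2"
        by (simp add: K_def power_mult_distrib power2_eq_square)
      finally show ?thesis by (rule power2_le_imp_le) (simp add: K_def)
    qed
  qed (use v_add[OF 0] v_scale[OF 0] in auto)
  then have C: "capply C = v 0" unfolding C_def by (rule capply_mk_op)
  \<comment> \<open>The generators of the relation that \<open>V\<close> has to extend; \<open>w = 0\<close> contributes only
      \<open>(0, 0)\<close>.\<close>
  define G where "G = {(cnj w *\<^sub>C v w x, v w x - v 0 x) |w x. w \<in> \<Omega>}"
  have nz: "1 - z * cnj w \<noteq> 0" if "z \<in> \<Omega>" "w \<in> \<Omega>" for z w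
    using that \<Omega> by (intro one_minus_mult_cnj_nonzero) auto
  have half: "s / 2 = d * (s / (2 * d))" if "d \<noteq> 0" for s d :: complex
    using that by simp
  have G_iso: "cinner a a' = cinner b b'" if ab: "(a, b) \<in> G" and ab': "(a', b') \<in> G" for a b a' b'
  proof -
    obtain w x where *: "w \<in> \<Omega>" "a = cnj w *\<^sub>C v w x" "b = v w x - v 0 x"
      using ab unfolding G_def by blast
    obtain z y where **: "z \<in> \<Omega>" "a' = cnj z *\<^sub>C v z y" "b' = v z y - v 0 y"
      using ab' unfolding G_def by blast
    have "cinner b b' = k z w x y - k 0 w x y - (k z 0 x y - k 0 0 x y)"
      using * ** 0 by (simp add: cinner_diff_left cinner_diff_right gram)
    also have "\<dots> = k z w x y - (\<llangle>\<psi> z x, y\<rrangle> + cnj \<llangle>\<psi> w y, x\<rrangle>) / 2"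
      by (simp add: k_eq[of 0] k_eq[of _ 0] field_simps)
    also have "(\<llangle>\<psi> z x, y\<rrangle> + cnj \<llangle>\<psi> w y, x\<rrangle>) / 2 = (1 - z * cnj w) * k z w x y"
      unfolding k_eq by (rule half) (rule nz[OF **(1) *(1)])
    also have "k z w x y - (1 - z * cnj w) * k z w x y = cinner a a'"
      using * ** by (simp add: cinner_scaleC_left cinner_scaleC_right gram algebra_simps)
    finally show ?thesis by simp
  qed
  \<comment> \<open>Weak continuity enters here: by the Gram formula \<open>h w\<close> is the squared distance of
      \<open>v w x\<close> and \<open>v 0 x\<close>.\<close>
  have v_lim: "((\<lambda>w. v w x) \<longlongrightarrow> v 0 x) (at 0)" for x
  proof -
    define f where "f w = \<llangle>\<psi> w x, x\<rrangle>" for w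
    define h where "h w = (f w + cnj (f w)) / (2 * (1 - w * cnj w)) - (f 0 + cnj (f w)) / 2
      - ((f w + cnj (f 0)) / 2 - (f 0 + cnj (f 0)) / 2)" for w
    have "(h \<longlongrightarrow> (f 0 + cnj (f 0)) / (2 * (1 - 0 * cnj 0)) - (f 0 + cnj (f 0)) / 2
      - ((f 0 + cnj (f 0)) / 2 - (f 0 + cnj (f 0)) / 2)) (at 0)"
      unfolding h_def by (intro tendsto_intros wc[of x, folded f_def]) simp_all
    then have h: "(h \<longlongrightarrow> 0) (at 0)" by simp
    have "norm (v w x - v 0 x) = sqrt (cmod (h w))" if w: "w \<in> \<Omega>" for w
    proof -
      have "complex_of_real ((norm (v w x - v 0 x))\<^sup>2) = h w"
        unfolding cinner_self[symmetric] using w 0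
        by (simp add: cinner_diff_left cinner_diff_right gram k_eq h_def f_def)
      then have "cmod (h w) = (norm (v w x - v 0 x))\<^sup>2" by (metis norm_of_real abs_of_nonneg zero_le_power2)
      then show ?thesis by simp
    qed
    then have ev: "\<forall>\<^sub>F w in at 0. sqrt (cmod (h w)) = norm (v w x - v 0 x)"
      using eventually_at_in_open'[OF op 0] by (auto elim: eventually_mono)
    have "((\<lambda>w. sqrt (cmod (h w))) \<longlongrightarrow> sqrt (cmod 0)) (at 0)" by (intro tendsto_intros h)
    then have "((\<lambda>w. norm (v w x - v 0 x)) \<longlongrightarrow> 0) (at 0)"
      using tendsto_cong[OF ev] by simp
    then show ?thesis using tendsto_norm_zero_iff Lim_null by blast
  qed
  \<comment> \<open>A vector orthogonal to \<open>v w x\<close> for all \<open>w \<noteq> 0\<close> is orthogonal to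
      \<open>v 0 x\<close> by continuity.\<close>
  have G_range: "cinner q e = 0"
    if e: "\<And>p q. (p, q) \<in> relspan G \<Longrightarrow> cinner p e = 0" and pq: "(p, q) \<in> relspan G" for e p q
  proof -
    have e': "cinner (v w x) e = 0" if "w \<in> \<Omega>" "w \<noteq> 0" for w x
    proof -
      have "cinner (cnj w *\<^sub>C v w x) e = 0"
        by (rule e[OF relspan_base]) (use that in \<open>auto simp: G_def\<close>)
      then show ?thesis using that by (simp add: cinner_scaleC_left)
    qed
    have e0: "cinner (v 0 x) e = 0" for x
    proof (rule tendsto_unique[where F = "at (0::complex)"])
      show "((\<lambda>w. cinner (v w x) e) \<longlongrightarrow> cinner (v 0 x) e) (at 0)"
        by (intro tendsto_cinner v_lim tendsto_const)
      have "\<forall>\<^sub>F w in at 0. cinner (v w x) e = 0"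
        using eventually_at_in_open[OF op 0] by (auto elim!: eventually_mono simp: e')
      then show "((\<lambda>w. cinner (v w x) e) \<longlongrightarrow> 0) (at 0)" by (rule tendsto_eventually)
    qed simp
    have "cinner b e = 0" if ab: "(a, b) \<in> G" for a b
    proof -
      obtain w x where "w \<in> \<Omega>" "b = v w x - v 0 x" using ab unfolding G_def by blast
      then show ?thesis using e'[of w x] e0[of x] by (cases "w = 0") (auto simp: cinner_diff_left)
    qed
    with pq show ?thesis
      by (induction rule: relspan.induct) (simp_all add: cinner_add_left cinner_scaleC_left)
  qed
  obtain V where V: "isometric V" and Vext: "\<And>p q. (p, q) \<in> relspan G \<Longrightarrow> capply V p = q"
  proof (rule isometric_extension[OF linear_relation_relspan[of G]])
    show "norm p = norm q" if "(p, q) \<in> relspan G" for p q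
      by (rule norm_eqI_cinner) (rule relspan_cinner_eq[OF G_iso that that])
  qed (use G_range in blast)+
  have Vv: "cnj w *\<^sub>C V (v w x) = v w x - v 0 x" if "w \<in> \<Omega>" for w x
    using Vext[OF relspan_base, of "cnj w *\<^sub>C v w x" "v w x - v 0 x"] that
    by (auto simp: G_def capply_scaleC)
  \<comment> \<open>Forced by the representation at \<open>z = 0\<close>.\<close>
  define D where "D = cadj (\<phi> 0) - adj_to_dual C o\<^sub>B C"
  have \<phi>\<psi>: "\<llangle>cadj (\<phi> z) x, y\<rrangle> = cnj \<llangle>\<psi> z y, x\<rrangle>" for z x y
    unfolding \<psi>_def by (rule cpair_cadj_natinj)
  have D_apply: "\<llangle>D x, y\<rrangle> = cnj \<llangle>\<psi> 0 y, x\<rrangle> - k 0 0 x y" for x y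
    by (simp add: D_def capply_minus_op cpair_diff_left adj_to_dual_apply \<phi>\<psi> C gram[OF 0 0])
  have "purely_imaginary D"
    unfolding purely_imaginary_def
    by (intro cblinfun_eqI cdual_eqI)
      (simp add: capply_plus_op cpair_add_left adj_restr_apply D_apply k_eq field_simps)
  moreover have "represents \<Omega> \<phi> V C D"
    unfolding represents_def
  proof (intro ballI cblinfun_eqI cdual_eqI)
    fix z x y assume z: "z \<in> \<Omega>"
    \<comment> \<open>The value at \<open>v 0 x\<close> of the Cayley transform.\<close>
    define u where "u = v z x + v z x - v 0 x"
    have "cnj z *\<^sub>C V u = (v z x - v 0 x) + (v z x - v 0 x) - cnj z *\<^sub>C V (v 0 x)"
      by (simp add: u_def capply_add capply_diff scaleC_add_right scaleC_diff_right Vv[OF z])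
    then have "(cid + cnj z *\<^sub>C V) (v 0 x) = u - cnj z *\<^sub>C V u"
      by (simp add: u_def capply_plus_op capply_scaleC_op)
    moreover have "cmod (cnj z) < 1" using z \<Omega> by auto
    ultimately have cay: "cinv (cid - cnj z *\<^sub>C V) ((cid + cnj z *\<^sub>C V) (v 0 x)) = u"
      using resolvent_contraction(2)[of V "cnj z" u] V by (simp add: isometric_contraction)
    have "\<llangle>(D + adj_to_dual C o\<^sub>B cinv (cid - cnj z *\<^sub>C V) o\<^sub>B (cid + cnj z *\<^sub>C V) o\<^sub>B C) x, y\<rrangle>
        = \<llangle>D x, y\<rrangle> + cinner u (v 0 y)"
      by (simp add: capply_plus_op[of D] cpair_add_left adj_to_dual_apply C cay)
    also have "\<dots> = cnj \<llangle>\<psi> 0 y, x\<rrangle> - k 0 0 x y + (k 0 z x y + k 0 z x y - k 0 0 x y)"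
      using z 0 by (simp add: D_apply u_def cinner_diff_left cinner_add_left gram)
    also have "\<dots> = cnj \<llangle>\<psi> z y, x\<rrangle>" by (simp add: k_eq field_simps)
    finally show "\<llangle>cadj (\<phi> z) x, y\<rrangle>
        = \<llangle>(D + adj_to_dual C o\<^sub>B cinv (cid - cnj z *\<^sub>C V) o\<^sub>B (cid + cnj z *\<^sub>C V) o\<^sub>B C) x, y\<rrangle>"
      by (simp add: \<phi>\<psi>)
  qed
  ultimately show thesis using V that by blast
qed

section \<open>Analytic extension\<close>

lemma resolvent_continuous_at_0:
  fixes W :: "'a::complex_banach \<Rightarrow>\<^sub>B 'a"
  assumes W: "\<And>x. norm (W x) \<le> norm x"
  shows "((\<lambda>z. cinv (cid - z *\<^sub>C W) h) \<longlongrightarrow> h) (at 0)"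
proof -
  define R where "R z = cinv (cid - z *\<^sub>C W) h" for z
  have "norm (R z - h) \<le> cmod z * (norm h / (1 - cmod z))" if z: "cmod z < 1" for z
  proof -
    have "R z - h = z *\<^sub>C W (R z)"
      using resolvent_contraction(1)[OF W z, of h] by (simp add: R_def algebra_simps)
    then have "norm (R z - h) = cmod z * norm (W (R z))" by (simp only: norm_scaleC)
    also have "\<dots> \<le> cmod z * norm (R z)" by (intro mult_left_mono W) simp
    also have "\<dots> \<le> cmod z * (norm h / (1 - cmod z))"
      unfolding R_def by (intro mult_left_mono resolvent_contraction(3)[OF W z]) simp
    finally show ?thesis .
  qed
  moreover have "\<forall>\<^sub>F z in at 0. cmod z < 1"
    using eventually_at_in_open'[of "ball 0 1" "0::complex"] by (simp add: mem_ball)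
  ultimately have "\<forall>\<^sub>F z in at 0. norm (R z - h) \<le> cmod z * (norm h / (1 - cmod z))"
    by (auto elim: eventually_mono)
  moreover have "((\<lambda>z. cmod z * (norm h / (1 - cmod z))) \<longlongrightarrow> cmod 0 * (norm h / (1 - cmod 0))) (at 0)"
    by (intro tendsto_intros) simp
  ultimately have "((\<lambda>z. R z - h) \<longlongrightarrow> 0) (at 0)"
    by (intro Lim_null_comparison[of "\<lambda>z. R z - h"]) simp_all
  then show ?thesis unfolding R_def using Lim_null by blast
qed

text \<open>The principle that a power series whose sum lies in a closed subspace near the origin has all its
  coefficients in that subspace, for \<open>T (I - z W)\<inverse> h = \<Sum> z\<^sup>n T W\<^sup>n h\<close>.  The constant term is the
  limit at \<open>0\<close>; subtracting it and dividing by \<open>z\<close> replaces \<open>T\<close> by \<open>T W\<close>, so the argument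
  can be repeated.\<close>

lemma resolvent_orbit_in_closed_subspace:
  fixes T :: "'a::complex_banach \<Rightarrow>\<^sub>B 'e::complex_normed_vector"
  assumes W: "\<And>x. norm (capply W x) \<le> norm x"
    and S: "closed S" "0 \<in> S" "\<And>x y. x \<in> S \<Longrightarrow> y \<in> S \<Longrightarrow> x + y \<in> S" "\<And>c x. x \<in> S \<Longrightarrow> c *\<^sub>C x \<in> S"
    and r: "0 < r" and near: "\<And>z. z \<noteq> 0 \<Longrightarrow> cmod z < r \<Longrightarrow> T (cinv (cid - z *\<^sub>C W) h) \<in> S"
    and z: "cmod z < 1"
  shows "T (cinv (cid - z *\<^sub>C W) h) \<in> S"
proof -
  define R where "R z = cinv (cid - z *\<^sub>C W) h" for z
  define r' where "r' = min r 1"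
  have r': "0 < r'" using r by (simp add: r'_def)
  have R: "R z = h + z *\<^sub>C W (R z)" if "cmod z < 1" for z
    using resolvent_contraction(1)[OF W that, of h] by (simp add: R_def algebra_simps)
  define near_S where "near_S T \<longleftrightarrow> (\<forall>z. z \<noteq> 0 \<longrightarrow> cmod z < r' \<longrightarrow> capply T (R z) \<in> S)"
    for T :: "'a \<Rightarrow>\<^sub>B 'e"
  have limit: "T h \<in> S" if T: "near_S T" for T
  proof (rule Lim_in_closed_set[OF S(1)])
    show "((\<lambda>z. T (R z)) \<longlongrightarrow> T h) (at 0)"
      unfolding R_def by (intro tendsto_capply resolvent_continuous_at_0 W)
    show "\<forall>\<^sub>F z in at 0. T (R z) \<in> S"
      using eventually_at_in_open[of "ball 0 r'" "0::complex"] r' T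
      by (auto elim!: eventually_mono simp: near_S_def)
  qed simp
  have step: "near_S (T o\<^sub>B W)" if T: "near_S T" for T
    unfolding near_S_def
  proof (intro allI impI)
    fix z :: complex assume z: "z \<noteq> 0" "cmod z < r'"
    have "T (R z) + (- 1) *\<^sub>C T h \<in> S"
      by (intro S limit[OF T]) (use T z in \<open>auto simp: near_S_def\<close>)
    then have "(1 / z) *\<^sub>C (T (R z) - T h) \<in> S" by (intro S) (simp add: scaleC_minus_left)
    moreover have "T (R z) - T h = z *\<^sub>C T (W (R z))"
    proof -
      have "R z - h = z *\<^sub>C W (R z)" using R[of z] z by (simp add: r'_def algebra_simps)
      then show ?thesis by (metis capply_diff capply_scaleC)
    qed
    ultimately show "(T o\<^sub>B W) (R z) \<in> S" using z by (simp add: scaleC_scaleC)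
  qed
  define U where "U n = ((\<lambda>T. T o\<^sub>B W) ^^ n) T" for n
  have U0: "U 0 = T" and USuc: "U (Suc n) = U n o\<^sub>B W" for n by (simp_all add: U_def)
  have "near_S T" using near by (simp add: near_S_def r'_def R_def)
  then have "near_S (U n)" for n by (induction n) (simp_all add: U0 USuc step)
  then have Uh: "U n h \<in> S" for n by (rule limit)
  have Ubd: "norm (U n x) \<le> norm T * norm x" for n x
  proof (induction n arbitrary: x)
    case 0 show ?case by (simp add: U0 norm_capply)
  next
    case (Suc n)
    have "norm (U n (W x)) \<le> norm T * norm (W x)" by (rule Suc)
    also have "\<dots> \<le> norm T * norm x" by (intro mult_left_mono W norm_ge_zero)
    finally show ?case by (simp add: USuc)
  qed
  define s where "s n = (\<Sum>k<n. z ^ k *\<^sub>C U k h)" for n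
  have sS: "s n \<in> S" for n by (induction n) (auto simp: s_def intro!: S Uh)
  have expand: "T (R z) = s n + z ^ n *\<^sub>C U n (R z)" for n
  proof (induction n)
    case 0 show ?case by (simp add: s_def U0)
  next
    case (Suc n)
    have "U n (R z) = U n h + z *\<^sub>C U (Suc n) (R z)"
      by (subst R[OF z]) (simp add: capply_add capply_scaleC USuc)
    with Suc show ?case by (simp add: s_def scaleC_add_right scaleC_scaleC mult.commute add.assoc)
  qed
  have "(\<lambda>n. z ^ n *\<^sub>C U n (R z)) \<longlonglongrightarrow> 0"
  proof (rule Lim_null_comparison)
    show "\<forall>\<^sub>F n in sequentially. norm (z ^ n *\<^sub>C U n (R z)) \<le> cmod z ^ n * (norm T * norm (R z))"
      by (intro always_eventually allI) (simp add: norm_scaleC norm_power Ubd mult_left_mono)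
    have "(\<lambda>n. cmod z ^ n * (norm T * norm (R z))) \<longlonglongrightarrow> 0 * (norm T * norm (R z))"
      by (intro tendsto_intros LIMSEQ_realpow_zero) (use z in auto)
    then show "(\<lambda>n. cmod z ^ n * (norm T * norm (R z))) \<longlonglongrightarrow> 0" by simp
  qed
  then have "(\<lambda>n. T (R z) - z ^ n *\<^sub>C U n (R z)) \<longlonglongrightarrow> T (R z) - 0" by (intro tendsto_intros)
  moreover have "T (R z) - z ^ n *\<^sub>C U n (R z) = s n" for n using expand[of n] by simp
  ultimately have "s \<longlonglongrightarrow> T (R z)" by simp
  then show ?thesis using closed_sequentially[OF S(1)] sS unfolding R_def by blast
qed

text \<open>An operator into \<open>B\<^sup>*\<^sup>*\<close> with values in the image of \<open>B\<close> is an operator into \<open>B\<close>, because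
  \<open>\<tau>\<close> is isometric.\<close>

lemma factor_through_natinj:
  fixes A :: "'a::complex_normed_vector \<Rightarrow>\<^sub>B 'b::complex_normed_vector cdual cdual"
  assumes "\<And>x. A x \<in> range (capply \<tau>)"
  obtains B where "A = \<tau> o\<^sub>B B"
proof -
  have "\<exists>b. A x = \<tau> b" for x using assms[of x] by blast
  then obtain B where B: "\<And>x. A x = \<tau> (B x)" by metis
  have "bounded_clinear B"
    unfolding bounded_clinear_def
  proof (intro conjI allI exI[of _ "norm A"])
    have "\<tau> (B (x + y)) = \<tau> (B x + B y)" for x y by (simp add: capply_add flip: B)
    then show "B (x + y) = B x + B y" for x y by simp
    have "\<tau> (B (c *\<^sub>C x)) = \<tau> (c *\<^sub>C B x)" for c x by (simp add: capply_scaleC flip: B)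
    then show "B (c *\<^sub>C x) = c *\<^sub>C B x" for c x by simp
    show "norm (B x) \<le> norm A * norm x" for x
      using norm_capply[of A x] by (simp add: B norm_natinj)
  qed
  then have "A = \<tau> o\<^sub>B mk_op B" by (intro cblinfun_eqI) (simp add: capply_mk_op B)
  then show thesis by (rule that)
qed

text \<open>The resolvent identity \<open>R(w) - R(z) = (w - z) R(w) W R(z)\<close>, applied twice, shows that
  \<open>R(z) W R(z)\<close> is the derivative of \<open>R\<close>, with a quadratic error.\<close>

lemma resolvent_second_difference:
  fixes W :: "'a::complex_banach \<Rightarrow>\<^sub>B 'a"
  assumes W: "\<And>x. norm (W x) \<le> norm x" and z: "cmod z < 1" and w: "cmod w < 1"
  defines "R \<equiv> \<lambda>z. capply (cinv (cid - z *\<^sub>C W))"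
  shows "norm (R w h - R z h - (w - z) *\<^sub>C R z (W (R z h)))
    \<le> (cmod (w - z))\<^sup>2 * (norm h / (1 - cmod z)\<^sup>2 / (1 - cmod w))"
proof -
  have bd: "norm (R z x) \<le> norm x / (1 - cmod z)" if "cmod z < 1" for z x
    unfolding R_def by (rule resolvent_contraction(3)[OF W that])
  have bdW: "norm (R z (W x)) \<le> norm x / (1 - cmod z)" if "cmod z < 1" for z x
  proof -
    have "norm (R z (W x)) \<le> norm (W x) / (1 - cmod z)" by (rule bd[OF that])
    also have "\<dots> \<le> norm x / (1 - cmod z)" using that by (intro divide_right_mono W) simp
    finally show ?thesis .
  qed
  have identity: "R w h - R z h = (w - z) *\<^sub>C R w (W (R z h))" for h
  proof -
    have eqs: "R w h - w *\<^sub>C W (R w h) = h" "R z h - z *\<^sub>C W (R z h) = h"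
      unfolding R_def using resolvent_contraction(1)[OF W w] resolvent_contraction(1)[OF W z] by simp_all
    have d: "R w h - R z h = w *\<^sub>C W (R w h) - z *\<^sub>C W (R z h)"
      using eqs by (metis add_diff_cancel_left diff_add_cancel)
    have "(R w h - R z h) - w *\<^sub>C W (R w h - R z h)
        = (R w h - R z h) - (w *\<^sub>C W (R w h) - w *\<^sub>C W (R z h))"
      by (simp only: capply_diff scaleC_diff_right)
    also have "\<dots> = (w - z) *\<^sub>C W (R z h)" by (simp add: d scaleC_diff_left)
    finally have "(w - z) *\<^sub>C W (R z h) = (R w h - R z h) - w *\<^sub>C W (R w h - R z h)" by (rule sym)
    then have "R w ((w - z) *\<^sub>C W (R z h)) = R w h - R z h"
      unfolding R_def using resolvent_contraction(2)[OF W w] by simp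
    then show ?thesis by (simp add: R_def capply_scaleC)
  qed
  have "R w h - R z h - (w - z) *\<^sub>C R z (W (R z h))
      = (w - z) *\<^sub>C (R w (W (R z h)) - R z (W (R z h)))"
    by (simp only: identity[of h] scaleC_diff_right)
  also have "\<dots> = (w - z) *\<^sub>C (w - z) *\<^sub>C R w (W (R z (W (R z h))))" by (simp only: identity)
  also have "norm \<dots> = (cmod (w - z))\<^sup>2 * norm (R w (W (R z (W (R z h)))))"
    by (simp add: norm_scaleC power2_eq_square mult.assoc)
  also have "\<dots> \<le> (cmod (w - z))\<^sup>2 * (norm h / (1 - cmod z)\<^sup>2 / (1 - cmod w))"
  proof (intro mult_left_mono)
    have "norm (R w (W (R z (W (R z h))))) \<le> norm (R z (W (R z h))) / (1 - cmod w)" by (rule bdW[OF w])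
    also have "\<dots> \<le> norm (R z h) / (1 - cmod z) / (1 - cmod w)"
      using w by (intro divide_right_mono bdW[OF z]) simp
    also have "\<dots> \<le> norm h / (1 - cmod z) / (1 - cmod z) / (1 - cmod w)"
      using w z by (intro divide_right_mono bd[OF z]) simp_all
    finally show "norm (R w (W (R z (W (R z h))))) \<le> norm h / (1 - cmod z)\<^sup>2 / (1 - cmod w)"
      by (simp add: power2_eq_square)
  qed simp
  finally show ?thesis .
qed

text \<open>The function \<open>F\<close>, given by the second representation on the whole disk, satisfies
  \<open>F(z) = F(0) + 2 z C\<^sup>* V\<^sup>* (I - z V\<^sup>*)\<inverse> C\<close>.  On \<open>\<Omega>\<close> it has values in the
  range of \<open>\<tau>\<close>, hence on the whole disk.  Its derivative, a limit of difference quotients, does too,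
  so differentiability descends to the function \<open>\<psi>\<close> with \<open>F = \<tau> \<psi>\<close>.\<close>

lemma represents_analytic_extension:
  fixes \<phi> :: "complex \<Rightarrow> 'b::complex_banach cdual \<Rightarrow>\<^sub>B 'b" and V :: "'h::complex_hilbert \<Rightarrow>\<^sub>B 'h"
  assumes V: "isometric V" and op: "open \<Omega>" and 0: "0 \<in> \<Omega>" and \<Omega>: "\<Omega> \<subseteq> ball 0 1"
    and rep: "represents' \<Omega> \<phi> V C D"
  shows "\<exists>\<psi>. analytic_into \<psi> (ball 0 1) \<and> (\<forall>z\<in>\<Omega>. \<psi> z = \<phi> z)"
proof -
  define W where "W = hadj V"
  define R where "R z = capply (cinv (cid - z *\<^sub>C W))" for z
  define C' where "C' = adj_to_dual C"
  define F where "F z = adj_restr D + C' o\<^sub>B (cid + z *\<^sub>C W) o\<^sub>B cinv (cid - z *\<^sub>C W) o\<^sub>B C" for z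
  have W: "norm (W x) \<le> norm x" for x unfolding W_def by (rule norm_hadj_isometric[OF V])
  have R: "z *\<^sub>C W (R z h) = R z h - h" if "cmod z < 1" for z h
    using resolvent_contraction(1)[OF W that, of h] by (simp add: R_def algebra_simps)
  have F_apply: "F z x = adj_restr D x + C' (R z (C x) + z *\<^sub>C W (R z (C x)))" for z x
    by (simp add: F_def R_def capply_plus_op[of "adj_restr D"] capply_plus_op[of cid] capply_scaleC_op)
  have R0: "R 0 h = h" for h using R[of 0 h] by simp
  have F_R: "F z x = F 0 x + (2 * z) *\<^sub>C C' (W (R z (C x)))" if "cmod z < 1" for z x
  proof -
    have Rz: "R z (C x) = C x + z *\<^sub>C W (R z (C x))" using R[OF that, of "C x"] by simp
    have "F z x = adj_restr D x + C' (C x + z *\<^sub>C W (R z (C x)) + z *\<^sub>C W (R z (C x)))"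
      unfolding F_apply by (subst (1) Rz) (rule refl)
    also have "\<dots> = F 0 x + (z *\<^sub>C C' (W (R z (C x))) + z *\<^sub>C C' (W (R z (C x))))"
      by (simp add: F_apply R0 capply_add capply_scaleC add.assoc)
    also have "\<dots> = F 0 x + (2 * z) *\<^sub>C C' (W (R z (C x)))"
      by (simp flip: scaleC_add_left)
    finally show ?thesis .
  qed
  define S where "S = range (capply (\<tau> :: 'b \<Rightarrow>\<^sub>B 'b cdual cdual))"
  have S: "closed S" "0 \<in> S" "\<And>x y. x \<in> S \<Longrightarrow> y \<in> S \<Longrightarrow> x + y \<in> S" "\<And>c x. x \<in> S \<Longrightarrow> c *\<^sub>C x \<in> S"
  proof -
    show "closed S" unfolding S_def by (rule closed_range_natinj)
    show "0 \<in> S" unfolding S_def by (rule range_eqI[of _ _ 0]) simp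
  qed (auto simp: S_def simp flip: capply_add capply_scaleC)
  have Sdiff: "x - y \<in> S" if "x \<in> S" "y \<in> S" for x y
    using S(3)[OF that(1) S(4)[OF that(2), of "-1"]] by (simp add: scaleC_minus_left)
  have F\<phi>: "F z = \<tau> o\<^sub>B \<phi> z" if "z \<in> \<Omega>" for z
    using rep that by (simp add: represents'_def F_def C'_def W_def)
  obtain r where r: "0 < r" "ball 0 r \<subseteq> \<Omega>" using op 0 open_contains_ball by blast
  have F0: "F 0 x \<in> S" for x using F\<phi>[OF 0] by (simp add: S_def)
  have FS: "F z x \<in> S" if z: "cmod z < 1" for z x
  proof -
    have "(C' o\<^sub>B W) (cinv (cid - z *\<^sub>C W) (C x)) \<in> S"
    proof (rule resolvent_orbit_in_closed_subspace[OF W S r(1) _ z])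
      fix u assume u: "u \<noteq> 0" "cmod u < r"
      then have u\<Omega>: "u \<in> \<Omega>" using r(2) by (auto simp: subset_iff)
      then have "cmod u < 1" using \<Omega> by auto
      then have "(2 * u) *\<^sub>C C' (W (R u (C x))) = F u x - F 0 x" by (simp add: F_R[of u])
      also have "\<dots> \<in> S" by (rule Sdiff) (use F\<phi>[OF u\<Omega>] F0 in \<open>simp_all add: S_def\<close>)
      finally have "(1 / (2 * u)) *\<^sub>C (2 * u) *\<^sub>C C' (W (R u (C x))) \<in> S" by (rule S(4))
      then show "(C' o\<^sub>B W) (cinv (cid - u *\<^sub>C W) (C x)) \<in> S" using u by (simp add: scaleC_scaleC R_def)
    qed
    then show ?thesis unfolding F_R[OF z] by (intro S F0) (simp add: R_def)
  qed
  have "\<exists>B. cmod z < 1 \<longrightarrow> F z = \<tau> o\<^sub>B B" for z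
    using factor_through_natinj[of "F z"] FS[of z] unfolding S_def by metis
  then obtain \<psi> where \<psi>: "\<And>z. cmod z < 1 \<Longrightarrow> F z = \<tau> o\<^sub>B \<psi> z" by metis
  have "\<exists>f'. (\<psi> has_derivative (\<lambda>h. h *\<^sub>C f')) (at z within ball 0 1)" if z: "cmod z < 1" for z
  proof -
    define F' where "F' = 2 *\<^sub>C (C' o\<^sub>B cinv (cid - z *\<^sub>C W) o\<^sub>B W o\<^sub>B cinv (cid - z *\<^sub>C W) o\<^sub>B C)"
    \<comment> \<open>For \<open>w\<close> within \<open>\<rho>\<close> of \<open>z\<close> the factor
        \<open>1 / (1 - cmod w)\<close> is at most \<open>1 / \<rho>\<close>.\<close>
    define \<rho> where "\<rho> = (1 - cmod z) / 2"
    define K where "K = 2 * (norm C' * (norm C / (1 - cmod z)\<^sup>2 / \<rho>))"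
    have \<rho>: "0 < \<rho>" using z by (simp add: \<rho>_def)
    have K: "0 \<le> K" using \<rho> by (simp add: K_def)
    have w1: "cmod w < 1" "\<rho> \<le> 1 - cmod w" if "dist w z < \<rho>" for w
    proof -
      have "cmod w \<le> cmod z + dist w z" using norm_triangle_ineq2[of w z] by (simp add: dist_norm)
      then show "cmod w < 1" "\<rho> \<le> 1 - cmod w" using that z by (simp_all add: \<rho>_def field_simps)
    qed
    have est: "norm (F w x - F z x - (w - z) *\<^sub>C F' x) \<le> K * (cmod (w - z))\<^sup>2 * norm x"
      if w: "dist w z < \<rho>" for w x
    proof -
      define e where "e = R w (C x) - R z (C x) - (w - z) *\<^sub>C R z (W (R z (C x)))"
      have FR2: "F u x = adj_restr D x + C' (2 *\<^sub>C R u (C x) - C x)" if "cmod u < 1" for u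
        unfolding F_apply R[OF that] using scaleC_add_left[of 1 1 "R u (C x)"] by (simp add: algebra_simps)
      have "F w x - F z x - (w - z) *\<^sub>C F' x = 2 *\<^sub>C C' e"
        unfolding FR2[OF z] FR2[OF w1(1)[OF w]]
        by (simp add: F'_def e_def R_def capply_scaleC_op capply_diff capply_scaleC scaleC_diff_right
            scaleC_scaleC mult.commute)
      then have "norm (F w x - F z x - (w - z) *\<^sub>C F' x) = 2 * norm (C' e)" by (simp add: norm_scaleC)
      also have "\<dots> \<le> 2 * (norm C' * norm e)" by (intro mult_left_mono norm_capply) simp
      also have "\<dots> \<le> 2 * (norm C' * ((cmod (w - z))\<^sup>2 * ((norm C * norm x) / (1 - cmod z)\<^sup>2 / \<rho>)))"
      proof (intro mult_left_mono)
        have "norm e \<le> (cmod (w - z))\<^sup>2 * (norm (C x) / (1 - cmod z)\<^sup>2 / (1 - cmod w))"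
          unfolding e_def R_def by (rule resolvent_second_difference[OF W z w1(1)[OF w]])
        also have "\<dots> \<le> (cmod (w - z))\<^sup>2 * ((norm C * norm x) / (1 - cmod z)\<^sup>2 / \<rho>)"
          using \<rho> w1[OF w] by (intro mult_left_mono frac_le divide_right_mono norm_capply) simp_all
        finally show "norm e \<le> (cmod (w - z))\<^sup>2 * ((norm C * norm x) / (1 - cmod z)\<^sup>2 / \<rho>)" .
      qed simp_all
      also have "\<dots> = K * (cmod (w - z))\<^sup>2 * norm x" by (simp add: K_def)
      finally show ?thesis .
    qed
    have F'S: "F' x \<in> S" for x
    proof (rule Lim_in_closed_set[OF S(1)])
      have ev: "\<forall>\<^sub>F w in at z. w \<noteq> z \<and> dist w z < \<rho>"
        using \<rho> by (auto simp: eventually_at)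
      show "\<forall>\<^sub>F w in at z. (1 / (w - z)) *\<^sub>C (F w x - F z x) \<in> S"
        using ev by (rule eventually_mono) (intro S(4) Sdiff FS z w1(1), simp)
      have "\<forall>\<^sub>F w in at z. norm ((1 / (w - z)) *\<^sub>C (F w x - F z x) - F' x) \<le> K * cmod (w - z) * norm x"
        using ev
      proof (rule eventually_mono)
        fix w assume w: "w \<noteq> z \<and> dist w z < \<rho>"
        have "(1 / (w - z)) *\<^sub>C (F w x - F z x) - F' x
            = (1 / (w - z)) *\<^sub>C (F w x - F z x - (w - z) *\<^sub>C F' x)"
          using w by (simp add: scaleC_diff_right scaleC_scaleC)
        then have "norm ((1 / (w - z)) *\<^sub>C (F w x - F z x) - F' x)
            = norm (F w x - F z x - (w - z) *\<^sub>C F' x) / cmod (w - z)"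
          by (simp add: norm_scaleC norm_divide)
        also have "\<dots> \<le> (K * (cmod (w - z))\<^sup>2 * norm x) / cmod (w - z)"
          using est w by (intro divide_right_mono) auto
        also have "\<dots> = K * cmod (w - z) * norm x" using w by (simp add: power2_eq_square)
        finally show "norm ((1 / (w - z)) *\<^sub>C (F w x - F z x) - F' x) \<le> K * cmod (w - z) * norm x" .
      qed
      moreover have "((\<lambda>w. K * cmod (w - z) * norm x) \<longlongrightarrow> K * cmod (z - z) * norm x) (at z)"
        by (intro tendsto_intros)
      ultimately have "((\<lambda>w. (1 / (w - z)) *\<^sub>C (F w x - F z x) - F' x) \<longlongrightarrow> 0) (at z)"
        by (intro Lim_null_comparison[of "\<lambda>w. (1 / (w - z)) *\<^sub>C (F w x - F z x) - F' x"]) simp_all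
      then show "((\<lambda>w. (1 / (w - z)) *\<^sub>C (F w x - F z x)) \<longlongrightarrow> F' x) (at z)"
        using Lim_null by blast
    qed simp
    then obtain f' where f': "F' = \<tau> o\<^sub>B f'"
      using factor_through_natinj[of F'] unfolding S_def by blast
    have "(\<psi> has_derivative (\<lambda>h. h *\<^sub>C f')) (at z within ball 0 1)"
    proof (rule has_derivativeI_sandwich[OF \<rho>])
      show "bounded_linear (\<lambda>h. h *\<^sub>C f')"
        by (rule bounded_bilinear.bounded_linear_left[OF bounded_bilinear_scaleC])
      have "((\<lambda>w. K * cmod (w - z)) \<longlongrightarrow> K * cmod (z - z)) (at z within ball 0 1)"
        by (intro tendsto_intros)
      then show "((\<lambda>w. K * cmod (w - z)) \<longlongrightarrow> 0) (at z within ball 0 1)" by simp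
      fix w assume w: "w \<in> ball 0 1" "w \<noteq> z" "dist w z < \<rho>"
      have "norm (\<psi> w - \<psi> z - (w - z) *\<^sub>C f') \<le> K * (cmod (w - z))\<^sup>2"
      proof (rule norm_cblinfun_bound)
        fix x
        have "\<tau> ((\<psi> w - \<psi> z - (w - z) *\<^sub>C f') x) = F w x - F z x - (w - z) *\<^sub>C F' x"
          using w(1) by (simp add: \<psi>[OF z] \<psi>[of w] f' capply_minus_op capply_scaleC_op capply_diff capply_scaleC)
        then show "norm ((\<psi> w - \<psi> z - (w - z) *\<^sub>C f') x) \<le> K * (cmod (w - z))\<^sup>2 * norm x"
          using est[OF w(3), of x] by (metis norm_natinj)
      qed (simp add: K)
      then have "norm (\<psi> w - \<psi> z - (w - z) *\<^sub>C f') / norm (w - z) \<le> (K * (cmod (w - z))\<^sup>2) / norm (w - z)"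
        by (intro divide_right_mono) auto
      then show "norm (\<psi> w - \<psi> z - (w - z) *\<^sub>C f') / norm (w - z) \<le> K * cmod (w - z)"
        using w(2) by (simp add: power2_eq_square)
    qed
    then show ?thesis ..
  qed
  moreover have "\<psi> z = \<phi> z" if z: "z \<in> \<Omega>" for z
  proof (rule cblinfun_eqI)
    fix x
    have "cmod z < 1" using z \<Omega> by auto
    then have "\<tau> o\<^sub>B \<psi> z = \<tau> o\<^sub>B \<phi> z" using \<psi> F\<phi>[OF z] by metis
    then have "\<tau> (\<psi> z x) = \<tau> (\<phi> z x)" by (metis ccomp_apply)
    then show "\<psi> z x = \<phi> z x" by simp
  qed
  ultimately show ?thesis
    unfolding analytic_into_def by (intro exI[of _ \<psi>]) (simp add: mem_ball)
qed

lemma represents_imp_caratheodory: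
  assumes "isometric V" "purely_imaginary D" "represents \<Omega> \<phi> V C D"
    and "\<Omega> \<subseteq> ball 0 1" and "weakly_continuous_at_0' \<Omega> \<phi>"
  shows "caratheodory' \<Omega> \<phi>"
  using represents_positive_kernel[OF assms(1-4)] assms(5)
  by (simp add: caratheodory'_def caratheodory_def weakly_continuous_at_0'_def)

theorem theorem6p1:
  fixes \<Omega> :: "complex set"
    and \<phi> :: "complex \<Rightarrow> 'b::complex_banach cdual \<Rightarrow>\<^sub>B 'b"
  assumes "open \<Omega>" and "0 \<in> \<Omega>" and "\<Omega> \<subseteq> ball 0 1"
    and "weakly_continuous_at_0' \<Omega> \<phi>"
  shows "(caratheodory' \<Omega> \<phi> \<longleftrightarrow>
      (\<exists>(V :: (complex \<Rightarrow> 'b cdual cdual) ell2 \<Rightarrow>\<^sub>B _) C D.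
        isometric V \<and> purely_imaginary D \<and> represents \<Omega> \<phi> V C D))
    \<and> ((\<exists>(V :: 'h::complex_hilbert \<Rightarrow>\<^sub>B 'h) C D.
        isometric V \<and> purely_imaginary D \<and> represents \<Omega> \<phi> V C D) \<longrightarrow> caratheodory' \<Omega> \<phi>)
    \<and> (\<forall>(V :: 'h \<Rightarrow>\<^sub>B 'h) C D. isometric V \<and> purely_imaginary D \<longrightarrow>
        (represents \<Omega> \<phi> V C D \<longleftrightarrow> represents' \<Omega> \<phi> V C D))
    \<and> (caratheodory' \<Omega> \<phi> \<longrightarrow>
        (\<exists>\<psi>. analytic_into \<psi> (ball 0 1) \<and> (\<forall>z\<in>\<Omega>. \<psi> z = \<phi> z)))"
proof -
  have necessary: "\<exists>(V :: (complex \<Rightarrow> 'b cdual cdual) ell2 \<Rightarrow>\<^sub>B _) C D.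
      isometric V \<and> purely_imaginary D \<and> represents \<Omega> \<phi> V C D" if "caratheodory' \<Omega> \<phi>"
    by (rule caratheodory_imp_represents[OF assms(1-3) that]) blast
  have "caratheodory' \<Omega> \<phi> \<longleftrightarrow> (\<exists>(V :: (complex \<Rightarrow> 'b cdual cdual) ell2 \<Rightarrow>\<^sub>B _) C D.
      isometric V \<and> purely_imaginary D \<and> represents \<Omega> \<phi> V C D)"
  proof
    assume "\<exists>(V :: (complex \<Rightarrow> 'b cdual cdual) ell2 \<Rightarrow>\<^sub>B _) C D.
      isometric V \<and> purely_imaginary D \<and> represents \<Omega> \<phi> V C D"
    then obtain V :: "(complex \<Rightarrow> 'b cdual cdual) ell2 \<Rightarrow>\<^sub>B _" and C D
      where "isometric V" "purely_imaginary D" "represents \<Omega> \<phi> V C D" by (elim exE conjE)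
    then show "caratheodory' \<Omega> \<phi>" by (rule represents_imp_caratheodory[OF _ _ _ assms(3,4)])
  qed (rule necessary)
  moreover have "(\<exists>(V :: 'h \<Rightarrow>\<^sub>B 'h) C D.
      isometric V \<and> purely_imaginary D \<and> represents \<Omega> \<phi> V C D) \<longrightarrow> caratheodory' \<Omega> \<phi>"
  proof
    assume "\<exists>(V :: 'h \<Rightarrow>\<^sub>B 'h) C D. isometric V \<and> purely_imaginary D \<and> represents \<Omega> \<phi> V C D"
    then obtain V :: "'h \<Rightarrow>\<^sub>B 'h" and C D
      where "isometric V" "purely_imaginary D" "represents \<Omega> \<phi> V C D" by (elim exE conjE)
    then show "caratheodory' \<Omega> \<phi>" by (rule represents_imp_caratheodory[OF _ _ _ assms(3,4)])
  qed
  moreover have "\<forall>(V :: 'h \<Rightarrow>\<^sub>B 'h) C D. isometric V \<and> purely_imaginary D \<longrightarrow>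
      (represents \<Omega> \<phi> V C D \<longleftrightarrow> represents' \<Omega> \<phi> V C D)"
    by (intro allI impI represents_iff_represents' assms(3)) (erule conjunct1)
  moreover have "caratheodory' \<Omega> \<phi> \<longrightarrow>
      (\<exists>\<psi>. analytic_into \<psi> (ball 0 1) \<and> (\<forall>z\<in>\<Omega>. \<psi> z = \<phi> z))"
  proof
    assume car: "caratheodory' \<Omega> \<phi>"
    obtain V :: "(complex \<Rightarrow> 'b cdual cdual) ell2 \<Rightarrow>\<^sub>B _" and C D
      where V: "isometric V" and "represents \<Omega> \<phi> V C D"
      using necessary[OF car] by (elim exE conjE)
    then have "represents' \<Omega> \<phi> V C D" by (simp only: represents_iff_represents'[OF V assms(3)])
    then show "\<exists>\<psi>. analytic_into \<psi> (ball 0 1) \<and> (\<forall>z\<in>\<Omega>. \<psi> z = \<phi> z)"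
      by (rule represents_analytic_extension[OF V assms(1-3)])
  qed
  ultimately show ?thesis by (intro conjI)
qed

end
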